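(* Given any proof $\Pi$ of a formula $\alpha$ in system $\mathsf{SKS}$, one can construct a proof of $\alpha$ in analytic $\mathsf{SKS}$, i.e. in $\mathsf{aSKS}=\mathsf{SKS}\setminus\{\mathsf{ai}{\uparrow},\mathsf{aw}{\uparrow}\}$, in time quasipolynomial in the size of $\Pi$.
   Context: Formulae are built from the units $\mathsf f,\mathsf t$ and atoms $a,b,\dots$ (with a non-identical involution $a\mapsto\bar a$; negation exists only on atoms) by disjunction $[\alpha\vee\beta]$ and conjunction $(\alpha\wedge\beta)$. A context $\xi\{\ \}$ is a formula with one hole. A rule with premiss $\alpha$ and conclusion $\beta$ generates inference steps from $\xi\{\gamma\}$ to $\xi\{\delta\}$ for any instance $\gamma,\delta$ of $\alpha,\beta$ and any context $\xi$ (deep inference). A derivation is a finite chain of inference steps; a proof is a derivation with premiss $\mathsf t$. System $\mathsf{SKS}$ consists of: atomic identity $\mathsf{ai}{\downarrow}$: $\mathsf t\to[a\vee\bar a]$; atomic weakening $\mathsf{aw}{\downarrow}$: $\mathsf f\to a$; atomic contraction $\mathsf{ac}{\downarrow}$: $[a\vee a]\to a$; atomic cut $\mathsf{ai}{\uparrow}$: $(a\wedge\bar a)\to\mathsf f$; atomic coweakening $\mathsf{aw}{\uparrow}$: $a\to\mathsf t$; atomic cocontraction $\mathsf{ac}{\uparrow}$: $a\to(a\wedge a)$; switch $\mathsf s$: $(\alpha\wedge[\beta\vee\gamma])\to[(\alpha\wedge\beta)\vee\gamma]$; medial $\mathsf m$: $[(\alpha\wedge\beta)\vee(\gamma\wedge\delta)]\to([\alpha\vee\gamma]\wedge[\beta\vee\delta])$;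 and the equality rule $=$ (replace a formula by one equal modulo associativity and commutativity of $\vee,\wedge$ and $[\alpha\vee\mathsf f]=\alpha$, $(\alpha\wedge\mathsf t)=\alpha$, $[\mathsf t\vee\mathsf t]=\mathsf t$, $(\mathsf f\wedge\mathsf f)=\mathsf f$, closed under contexts), which is present in every subsystem. The size of a proof is the number of unit and atom occurrences in it. Quasipolynomial time means time bounded by $2^{(\log n)^{O(1)}}$ in the input size $n$. *)

theory Defs
  imports Complex_Main
begin

section \<open>Formulae, contexts and the rules of SKS\<close>

text \<open>The type \<open>'a\<close> is the set of all atoms, both \<open>a\<close> and its dual; the involution on atoms is a
  parameter \<open>bar\<close>. Formulae are plain binary trees: associativity, commutativity and the unit laws
  are only available through the rule \<open>=\<close>.\<close>

datatype 'a form =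
    FF
  | TT
  | Atom 'a
  | Disj "'a form" "'a form"
  | Conj "'a form" "'a form"

datatype 'a ctxt =
    Hole
  | DisjL "'a ctxt" "'a form"
  | DisjR "'a form" "'a ctxt"
  | ConjL "'a ctxt" "'a form"
  | ConjR "'a form" "'a ctxt"

primrec plug :: "'a ctxt \<Rightarrow> 'a form \<Rightarrow> 'a form" where
  "plug Hole \<gamma> = \<gamma>"
| "plug (DisjL \<xi> \<beta>) \<gamma> = Disj (plug \<xi> \<gamma>) \<beta>"
| "plug (DisjR \<alpha> \<xi>) \<gamma> = Disj \<alpha> (plug \<xi> \<gamma>)"
| "plug (ConjL \<xi> \<beta>) \<gamma> = Conj (plug \<xi> \<gamma>) \<beta>"
| "plug (ConjR \<alpha> \<xi>) \<gamma> = Conj \<alpha> (plug \<xi> \<gamma>)"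

inductive form_eq :: "'a form \<Rightarrow> 'a form \<Rightarrow> bool" where
  refl: "form_eq \<alpha> \<alpha>"
| sym: "form_eq \<alpha> \<beta> \<Longrightarrow> form_eq \<beta> \<alpha>"
| trans: "form_eq \<alpha> \<beta> \<Longrightarrow> form_eq \<beta> \<gamma> \<Longrightarrow> form_eq \<alpha> \<gamma>"
| ctxt: "form_eq \<alpha> \<beta> \<Longrightarrow> form_eq (plug \<xi> \<alpha>) (plug \<xi> \<beta>)"
| disj_comm: "form_eq (Disj \<alpha> \<beta>) (Disj \<beta> \<alpha>)"
| conj_comm: "form_eq (Conj \<alpha> \<beta>) (Conj \<beta> \<alpha>)"
| disj_assoc: "form_eq (Disj (Disj \<alpha> \<beta>) \<gamma>) (Disj \<alpha> (Disj \<beta> \<gamma>))"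
| conj_assoc: "form_eq (Conj (Conj \<alpha> \<beta>) \<gamma>) (Conj \<alpha> (Conj \<beta> \<gamma>))"
| disj_FF: "form_eq (Disj \<alpha> FF) \<alpha>"
| conj_TT: "form_eq (Conj \<alpha> TT) \<alpha>"
| disj_TT: "form_eq (Disj TT TT) TT"
| conj_FF: "form_eq (Conj FF FF) FF"

datatype rule =
    AiDown | AwDown | AcDown | AiUp | AwUp | AcUp | Switch | Medial | Equality

text \<open>\<open>rule_inst bar \<rho> \<gamma> \<delta>\<close>: the rule \<open>\<rho>\<close> has an instance with premiss \<open>\<gamma>\<close> and conclusion \<open>\<delta>\<close>.\<close>

inductive rule_inst :: "('a \<Rightarrow> 'a) \<Rightarrow> rule \<Rightarrow> 'a form \<Rightarrow> 'a form \<Rightarrow> bool"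
  for bar :: "'a \<Rightarrow> 'a" where
  ai_down: "rule_inst bar AiDown TT (Disj (Atom a) (Atom (bar a)))"
| aw_down: "rule_inst bar AwDown FF (Atom a)"
| ac_down: "rule_inst bar AcDown (Disj (Atom a) (Atom a)) (Atom a)"
| ai_up: "rule_inst bar AiUp (Conj (Atom a) (Atom (bar a))) FF"
| aw_up: "rule_inst bar AwUp (Atom a) TT"
| ac_up: "rule_inst bar AcUp (Atom a) (Conj (Atom a) (Atom a))"
| switch: "rule_inst bar Switch (Conj \<alpha> (Disj \<beta> \<gamma>)) (Disj (Conj \<alpha> \<beta>) \<gamma>)"
| medial: "rule_inst bar Medial (Disj (Conj \<alpha> \<beta>) (Conj \<gamma> \<delta>)) (Conj (Disj \<alpha> \<gamma>) (Disj \<beta> \<delta>))"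
| equality: "form_eq \<alpha> \<beta> \<Longrightarrow> rule_inst bar Equality \<alpha> \<beta>"

inductive inference_step :: "('a \<Rightarrow> 'a) \<Rightarrow> rule \<Rightarrow> 'a form \<Rightarrow> 'a form \<Rightarrow> bool"
  for bar :: "'a \<Rightarrow> 'a" where
  "rule_inst bar \<rho> \<gamma> \<delta> \<Longrightarrow> inference_step bar \<rho> (plug \<xi> \<gamma>) (plug \<xi> \<delta>)"

definition SKS :: "rule set" where
  "SKS = UNIV"

definition aSKS :: "rule set" where
  "aSKS = SKS - {AiUp, AwUp}"


section \<open>Derivations and proofs\<close>

text \<open>A derivation is its premiss together with the successive inference steps, each given by the
  name of its rule and the formula it leads to.\<close>

type_synonym 'a deriv = "'a form \<times> (rule \<times> 'a form) list"

fun chain :: "('a \<Rightarrow> 'a) \<Rightarrow> rule set \<Rightarrow> 'a form \<Rightarrow> (rule \<times> 'a form) list \<Rightarrow> 'a form \<Rightarrow> bool" where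
  "chain bar S \<alpha> [] \<beta> \<longleftrightarrow> \<alpha> = \<beta>"
| "chain bar S \<alpha> ((\<rho>, \<gamma>) # steps) \<beta> \<longleftrightarrow>
     \<rho> \<in> S \<and> inference_step bar \<rho> \<alpha> \<gamma> \<and> chain bar S \<gamma> steps \<beta>"

definition is_derivation ::
  "('a \<Rightarrow> 'a) \<Rightarrow> rule set \<Rightarrow> 'a deriv \<Rightarrow> 'a form \<Rightarrow> 'a form \<Rightarrow> bool" where
  "is_derivation bar S \<Phi> \<alpha> \<beta> \<longleftrightarrow> fst \<Phi> = \<alpha> \<and> chain bar S \<alpha> (snd \<Phi>) \<beta>"

definition is_proof :: "('a \<Rightarrow> 'a) \<Rightarrow> rule set \<Rightarrow> 'a deriv \<Rightarrow> 'a form \<Rightarrow> bool" where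
  "is_proof bar S \<Pi> \<alpha> \<longleftrightarrow> is_derivation bar S \<Pi> TT \<alpha>"

primrec form_size :: "'a form \<Rightarrow> nat" where
  "form_size FF = 1"
| "form_size TT = 1"
| "form_size (Atom a) = 1"
| "form_size (Disj \<alpha> \<beta>) = form_size \<alpha> + form_size \<beta>"
| "form_size (Conj \<alpha> \<beta>) = form_size \<alpha> + form_size \<beta>"

definition deriv_size :: "'a deriv \<Rightarrow> nat" where
  "deriv_size \<Phi> = form_size (fst \<Phi>) + (\<Sum>(\<rho>, \<beta>)\<leftarrow>snd \<Phi>. form_size \<beta>)"


section \<open>Model of computation\<close>

text \<open>Time is measured on first-order recursive programs over binary trees whose leaves are the
  empty tree or an atom (Lisp without side effects). A program is a finite list of function bodies.
  Programs contain no atoms as constants: an atom is a token that can only be copied, tested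
  for equality and dualised. So an atom occurrence counts one, as in the size of a formula.\<close>

datatype 'a data =
    Null
  | Tok 'a
  | Node "'a data" "'a data"

primrec data_size :: "'a data \<Rightarrow> nat" where
  "data_size Null = 1"
| "data_size (Tok a) = 1"
| "data_size (Node u v) = 1 + data_size u + data_size v"

datatype expr =
    Var nat
  | NullE
  | NodeE expr expr
  | Fst expr
  | Snd expr
  | Bar expr
  | IsTok expr
  | Eq expr expr
  | Cond expr expr expr
  | LetIn expr expr
  | Call nat "expr list"

type_synonym program = "expr list"

fun data_fst :: "'a data \<Rightarrow> 'a data" where
  "data_fst (Node u v) = u"
| "data_fst _ = Null"

fun data_snd :: "'a data \<Rightarrow> 'a data" where
  "data_snd (Node u v) = v"
| "data_snd _ = Null"

fun data_bar :: "('a \<Rightarrow> 'a) \<Rightarrow> 'a data \<Rightarrow> 'a data" where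
  "data_bar bar (Tok a) = Tok (bar a)"
| "data_bar bar _ = Null"

definition truth :: "bool \<Rightarrow> 'a data" where
  "truth b = (if b then Node Null Null else Null)"

fun is_tok :: "'a data \<Rightarrow> bool" where
  "is_tok (Tok a) \<longleftrightarrow> True"
| "is_tok _ \<longleftrightarrow> False"

text \<open>\<open>eval bar P env e v t\<close>: under call by value, \<open>e\<close> evaluates to \<open>v\<close> in time \<open>t\<close>, where variables
  are de Bruijn indices into \<open>env\<close>. Every evaluation of a subexpression is charged the size of its
  value. Hence \<open>t\<close> bounds the total size of all the data that is produced, and \<open>t\<close> is polynomially
  related to the time of a Turing machine; in particular, comparing two trees with \<open>Eq\<close> is paid for
  by the evaluation of its arguments, and a large output cannot be hidden by sharing.\<close>

inductive eval ::
    "('a \<Rightarrow> 'a) \<Rightarrow> program \<Rightarrow> 'a data list \<Rightarrow> expr \<Rightarrow> 'a data \<Rightarrow> nat \<Rightarrow> bool"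
  and evals ::
    "('a \<Rightarrow> 'a) \<Rightarrow> program \<Rightarrow> 'a data list \<Rightarrow> expr list \<Rightarrow> 'a data list \<Rightarrow> nat \<Rightarrow> bool"
  for bar :: "'a \<Rightarrow> 'a" and P :: program where
  Var: "i < length env \<Longrightarrow> eval bar P env (Var i) (env ! i) (data_size (env ! i))"
| NullE: "eval bar P env NullE Null 1"
| NodeE: "eval bar P env e1 u s \<Longrightarrow> eval bar P env e2 v t \<Longrightarrow>
    eval bar P env (NodeE e1 e2) (Node u v) (s + t + data_size (Node u v))"
| Fst: "eval bar P env e v t \<Longrightarrow>
    eval bar P env (Fst e) (data_fst v) (t + data_size (data_fst v))"
| Snd: "eval bar P env e v t \<Longrightarrow>
    eval bar P env (Snd e) (data_snd v) (t + data_size (data_snd v))"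
| Bar: "eval bar P env e v t \<Longrightarrow>
    eval bar P env (Bar e) (data_bar bar v) (t + data_size (data_bar bar v))"
| IsTok: "eval bar P env e v t \<Longrightarrow>
    eval bar P env (IsTok e) (truth (is_tok v)) (t + data_size (truth (is_tok v) :: 'a data))"
| Eq: "eval bar P env e1 u s \<Longrightarrow> eval bar P env e2 v t \<Longrightarrow>
    eval bar P env (Eq e1 e2) (truth (u = v)) (s + t + data_size (truth (u = v) :: 'a data))"
| Cond_true: "eval bar P env e u s \<Longrightarrow> u \<noteq> Null \<Longrightarrow> eval bar P env e1 v t \<Longrightarrow>
    eval bar P env (Cond e e1 e2) v (s + t + data_size v)"
| Cond_false: "eval bar P env e Null s \<Longrightarrow> eval bar P env e2 v t \<Longrightarrow>
    eval bar P env (Cond e e1 e2) v (s + t + data_size v)"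
| LetIn: "eval bar P env e1 u s \<Longrightarrow> eval bar P (u # env) e2 v t \<Longrightarrow>
    eval bar P env (LetIn e1 e2) v (s + t + data_size v)"
| Call: "i < length P \<Longrightarrow> evals bar P env es us s \<Longrightarrow> eval bar P us (P ! i) v t \<Longrightarrow>
    eval bar P env (Call i es) v (s + t + data_size v)"
| Nil: "evals bar P env [] [] 0"
| Cons: "eval bar P env e v s \<Longrightarrow> evals bar P env es vs t \<Longrightarrow>
    evals bar P env (e # es) (v # vs) (s + t)"

text \<open>The main function of a program is its first one.\<close>

definition computes_in_time ::
  "('a \<Rightarrow> 'a) \<Rightarrow> program \<Rightarrow> 'a data \<Rightarrow> 'a data \<Rightarrow> nat \<Rightarrow> bool" where
  "computes_in_time bar P input output t \<longleftrightarrow> eval bar P [input] (Call 0 [Var 0]) output t"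

text \<open>Evaluation is deterministic, so a short run cannot be the result of a lucky guess.\<close>

inductive_cases evalE:
  "eval bar P env (Var i) v t"
  "eval bar P env NullE v t"
  "eval bar P env (NodeE e1 e2) v t"
  "eval bar P env (Fst e) v t"
  "eval bar P env (Snd e) v t"
  "eval bar P env (Bar e) v t"
  "eval bar P env (IsTok e) v t"
  "eval bar P env (Eq e1 e2) v t"
  "eval bar P env (Cond e e1 e2) v t"
  "eval bar P env (LetIn e1 e2) v t"
  "eval bar P env (Call i es) v t"
  "evals bar P env [] vs t"
  "evals bar P env (e # es) vs t"

lemma eval_deterministic:
  "eval bar P env e v t \<Longrightarrow> eval bar P env e v' t' \<Longrightarrow> v' = v \<and> t' = t"
  "evals bar P env es vs t \<Longrightarrow> evals bar P env es vs' t' \<Longrightarrow> vs' = vs \<and> t' = t"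
proof (induction arbitrary: v' t' and vs' t' rule: eval_evals.inducts)
  case Var from Var.prems show ?case by (rule evalE) simp
next
  case NullE from NullE.prems show ?case by (rule evalE) simp
next
  case NodeE from NodeE.prems show ?case by (rule evalE) (auto dest!: NodeE.IH(2,4))
next
  case Fst from Fst.prems show ?case by (rule evalE) (auto dest!: Fst.IH(2))
next
  case Snd from Snd.prems show ?case by (rule evalE) (auto dest!: Snd.IH(2))
next
  case Bar from Bar.prems show ?case by (rule evalE) (auto dest!: Bar.IH(2))
next
  case IsTok from IsTok.prems show ?case by (rule evalE) (auto dest!: IsTok.IH(2))
next
  case Eq from Eq.prems show ?case by (rule evalE) (auto dest!: Eq.IH(2,4))
next
  case Cond_true from Cond_true.prems show ?case by (rule evalE) ((auto dest!: Cond_true.IH(2,4) simp: Cond_true.hyps))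
next
  case Cond_false from Cond_false.prems show ?case by (rule evalE) (auto dest!: Cond_false.IH(2,4))
next
  case LetIn from LetIn.prems show ?case by (rule evalE) (auto dest!: LetIn.IH(2,4))
next
  case Call from Call.prems show ?case by (rule evalE) (auto dest!: Call.IH(3,5))
next
  case Nil from Nil.prems show ?case by (rule evalE) simp
next
  case Cons from Cons.prems show ?case by (rule evalE) (auto dest!: Cons.IH(2,4))
qed

lemma computes_in_time_deterministic:
  "computes_in_time bar P x y t \<Longrightarrow> computes_in_time bar P x y' t' \<Longrightarrow> y' = y \<and> t' = t"
  unfolding computes_in_time_def by (rule eval_deterministic(1))


section \<open>Representing derivations as data\<close>

primrec tag :: "nat \<Rightarrow> 'a data" where
  "tag 0 = Null"
| "tag (Suc n) = Node Null (tag n)"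

primrec encode_list :: "('b \<Rightarrow> 'a data) \<Rightarrow> 'b list \<Rightarrow> 'a data" where
  "encode_list f [] = Null"
| "encode_list f (x # xs) = Node (f x) (encode_list f xs)"

primrec encode_form :: "'a form \<Rightarrow> 'a data" where
  "encode_form FF = tag 0"
| "encode_form TT = tag 1"
| "encode_form (Atom a) = Tok a"
| "encode_form (Disj \<alpha> \<beta>) = Node (tag 1) (Node (encode_form \<alpha>) (encode_form \<beta>))"
| "encode_form (Conj \<alpha> \<beta>) = Node (tag 2) (Node (encode_form \<alpha>) (encode_form \<beta>))"

primrec encode_rule :: "rule \<Rightarrow> 'a data" where
  "encode_rule AiDown = tag 0"
| "encode_rule AwDown = tag 1"
| "encode_rule AcDown = tag 2"
| "encode_rule AiUp = tag 3"
| "encode_rule AwUp = tag 4"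
| "encode_rule AcUp = tag 5"
| "encode_rule Switch = tag 6"
| "encode_rule Medial = tag 7"
| "encode_rule Equality = tag 8"

definition encode_deriv :: "'a deriv \<Rightarrow> 'a data" where
  "encode_deriv \<Phi> =
     Node (encode_form (fst \<Phi>))
       (encode_list (\<lambda>(\<rho>, \<beta>). Node (encode_rule \<rho>) (encode_form \<beta>)) (snd \<Phi>))"

lemma tag_inject [simp]: "tag m = tag n \<longleftrightarrow> m = n"
proof (induction m arbitrary: n)
  case 0
  then show ?case by (cases n) simp_all
next
  case (Suc m)
  then show ?case by (cases n) simp_all
qed

lemma encode_form_inject: "encode_form \<alpha> = encode_form \<beta> \<longleftrightarrow> \<alpha> = \<beta>"
proof (induction \<alpha> arbitrary: \<beta>)
  case FF then show ?case by (cases \<beta>) simp_all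
next
  case TT then show ?case by (cases \<beta>) simp_all
next
  case (Atom a) then show ?case by (cases \<beta>) simp_all
next
  case (Disj \<alpha>1 \<alpha>2) then show ?case by (cases \<beta>) (simp_all add: numeral_2_eq_2)
next
  case (Conj \<alpha>1 \<alpha>2) then show ?case by (cases \<beta>) (simp_all add: numeral_2_eq_2)
qed

lemma encode_rule_inject: "(encode_rule \<rho> :: 'a data) = encode_rule \<sigma> \<longleftrightarrow> \<rho> = \<sigma>"
  by (cases \<rho>; cases \<sigma>) (simp_all del: tag.simps)

lemma encode_list_inject:
  "(\<And>x y. f x = f y \<longleftrightarrow> x = y) \<Longrightarrow> encode_list f xs = encode_list f ys \<longleftrightarrow> xs = ys"
proof (induction xs arbitrary: ys)
  case Nil then show ?case by (cases ys) simp_all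
next
  case (Cons x xs) then show ?case by (cases ys) simp_all
qed

lemma encode_deriv_inject: "encode_deriv \<Phi> = encode_deriv \<Psi> \<longleftrightarrow> \<Phi> = \<Psi>"
proof -
  have "encode_list (\<lambda>(\<rho>, \<beta>). Node (encode_rule \<rho>) (encode_form \<beta>)) xs =
        encode_list (\<lambda>(\<rho>, \<beta>). Node (encode_rule \<rho>) (encode_form \<beta>)) ys \<longleftrightarrow> xs = ys"
    for xs ys :: "(rule \<times> 'a form) list"
    by (rule encode_list_inject) (auto simp: encode_rule_inject encode_form_inject)
  then show ?thesis
    by (simp add: encode_deriv_def encode_form_inject prod_eq_iff)
qed


section \<open>Quasipolynomial growth\<close>

definition quasipolynomial :: "(nat \<Rightarrow> nat) \<Rightarrow> bool" where
  "quasipolynomial T \<longleftrightarrow>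
     (\<exists>k::nat. \<forall>\<^sub>F n in sequentially. real (T n) \<le> 2 powr (log 2 (real n) ^ k))"

end

theory Submission
  imports Defs
begin

text \<open>Let \<open>\<alpha>\<close> be the conclusion, and choose one atom \<open>p\<close> of every dual pair that occurs in \<open>\<alpha>\<close>.
  Let \<open>\<theta>\<^sub>k\<close> say that at least \<open>k\<close> of the chosen atoms are true; built by divide and conquer it has
  size \<open>n\<close> to the power \<open>O(log n)\<close>. In the \<open>k\<close>-th copy of the given proof the negation of \<open>p\<close> is read as
  \<open>\<theta>\<^sub>k{p := f}\<close>, and an atom foreign to \<open>\<alpha>\<close> as a unit. Identity and cut turn into the derivations from
  \<open>\<theta>\<^sub>k\<close> to \<open>p \<or> \<theta>\<^sub>k{p := f}\<close> and from \<open>p \<and> \<theta>\<^sub>k{p := f}\<close> to \<open>\<theta>\<^sub>k\<^sub>+\<^sub>1\<close>, so the copy yields \<open>\<alpha> \<or> \<theta>\<^sub>k\<^sub>+\<^sub>1\<close> from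
  \<open>\<theta>\<^sub>k\<close>, and the copies compose from \<open>\<theta>\<^sub>0 = t\<close> up to the last threshold \<open>f\<close>. Coweakening is
  avoided because \<open>f \<and> p\<close> entails \<open>\<alpha>\<close> analytically whenever \<open>p\<close> occurs in \<open>\<alpha>\<close>, so whatever would have
  to be discarded can be absorbed by the alternative \<open>\<alpha>\<close>.\<close>

section \<open>Quasipolynomial bounds\<close>

text \<open>If exactly \<open>k\<close> of the chosen atoms are true, the negation of
  \<open>p\<close> is equivalent to the monotone formula \<open>\<theta>\<^sub>k{p := f}\<close>:
  this is the origin of the reading of negated atoms. A threshold only says that at least
  \<open>k\<close> atoms are true, and the excess escapes at each cut as
  \<open>\<theta>\<^sub>k\<^sub>+\<^sub>1\<close>. Absorption also explains the fate of atoms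
  foreign to \<alpha>: \<alpha> could not take them up, so they must vanish before anything has to
  be discarded. The other half of the proof has to exhibit an actual program. Time is charged by the
  size of the data produced, and the number of recursive calls is bounded by the input, so a
  recursion is fast as soon as the sizes of its results are bounded. Most constructions add one
  computable piece per call, and their bound comes for free. Only the thresholds and the derivations
  between consecutive ones multiply sizes from level to level of a tree, by a polynomial factor;
  balanced trees keep the number of levels logarithmic, and this is where the bound stops being
  polynomial.\<close>

definition lg :: "nat \<Rightarrow> nat" where
  "lg n = (LEAST m. n \<le> 2 ^ m)"

lemma lg_le_iff: "lg n \<le> m \<longleftrightarrow> n \<le> 2 ^ m"
proof
  assume "lg n \<le> m"
  have "n \<le> 2 ^ lg n"
    unfolding lg_def by (rule LeastI[of _ n]) (simp add: less_exp less_imp_le)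
  also have "\<dots> \<le> 2 ^ m" using \<open>lg n \<le> m\<close> by simp
  finally show "n \<le> 2 ^ m" .
next
  assume "n \<le> 2 ^ m"
  then show "lg n \<le> m" unfolding lg_def by (rule Least_le)
qed

lemma le_pow_lg: "n \<le> 2 ^ lg n"
  using lg_le_iff[of n "lg n"] by simp

lemma lg_mono: "m \<le> n \<Longrightarrow> lg m \<le> lg n"
  using lg_le_iff le_pow_lg le_trans by metis

text \<open>The reference quasipolynomials. Shifting the base by \<open>k\<close>, besides raising
  to the power \<open>k\<close>, makes the family monotone in \<open>k\<close> even where
  \<open>lg n\<close> is 0 or 1, so that the closure laws hold for every \<open>n\<close> and not
  only eventually.\<close>

definition bd :: "nat \<Rightarrow> nat \<Rightarrow> nat" where
  "bd k n = 2 ^ ((lg n + k) ^ k)"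

lemma bd_pos: "1 \<le> bd k n" by (simp add: bd_def)

lemma bd_mono: assumes "k \<le> k'" "n \<le> n'" shows "bd k n \<le> bd k' n'"
proof -
  have "(lg n + k) ^ k \<le> (lg n' + k') ^ k" using assms lg_mono by (intro power_mono) (auto simp: add_mono)
  also have "\<dots> \<le> (lg n' + k') ^ k'"
    using assms by (cases "lg n' + k' = 0") (auto intro: power_increasing)
  finally show ?thesis by (simp add: bd_def)
qed

lemma le_bd: "n \<le> bd 1 n"
proof -
  have "n \<le> 2 ^ lg n" by (rule le_pow_lg)
  also have "\<dots> \<le> bd 1 n" by (simp add: bd_def)
  finally show ?thesis .
qed

text \<open>Exponents add, and \<open>1 + 2 * y ^ K\<close> fits under
  \<open>(y + 2) ^ (K + 2)\<close> because two further factors \<open>y + 2\<close> are worth at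
  least 4. The spare factor 2 also covers sums, since a sum of two positive integers is at most
  twice their product.\<close>

lemma bd_mult2: "2 * (bd k n * bd k' n) \<le> bd (k + k' + 2) n"
proof -
  define K where "K = k + k'"
  define y where "y = lg n + K"
  have 1: "bd k n * bd k' n \<le> bd K n * bd K n"
    by (intro mult_mono bd_mono) (auto simp: K_def)
  have "1 + 2 * y ^ K \<le> 4 * (y + 2) ^ K"
  proof -
    have "y ^ K \<le> (y + 2) ^ K" by (intro power_mono) auto
    moreover have "1 \<le> (y + 2) ^ K" by (intro one_le_power) auto
    ultimately show ?thesis by linarith
  qed
  also have "\<dots> \<le> (y + 2) ^ 2 * (y + 2) ^ K"
    by (intro mult_right_mono) (auto simp: power2_eq_square)
  also have "\<dots> = (y + 2) ^ (K + 2)" by (simp only: power_add mult.commute)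
  finally have e: "1 + 2 * y ^ K \<le> (y + 2) ^ (K + 2)" .
  have "2 * (bd K n * bd K n) = 2 ^ (1 + 2 * y ^ K)"
    by (simp add: bd_def y_def power_add mult_2)
  also have "\<dots> \<le> 2 ^ ((y + 2) ^ (K + 2))" using e by (intro power_increasing) auto
  also have "\<dots> = bd (K + 2) n" by (simp add: bd_def y_def add_ac)
  finally show ?thesis using 1 by (simp add: K_def)
qed

lemma bd_mult: "bd k n * bd k' n \<le> bd (k + k' + 2) n"
  using bd_mult2[of k n k'] by simp

lemma bd_add: "bd k n + bd k' n \<le> bd (k + k' + 2) n"
proof -
  have "bd k n + bd k' n \<le> 2 * (bd k n * bd k' n)"
  proof -
    have "bd k n * 1 \<le> bd k n * bd k' n" "1 * bd k' n \<le> bd k n * bd k' n"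
      by (intro mult_le_mono bd_pos order_refl)+
    then show ?thesis by linarith
  qed
  also have "\<dots> \<le> bd (k + k' + 2) n" by (rule bd_mult2)
  finally show ?thesis .
qed

text \<open>Composition of quasipolynomials: \<open>lg (bd k' n)\<close> is at most a power of
  \<open>lg n + k'\<close>, so the new exponent is essentially a power of a power.\<close>

lemma bd_bd: "bd k (bd k' n) \<le> bd ((k' + 1) * (k + 1)) n"
proof -
  define x where "x = lg n"
  have lgb: "lg (bd k' n) \<le> (x + k') ^ k'" by (simp add: lg_le_iff bd_def x_def)
  \<comment> \<open>One base that exceeds \<open>x + k'\<close> and leaves room for the summand
    \<open>k\<close> at the price of one more power.\<close>
  define z where "z = x + k' + k + 1"
  have "(x + k') ^ k' + k \<le> z ^ k' + (z - 1) * z ^ k'"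
  proof (rule add_mono)
    show "(x + k') ^ k' \<le> z ^ k'" by (intro power_mono) (auto simp: z_def)
    have "k * 1 \<le> (z - 1) * z ^ k'" by (intro mult_le_mono) (auto simp: z_def)
    then show "k \<le> (z - 1) * z ^ k'" by simp
  qed
  also have "\<dots> = z ^ (k' + 1)" by (cases z) (auto simp: z_def)
  finally have 1: "(x + k') ^ k' + k \<le> z ^ (k' + 1)" .
  define K where "K = (k' + 1) * (k + 1)"
  have "(lg (bd k' n) + k) ^ k \<le> ((x + k') ^ k' + k) ^ k" using lgb by (intro power_mono) auto
  also have "\<dots> \<le> (z ^ (k' + 1)) ^ k" using 1 by (intro power_mono) auto
  also have "\<dots> = z ^ ((k' + 1) * k)" by (simp only: power_mult)
  also have "\<dots> \<le> z ^ K" by (intro power_increasing) (auto simp: K_def z_def)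
  also have "\<dots> \<le> (x + K) ^ K" by (intro power_mono) (auto simp: K_def z_def)
  finally show ?thesis
    by (simp only: bd_def x_def K_def) (rule power_increasing, auto)
qed

section \<open>Closure properties of quasipolynomially bounded functions\<close>

definition qb :: "'s set \<Rightarrow> ('s \<Rightarrow> nat) \<Rightarrow> ('s \<Rightarrow> nat) \<Rightarrow> bool" where
  "qb S N f \<longleftrightarrow> (\<exists>k. \<forall>s\<in>S. f s \<le> bd k (N s))"

lemma qb_mono: "qb S N f \<Longrightarrow> (\<And>s. s \<in> S \<Longrightarrow> g s \<le> f s) \<Longrightarrow> qb S N g"
  unfolding qb_def by (meson le_trans)

lemma qb_subset: "qb S N f \<Longrightarrow> S' \<subseteq> S \<Longrightarrow> qb S' N f"
  unfolding qb_def by (meson subsetD)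

lemma qb_N: "qb S N N"
  unfolding qb_def using le_bd by blast

lemma qb_const: "qb S N (\<lambda>s. c)"
  unfolding qb_def
proof (intro exI ballI)
  fix s
  have "c \<le> 2 ^ c" by (simp add: less_exp less_imp_le)
  also have "\<dots> \<le> bd (c + 1) (N s)"
  proof -
    have "c * 1 \<le> (lg (N s) + (c + 1)) * (lg (N s) + (c + 1)) ^ c" by (intro mult_le_mono) auto
    then show ?thesis by (simp add: bd_def)
  qed
  finally show "c \<le> bd (c + 1) (N s)" .
qed

lemma qb_add: "qb S N f \<Longrightarrow> qb S N g \<Longrightarrow> qb S N (\<lambda>s. f s + g s)"
  unfolding qb_def by (meson add_mono bd_add le_trans)

lemma qb_mult: "qb S N f \<Longrightarrow> qb S N g \<Longrightarrow> qb S N (\<lambda>s. f s * g s)"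
  unfolding qb_def by (meson mult_le_mono bd_mult le_trans)

lemma qb_Suc: "qb S N f \<Longrightarrow> qb S N (\<lambda>s. Suc (f s))"
  using qb_add[OF _ qb_const[of S N 1], of f] by simp

lemma qb_bd: "qb S N f \<Longrightarrow> qb S N (\<lambda>s. bd k (f s))"
  unfolding qb_def by (meson bd_mono bd_bd le_trans order_refl)

text \<open>For calls: a bound in the size of the callee's environment becomes one in the caller's,
  once the arguments are bounded.\<close>

lemma qb_compose:
  assumes "qb S' N' f" "\<And>s. s \<in> S \<Longrightarrow> \<phi> s \<in> S'" "qb S N (\<lambda>s. N' (\<phi> s))"
  shows "qb S N (\<lambda>s. f (\<phi> s))"
proof -
  obtain k where "\<forall>s\<in>S'. f s \<le> bd k (N' s)" using assms(1) by (auto simp: qb_def)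
  then show ?thesis using assms(2) by (intro qb_mono[OF qb_bd[OF assms(3), of k]]) auto
qed

lemmas qb_intros = qb_N qb_const qb_add qb_mult qb_Suc qb_bd

section \<open>Computability in quasipolynomial time\<close>

definition esz :: "'a data list \<Rightarrow> nat" where
  "esz env = sum_list (map data_size env)"

lemma esz_simps [simp]: "esz [] = 0" "esz (x # xs) = data_size x + esz xs" "esz (xs @ ys) = esz xs + esz ys"
  by (simp_all add: esz_def)

lemma data_size_pos: "1 \<le> data_size u" by (induction u) auto

lemma data_size_nth_le: "i < length env \<Longrightarrow> data_size (env ! i) \<le> esz env"
  by (induction env arbitrary: i) (auto simp: nth_Cons split: nat.split intro: trans_le_add2)

lemma data_size_truth: "data_size (truth b) \<le> 3" by (simp add: truth_def)

lemma data_size_fst: "data_size (data_fst v) \<le> data_size v" by (cases v) auto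
lemma data_size_snd: "data_size (data_snd v) \<le> data_size v" by (cases v) auto
lemma data_size_bar: "data_size (data_bar b v) \<le> data_size v" by (cases v) auto

lemma evals_append:
  "evals bar P env es us s \<Longrightarrow> evals bar P env fs vs t \<Longrightarrow> evals bar P env (es @ fs) (us @ vs) (s + t)"
proof (induction es arbitrary: us s)
  case Nil
  then show ?case by (auto elim: evalE)
next
  case (Cons e es)
  from Cons.prems(1) show ?case
    by (rule evalE) (auto simp: add.assoc intro!: eval_evals.Cons Cons.IH Cons.prems(2))
qed

lemma evals_Vars: "\<forall>i\<in>set is. i < length env \<Longrightarrow>
  evals bar P env (map Var is) (map ((!) env) is) (\<Sum>i\<leftarrow>is. data_size (env ! i))"
  by (induction "is") (auto intro: eval_evals.intros)

lemma evals_all_Vars: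
  assumes "length env = n"
  shows "evals bar P env (map Var [0..<n]) env (esz env)"
proof -
  have m: "map ((!) env) [0..<n] = env" using assms map_nth by blast
  have "esz env = sum_list (map data_size (map ((!) env) [0..<n]))" by (simp add: m esz_def)
  also have "\<dots> = (\<Sum>i\<leftarrow>[0..<n]. data_size (env ! i))" by (simp add: o_def)
  finally show ?thesis using evals_Vars[of "[0..<n]" env bar P] assms by (simp add: m)
qed

text \<open>Expressions refer to functions by absolute index, so a computable function is a family of
  program fragments, one for every offset at which the fragment may be placed.\<close>

locale sks =
  fixes bar :: "'a \<Rightarrow> 'a"
  assumes bar_bar: "bar (bar a) = a" and bar_neq: "bar a \<noteq> a"
begin

text \<open>\<open>s\<close> is an abstract index that the program sees only through
  \<open>env s\<close>. The time bound \<open>T\<close> is fixed before the offset, so relocating a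
  fragment does not affect the bound, and a fragment has to work with arbitrary code before and
  after it.\<close>

definition computable :: "'s set \<Rightarrow> ('s \<Rightarrow> 'a data list) \<Rightarrow> ('s \<Rightarrow> 'a data) \<Rightarrow> bool" where
  "computable S env g \<longleftrightarrow> (\<exists>T. qb S (\<lambda>s. esz (env s)) T \<and>
     (\<forall>off. \<exists>Q e. \<forall>pre post. length pre = off \<longrightarrow>
        (\<forall>s\<in>S. \<exists>t\<le>T s. eval bar (pre @ Q @ post) (env s) e (g s) t)))"

definition computables :: "'s set \<Rightarrow> ('s \<Rightarrow> 'a data list) \<Rightarrow> ('s \<Rightarrow> 'a data list) \<Rightarrow> bool" where
  "computables S env g \<longleftrightarrow> (\<exists>T. qb S (\<lambda>s. esz (env s)) T \<and>
     (\<forall>off. \<exists>Q es. \<forall>pre post. length pre = off \<longrightarrow>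
        (\<forall>s\<in>S. \<exists>t\<le>T s. evals bar (pre @ Q @ post) (env s) es (g s) t)))"

lemma eval_data_size: 
  "eval bar P env e v t \<Longrightarrow> data_size v \<le> t"
  "evals bar P env es vs t \<Longrightarrow> esz vs \<le> t"
  by (induction rule: eval_evals.inducts) auto

lemma compE:
  assumes "computable S env g"
  obtains T where "qb S (\<lambda>s. esz (env s)) T" and
    "\<And>off. \<exists>Q e. \<forall>pre post. length pre = off \<longrightarrow>
        (\<forall>s\<in>S. \<exists>t\<le>T s. eval bar (pre @ Q @ post) (env s) e (g s) t)"
  using assms unfolding computable_def by blast

lemma compsE:
  assumes "computables S env g"
  obtains T where "qb S (\<lambda>s. esz (env s)) T" and
    "\<And>off. \<exists>Q e. \<forall>pre post. length pre = off \<longrightarrow>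
        (\<forall>s\<in>S. \<exists>t\<le>T s. evals bar (pre @ Q @ post) (env s) e (g s) t)"
  using assms unfolding computables_def by blast

text \<open>Every value is charged its size, so the running time bounds the size of the result.
  Later this yields size bounds without calculation: a formula or derivation is bounded because it
  is computable.\<close>

lemma comp_qb: assumes "computable S env g" shows "qb S (\<lambda>s. esz (env s)) (\<lambda>s. data_size (g s))"
proof -
  obtain T where T: "qb S (\<lambda>s. esz (env s)) T" 
    "\<And>off. \<exists>Q e. \<forall>pre post. length pre = off \<longrightarrow>
        (\<forall>s\<in>S. \<exists>t\<le>T s. eval bar (pre @ Q @ post) (env s) e (g s) t)"
    using compE[OF assms] by blast
  obtain Q e where Q: "\<forall>pre post. length pre = 0 \<longrightarrow>
        (\<forall>s\<in>S. \<exists>t\<le>T s. eval bar (pre @ Q @ post) (env s) e (g s) t)"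
    using T(2) by blast
  have "data_size (g s) \<le> T s" if "s \<in> S" for s
    using Q[rule_format, of "[]" s "[]"] that eval_data_size(1) le_trans by fastforce
  then show ?thesis by (rule qb_mono[OF T(1)])
qed

lemma comps_qb: assumes "computables S env g" shows "qb S (\<lambda>s. esz (env s)) (\<lambda>s. esz (g s))"
proof -
  obtain T where T: "qb S (\<lambda>s. esz (env s)) T" 
    "\<And>off. \<exists>Q e. \<forall>pre post. length pre = off \<longrightarrow>
        (\<forall>s\<in>S. \<exists>t\<le>T s. evals bar (pre @ Q @ post) (env s) e (g s) t)"
    using compsE[OF assms] by blast
  obtain Q e where Q: "\<forall>pre post. length pre = 0 \<longrightarrow>
        (\<forall>s\<in>S. \<exists>t\<le>T s. evals bar (pre @ Q @ post) (env s) e (g s) t)"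
    using T(2) by blast
  have "esz (g s) \<le> T s" if "s \<in> S" for s
    using Q[rule_format, of "[]" s "[]"] that eval_data_size(2) le_trans by fastforce
  then show ?thesis by (rule qb_mono[OF T(1)])
qed

lemma compI:
  assumes "qb S (\<lambda>s. esz (env s)) T" and
    "\<And>off. \<exists>Q e. \<forall>pre post. length pre = off \<longrightarrow>
        (\<forall>s\<in>S. \<exists>t\<le>T s. eval bar (pre @ Q @ post) (env s) e (g s) t)"
  shows "computable S env g"
  using assms unfolding computable_def by blast

lemma compsI:
  assumes "qb S (\<lambda>s. esz (env s)) T" and
    "\<And>off. \<exists>Q e. \<forall>pre post. length pre = off \<longrightarrow>
        (\<forall>s\<in>S. \<exists>t\<le>T s. evals bar (pre @ Q @ post) (env s) e (g s) t)"
  shows "computables S env g"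
  using assms unfolding computables_def by blast

lemma comp_cong: assumes "computable S env g" "\<And>s. s \<in> S \<Longrightarrow> g' s = g s" shows "computable S env g'"
  using assms unfolding computable_def by simp

lemma comp_subset: assumes "computable S env g" "S' \<subseteq> S" shows "computable S' env g"
  using assms unfolding computable_def by (meson qb_subset subsetD)

lemma comp_var:
  assumes "\<And>s. s \<in> S \<Longrightarrow> i < length (env s) \<and> env s ! i = g s"
  shows "computable S env g"
  unfolding computable_def
proof (intro exI conjI allI)
  show "qb S (\<lambda>s. esz (env s)) (\<lambda>s. esz (env s))" by (rule qb_N)
  show "length pre = off \<longrightarrow> (\<forall>s\<in>S. \<exists>t\<le>esz (env s). eval bar (pre @ [] @ post) (env s) (Var i) (g s) t)"
    for pre post :: program and off
    using assms by (metis data_size_nth_le eval_evals.Var)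
qed

lemma comp_Null: "computable S env (\<lambda>s. Null)"
  unfolding computable_def
proof (intro exI conjI allI)
  show "qb S (\<lambda>s. esz (env s)) (\<lambda>_. 1)" by (rule qb_const)
  show "length pre = off \<longrightarrow> (\<forall>s\<in>S. \<exists>t\<le>1. eval bar (pre @ [] @ post) (env s) NullE Null t)"
    for pre post :: program and off
    using eval_evals.NullE[of bar "pre @ post"] by auto
qed

text \<open>\<open>E\<close> is a constructor of expressions and \<open>F\<close> its meaning; the
  slack 3 is the size of \<open>truth True\<close>.\<close>

lemma comp_unary:
  assumes "computable S env g"
    and ev: "\<And>P env e v t. eval bar P env e v t \<Longrightarrow> eval bar P env (E e) (F v) (t + data_size (F v))"
    and sz: "\<And>v. data_size (F v) \<le> data_size v + 3"
  shows "computable S env (\<lambda>s. F (g s))"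
proof -
  obtain T where T: "qb S (\<lambda>s. esz (env s)) T" 
    "\<And>off. \<exists>Q e. \<forall>pre post. length pre = off \<longrightarrow>
        (\<forall>s\<in>S. \<exists>t\<le>T s. eval bar (pre @ Q @ post) (env s) e (g s) t)"
    using compE[OF assms(1)] by blast
  show ?thesis
  proof (rule compI)
    show "qb S (\<lambda>s. esz (env s)) (\<lambda>s. T s + (T s + 3))" by (intro qb_intros T)
    fix off
    obtain Q e where Q: "\<forall>pre post. length pre = off \<longrightarrow>
        (\<forall>s\<in>S. \<exists>t\<le>T s. eval bar (pre @ Q @ post) (env s) e (g s) t)" using T(2) by blast
    show "\<exists>Q e. \<forall>pre post. length pre = off \<longrightarrow>
        (\<forall>s\<in>S. \<exists>t\<le>T s + (T s + 3). eval bar (pre @ Q @ post) (env s) e (F (g s)) t)"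
    proof (rule exI, rule exI, intro allI impI ballI)
      fix pre post :: program and s assume "length pre = off" "s \<in> S"
      with Q obtain t where t: "t \<le> T s" "eval bar (pre @ Q @ post) (env s) e (g s) t" by blast
      have "data_size (F (g s)) \<le> t + 3" using sz[of "g s"] eval_data_size(1)[OF t(2)] by linarith
      then show "\<exists>t\<le>T s + (T s + 3). eval bar (pre @ Q @ post) (env s) (E e) (F (g s)) t"
        using ev[OF t(2)] t(1) by (intro exI[of _ "t + data_size (F (g s))"]) auto
    qed
  qed
qed

lemma comp_Fst: "computable S env g \<Longrightarrow> computable S env (\<lambda>s. data_fst (g s))"
  by (rule comp_unary[where E = Fst]) (auto intro: eval_evals.Fst order_trans[OF data_size_fst])

lemma comp_Snd: "computable S env g \<Longrightarrow> computable S env (\<lambda>s. data_snd (g s))"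
  by (rule comp_unary[where E = Snd]) (auto intro: eval_evals.Snd order_trans[OF data_size_snd])

lemma comp_Bar: "computable S env g \<Longrightarrow> computable S env (\<lambda>s. data_bar bar (g s))"
  by (rule comp_unary[where E = Bar]) (auto intro: eval_evals.Bar order_trans[OF data_size_bar])

lemma comp_IsTok: "computable S env g \<Longrightarrow> computable S env (\<lambda>s. truth (is_tok (g s)))"
  by (rule comp_unary[where E = IsTok and F = "\<lambda>v. truth (is_tok v)"])
    (auto intro: eval_evals.IsTok order_trans[OF data_size_truth])

lemma comp_binary:
  assumes "computable S env g1" "computable S env g2"
    and ev: "\<And>P env e1 e2 u v s t. eval bar P env e1 u s \<Longrightarrow> eval bar P env e2 v t \<Longrightarrow> 
       eval bar P env (E e1 e2) (F u v) (s + t + data_size (F u v))"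
    and sz: "\<And>u v. data_size (F u v) \<le> data_size u + data_size v + 3"
  shows "computable S env (\<lambda>s. F (g1 s) (g2 s))"
proof -
  obtain T where T: "qb S (\<lambda>s. esz (env s)) T" 
    "\<And>off. \<exists>Q e. \<forall>pre post. length pre = off \<longrightarrow>
        (\<forall>s\<in>S. \<exists>t\<le>T s. eval bar (pre @ Q @ post) (env s) e (g1 s) t)"
    using compE[OF assms(1)] by blast
  obtain U where U: "qb S (\<lambda>s. esz (env s)) U" 
    "\<And>off. \<exists>Q e. \<forall>pre post. length pre = off \<longrightarrow>
        (\<forall>s\<in>S. \<exists>t\<le>U s. eval bar (pre @ Q @ post) (env s) e (g2 s) t)"
    using compE[OF assms(2)] by blast
  show ?thesis
  proof (rule compI)
    show "qb S (\<lambda>s. esz (env s)) (\<lambda>s. T s + U s + (T s + U s + 3))" by (intro qb_intros T U)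
    fix off
    obtain Q e where Q: "\<forall>pre post. length pre = off \<longrightarrow>
        (\<forall>s\<in>S. \<exists>t\<le>T s. eval bar (pre @ Q @ post) (env s) e (g1 s) t)" using T(2) by blast
    \<comment> \<open>The second fragment is compiled for the place right behind the first, so that
      \<open>Q @ Q'\<close> contains both.\<close>
    obtain Q' e' where Q': "\<forall>pre post. length pre = off + length Q \<longrightarrow>
        (\<forall>s\<in>S. \<exists>t\<le>U s. eval bar (pre @ Q' @ post) (env s) e' (g2 s) t)" using U(2) by blast
    show "\<exists>Q e. \<forall>pre post. length pre = off \<longrightarrow>
        (\<forall>s\<in>S. \<exists>t\<le>T s + U s + (T s + U s + 3). eval bar (pre @ Q @ post) (env s) e (F (g1 s) (g2 s)) t)"
    proof (rule exI, rule exI, intro allI impI ballI)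
      fix pre post :: program and s assume A: "length pre = off" "s \<in> S"
      have "\<exists>t\<le>T s. eval bar (pre @ Q @ (Q' @ post)) (env s) e (g1 s) t" using Q A by blast
      then obtain t where t: "t \<le> T s" "eval bar (pre @ (Q @ Q') @ post) (env s) e (g1 s) t" by auto
      have "\<exists>t\<le>U s. eval bar ((pre @ Q) @ Q' @ post) (env s) e' (g2 s) t" using Q'[rule_format, of "pre @ Q" s post] A by simp
      then obtain u where u: "u \<le> U s" "eval bar (pre @ (Q @ Q') @ post) (env s) e' (g2 s) u" by auto
      have "data_size (F (g1 s) (g2 s)) \<le> t + u + 3"
        using sz[of "g1 s" "g2 s"] eval_data_size(1)[OF t(2)] eval_data_size(1)[OF u(2)] by linarith
      then show "\<exists>t\<le>T s + U s + (T s + U s + 3). eval bar (pre @ (Q @ Q') @ post) (env s) (E e e') (F (g1 s) (g2 s)) t"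
        using ev[OF t(2) u(2)] t(1) u(1) by (intro exI[of _ "t + u + data_size (F (g1 s) (g2 s))"]) auto
    qed
  qed
qed

lemma comp_Node: "computable S env g1 \<Longrightarrow> computable S env g2 \<Longrightarrow> computable S env (\<lambda>s. Node (g1 s) (g2 s))"
  by (rule comp_binary[where E = NodeE and F = Node], assumption, assumption, erule (1) eval_evals.NodeE, simp)

lemma comp_Eq: "computable S env g1 \<Longrightarrow> computable S env g2 \<Longrightarrow> computable S env (\<lambda>s. truth (g1 s = g2 s))"
  by (rule comp_binary[where E = Eq and F = "\<lambda>u v. truth (u = v)"])
    (auto intro: eval_evals.Eq order_trans[OF data_size_truth])

lemma comps_Nil: "computables S env (\<lambda>s. [])"
  unfolding computables_def
proof (intro exI conjI allI)
  show "qb S (\<lambda>s. esz (env s)) (\<lambda>_. 0)" by (rule qb_const)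
  show "length pre = off \<longrightarrow> (\<forall>s\<in>S. \<exists>t\<le>0. evals bar (pre @ [] @ post) (env s) [] [] t)"
    for pre post :: program and off
    by (auto intro: eval_evals.Nil)
qed

lemma comps_Cons:
  assumes "computable S env g1" "computables S env g2"
  shows "computables S env (\<lambda>s. g1 s # g2 s)"
proof -
  obtain T where T: "qb S (\<lambda>s. esz (env s)) T" 
    "\<And>off. \<exists>Q e. \<forall>pre post. length pre = off \<longrightarrow>
        (\<forall>s\<in>S. \<exists>t\<le>T s. eval bar (pre @ Q @ post) (env s) e (g1 s) t)"
    using compE[OF assms(1)] by blast
  obtain U where U: "qb S (\<lambda>s. esz (env s)) U" 
    "\<And>off. \<exists>Q e. \<forall>pre post. length pre = off \<longrightarrow>
        (\<forall>s\<in>S. \<exists>t\<le>U s. evals bar (pre @ Q @ post) (env s) e (g2 s) t)"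
    using compsE[OF assms(2)] by blast
  show ?thesis
  proof (rule compsI)
    show "qb S (\<lambda>s. esz (env s)) (\<lambda>s. T s + U s)" by (intro qb_intros T U)
    fix off
    obtain Q e where Q: "\<forall>pre post. length pre = off \<longrightarrow>
        (\<forall>s\<in>S. \<exists>t\<le>T s. eval bar (pre @ Q @ post) (env s) e (g1 s) t)" using T(2) by blast
    obtain Q' e' where Q': "\<forall>pre post. length pre = off + length Q \<longrightarrow>
        (\<forall>s\<in>S. \<exists>t\<le>U s. evals bar (pre @ Q' @ post) (env s) e' (g2 s) t)" using U(2) by blast
    show "\<exists>Q es. \<forall>pre post. length pre = off \<longrightarrow>
        (\<forall>s\<in>S. \<exists>t\<le>T s + U s. evals bar (pre @ Q @ post) (env s) es (g1 s # g2 s) t)"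
    proof (rule exI, rule exI, intro allI impI ballI)
      fix pre post :: program and s assume A: "length pre = off" "s \<in> S"
      have "\<exists>t\<le>T s. eval bar (pre @ Q @ (Q' @ post)) (env s) e (g1 s) t" using Q A by blast
      then obtain t where t: "t \<le> T s" "eval bar (pre @ (Q @ Q') @ post) (env s) e (g1 s) t" by auto
      have "\<exists>t\<le>U s. evals bar ((pre @ Q) @ Q' @ post) (env s) e' (g2 s) t" using Q'[rule_format, of "pre @ Q" s post] A by simp
      then obtain u where u: "u \<le> U s" "evals bar (pre @ (Q @ Q') @ post) (env s) e' (g2 s) u" by auto
      show "\<exists>t\<le>T s + U s. evals bar (pre @ (Q @ Q') @ post) (env s) (e # e') (g1 s # g2 s) t"
        using eval_evals.Cons[OF t(2) u(2)] t(1) u(1) by (intro exI[of _ "t + u"]) auto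
    qed
  qed
qed

text \<open>A call is substitution: \<open>\<phi>\<close> turns the index of the caller into that of
  the callee. The body of the callee becomes a new function at index \<open>off\<close>, in front of
  the two fragments; hence their offsets start at \<open>off + 1\<close>.\<close>

lemma comp_call:
  assumes "computables S env (\<lambda>s. env' (\<phi> s))" "computable S' env' g" "\<And>s. s \<in> S \<Longrightarrow> \<phi> s \<in> S'"
  shows "computable S env (\<lambda>s. g (\<phi> s))"
proof -
  obtain U where U: "qb S (\<lambda>s. esz (env s)) U" 
    "\<And>off. \<exists>Q e. \<forall>pre post. length pre = off \<longrightarrow>
        (\<forall>s\<in>S. \<exists>t\<le>U s. evals bar (pre @ Q @ post) (env s) e (env' (\<phi> s)) t)"
    using compsE[OF assms(1)] by blast
  obtain T where T: "qb S' (\<lambda>s. esz (env' s)) T" 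
    "\<And>off. \<exists>Q e. \<forall>pre post. length pre = off \<longrightarrow>
        (\<forall>s\<in>S'. \<exists>t\<le>T s. eval bar (pre @ Q @ post) (env' s) e (g s) t)"
    using compE[OF assms(2)] by blast
  have TT: "qb S (\<lambda>s. esz (env s)) (\<lambda>s. T (\<phi> s))"
    using qb_compose[OF T(1) assms(3) comps_qb[OF assms(1)]] .
  show ?thesis
  proof (rule compI)
    show "qb S (\<lambda>s. esz (env s)) (\<lambda>s. U s + T (\<phi> s) + T (\<phi> s))" by (intro qb_intros TT U)
    fix off
    obtain Q e where Q: "\<forall>pre post. length pre = off + 1 \<longrightarrow>
        (\<forall>s\<in>S. \<exists>t\<le>U s. evals bar (pre @ Q @ post) (env s) e (env' (\<phi> s)) t)" using U(2) by blast
    obtain Q' e' where Q': "\<forall>pre post. length pre = off + 1 + length Q \<longrightarrow>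
        (\<forall>s\<in>S'. \<exists>t\<le>T s. eval bar (pre @ Q' @ post) (env' s) e' (g s) t)" using T(2) by blast
    show "\<exists>Q e. \<forall>pre post. length pre = off \<longrightarrow>
        (\<forall>s\<in>S. \<exists>t\<le>U s + T (\<phi> s) + T (\<phi> s). eval bar (pre @ Q @ post) (env s) e (g (\<phi> s)) t)"
    proof (rule exI, rule exI, intro allI impI ballI)
      fix pre post :: program and s assume A: "length pre = off" "s \<in> S"
      let ?P = "pre @ (e' # Q @ Q') @ post"
      have "\<exists>t\<le>U s. evals bar ((pre @ [e']) @ Q @ (Q' @ post)) (env s) e (env' (\<phi> s)) t" using Q[rule_format, of "pre @ [e']"] A by simp
      then obtain u where u: "u \<le> U s" "evals bar ?P (env s) e (env' (\<phi> s)) u" by auto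
      have "\<exists>t\<le>T (\<phi> s). eval bar ((pre @ e' # Q) @ Q' @ post) (env' (\<phi> s)) e' (g (\<phi> s)) t"
        using Q'[rule_format, of "pre @ e' # Q" "\<phi> s" post] A assms(3) by simp
      then obtain t where t: "t \<le> T (\<phi> s)" "eval bar ?P (env' (\<phi> s)) e' (g (\<phi> s)) t" by auto
      have "eval bar ?P (env s) (Call off e) (g (\<phi> s)) (u + t + data_size (g (\<phi> s)))"
        using A t(2) u(2) by (intro eval_evals.Call) (auto simp: nth_append)
      then show "\<exists>t\<le>U s + T (\<phi> s) + T (\<phi> s). eval bar ?P (env s) (Call off e) (g (\<phi> s)) t"
        using t(1) u(1) eval_data_size(1)[OF t(2)]
        by (intro exI[of _ "u + t + data_size (g (\<phi> s))"]) auto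
    qed
  qed
qed

text \<open>Each branch has to be computable only where it is taken, so a case distinction may use
  facts that hold in one case alone.\<close>

lemma comp_if:
  assumes "computable S env (\<lambda>s. truth (b s))" "computable {s\<in>S. b s} env g1" "computable {s\<in>S. \<not> b s} env g2"
  shows "computable S env (\<lambda>s. if b s then g1 s else g2 s)"
proof -
  obtain B where B: "qb S (\<lambda>s. esz (env s)) B" 
    "\<And>off. \<exists>Q e. \<forall>pre post. length pre = off \<longrightarrow>
        (\<forall>s\<in>S. \<exists>t\<le>B s. eval bar (pre @ Q @ post) (env s) e (truth (b s)) t)"
    using compE[OF assms(1)] by blast
  obtain T where T: "qb {s\<in>S. b s} (\<lambda>s. esz (env s)) T" 
    "\<And>off. \<exists>Q e. \<forall>pre post. length pre = off \<longrightarrow>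
        (\<forall>s\<in>{s\<in>S. b s}. \<exists>t\<le>T s. eval bar (pre @ Q @ post) (env s) e (g1 s) t)"
    using compE[OF assms(2)] by blast
  obtain U where U: "qb {s\<in>S. \<not> b s} (\<lambda>s. esz (env s)) U" 
    "\<And>off. \<exists>Q e. \<forall>pre post. length pre = off \<longrightarrow>
        (\<forall>s\<in>{s\<in>S. \<not> b s}. \<exists>t\<le>U s. eval bar (pre @ Q @ post) (env s) e (g2 s) t)"
    using compE[OF assms(3)] by blast
  define W where "W = (\<lambda>s. if b s then T s else U s)"
  obtain k1 k2 where k: "\<forall>s\<in>{s\<in>S. b s}. T s \<le> bd k1 (esz (env s))" "\<forall>s\<in>{s\<in>S. \<not> b s}. U s \<le> bd k2 (esz (env s))"
    using T(1) U(1) by (auto simp: qb_def)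
  have W: "qb S (\<lambda>s. esz (env s)) W"
    unfolding qb_def
  proof (intro exI ballI)
    fix s assume "s \<in> S"
    then show "W s \<le> bd (k1 + k2) (esz (env s))"
      using k by (auto simp: W_def intro: order_trans[OF _ bd_mono])
  qed
  show ?thesis
  proof (rule compI)
    show "qb S (\<lambda>s. esz (env s)) (\<lambda>s. B s + W s + W s)" by (intro qb_intros W B)
    fix off
    obtain Q e where Q: "\<forall>pre post. length pre = off \<longrightarrow>
        (\<forall>s\<in>S. \<exists>t\<le>B s. eval bar (pre @ Q @ post) (env s) e (truth (b s)) t)" using B(2) by blast
    obtain Q1 e1 where Q1: "\<forall>pre post. length pre = off + length Q \<longrightarrow>
        (\<forall>s\<in>{s\<in>S. b s}. \<exists>t\<le>T s. eval bar (pre @ Q1 @ post) (env s) e1 (g1 s) t)" using T(2) by blast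
    obtain Q2 e2 where Q2: "\<forall>pre post. length pre = off + length Q + length Q1 \<longrightarrow>
        (\<forall>s\<in>{s\<in>S. \<not> b s}. \<exists>t\<le>U s. eval bar (pre @ Q2 @ post) (env s) e2 (g2 s) t)" using U(2) by blast
    show "\<exists>Q e. \<forall>pre post. length pre = off \<longrightarrow>
        (\<forall>s\<in>S. \<exists>t\<le>B s + W s + W s. eval bar (pre @ Q @ post) (env s) e (if b s then g1 s else g2 s) t)"
    proof (rule exI, rule exI, intro allI impI ballI)
      fix pre post :: program and s assume A: "length pre = off" "s \<in> S"
      let ?P = "pre @ (Q @ Q1 @ Q2) @ post"
      have "\<exists>t\<le>B s. eval bar (pre @ Q @ (Q1 @ Q2 @ post)) (env s) e (truth (b s)) t" using Q A by blast
      then obtain u where u: "u \<le> B s" "eval bar ?P (env s) e (truth (b s)) u" by auto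
      show "\<exists>t\<le>B s + W s + W s. eval bar ?P (env s) (Cond e e1 e2) (if b s then g1 s else g2 s) t"
      proof (cases "b s")
        case True
        then have "\<exists>t\<le>T s. eval bar ((pre @ Q) @ Q1 @ (Q2 @ post)) (env s) e1 (g1 s) t"
          using Q1[rule_format, of "pre @ Q" s "Q2 @ post"] A by simp
        then obtain t where t: "t \<le> T s" "eval bar ?P (env s) e1 (g1 s) t" by auto
        have "eval bar ?P (env s) (Cond e e1 e2) (g1 s) (u + t + data_size (g1 s))"
          using True by (intro eval_evals.Cond_true[OF u(2)] t) (simp add: truth_def)
        then show ?thesis using True u(1) t(1) eval_data_size(1)[OF t(2)]
          by (intro exI[of _ "u + t + data_size (g1 s)"]) (auto simp: W_def)
      next
        case False
        then have "\<exists>t\<le>U s. eval bar ((pre @ Q @ Q1) @ Q2 @ post) (env s) e2 (g2 s) t"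
          using Q2[rule_format, of "pre @ Q @ Q1" s post] A by simp
        then obtain t where t: "t \<le> U s" "eval bar ?P (env s) e2 (g2 s) t" by auto
        have "eval bar ?P (env s) (Cond e e1 e2) (g2 s) (u + t + data_size (g2 s))"
          using False u(2) by (intro eval_evals.Cond_false t) (simp add: truth_def)
        then show ?thesis using False u(1) t(1) eval_data_size(1)[OF t(2)]
          by (intro exI[of _ "u + t + data_size (g2 s)"]) (auto simp: W_def)
      qed
    qed
  qed
qed

text \<open>The argument tuples of all recursive calls of a function are compiled together, under
  one common time bound.\<close>

lemma comps_list:
  assumes "\<And>c. c \<in> set cs \<Longrightarrow> computables S env (\<lambda>s. env' (c s))"
  shows "\<exists>T. qb S (\<lambda>s. esz (env s)) T \<and>
     (\<forall>off. \<exists>Q ess. \<forall>pre post. length pre = off \<longrightarrow>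
        (\<forall>s\<in>S. list_all2 (\<lambda>c es. \<exists>t\<le>T s. evals bar (pre @ Q @ post) (env s) es (env' (c s)) t) cs ess))"
  using assms
proof (induction cs)
  case Nil
  show ?case
    by (rule exI[of _ "\<lambda>_. 0"], rule conjI, rule qb_const, rule allI, rule exI[of _ "[]"], rule exI[of _ "[]"]) simp
next
  case (Cons c cs)
  have cs: "computables S env (\<lambda>s. env' (c' s))" if "c' \<in> set cs" for c'
    using Cons.prems that by simp
  have c: "computables S env (\<lambda>s. env' (c s))" using Cons.prems by simp
  note IH = Cons.IH[OF cs]
  obtain T where T: "qb S (\<lambda>s. esz (env s)) T" "\<And>off. \<exists>Q ess. \<forall>pre post. length pre = off \<longrightarrow>
        (\<forall>s\<in>S. list_all2 (\<lambda>c es. \<exists>t\<le>T s. evals bar (pre @ Q @ post) (env s) es (env' (c s)) t) cs ess)"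
    using IH by blast
  obtain U where U: "qb S (\<lambda>s. esz (env s)) U" 
    "\<And>off. \<exists>Q e. \<forall>pre post. length pre = off \<longrightarrow>
        (\<forall>s\<in>S. \<exists>t\<le>U s. evals bar (pre @ Q @ post) (env s) e (env' (c s)) t)"
    using compsE[OF c] by blast
  show ?case
  proof (rule exI[of _ "\<lambda>s. T s + U s"], rule conjI, rule_tac [2] allI)
    show "qb S (\<lambda>s. esz (env s)) (\<lambda>s. T s + U s)" by (intro qb_intros T U)
    fix off
    obtain Q e where Q: "\<forall>pre post. length pre = off \<longrightarrow>
        (\<forall>s\<in>S. \<exists>t\<le>U s. evals bar (pre @ Q @ post) (env s) e (env' (c s)) t)" using U(2) by blast
    obtain Q' es where Q': "\<forall>pre post. length pre = off + length Q \<longrightarrow>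
        (\<forall>s\<in>S. list_all2 (\<lambda>c es. \<exists>t\<le>T s. evals bar (pre @ Q' @ post) (env s) es (env' (c s)) t) cs es)"
      using T(2) by blast
    show "\<exists>Q ess. \<forall>pre post. length pre = off \<longrightarrow>
        (\<forall>s\<in>S. list_all2 (\<lambda>c es. \<exists>t\<le>T s + U s. evals bar (pre @ Q @ post) (env s) es (env' (c s)) t) (c # cs) ess)"
    proof (rule exI, rule exI, intro allI impI ballI)
      fix pre post :: program and s assume A: "length pre = off" "s \<in> S"
      let ?P = "pre @ (Q @ Q') @ post"
      have "\<exists>t\<le>U s. evals bar (pre @ Q @ (Q' @ post)) (env s) e (env' (c s)) t" using Q A by blast
      then have 1: "\<exists>t\<le>T s + U s. evals bar ?P (env s) e (env' (c s)) t" by (metis append_assoc trans_le_add2)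
      have "list_all2 (\<lambda>c es. \<exists>t\<le>T s. evals bar ((pre @ Q) @ Q' @ post) (env s) es (env' (c s)) t) cs es"
        using Q'[rule_format, of "pre @ Q" s post] A by simp
      then have "list_all2 (\<lambda>c es. \<exists>t\<le>T s + U s. evals bar ?P (env s) es (env' (c s)) t) cs es"
        by (rule list_all2_mono) (metis append_assoc trans_le_add1)
      with 1 show "list_all2 (\<lambda>c es. \<exists>t\<le>T s + U s. evals bar ?P (env s) es (env' (c s)) t) (c # cs) (e # es)"
        by simp
    qed
  qed
qed

text \<open>Recursion: on \<open>nd s\<close> the value at \<open>s\<close> is computed from the values at the children \<open>c s\<close>.
  The weight \<open>w\<close> bounds the number of calls, and the sizes of the results have to be bounded
  beforehand.\<close>

lemma comp_rec:
  fixes w :: "'s \<Rightarrow> nat"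
  assumes nd: "computable S env (\<lambda>s. truth (nd s))"
    and leaf: "computable {s\<in>S. \<not> nd s} env g"
    and node: "computable {s\<in>S. nd s} (\<lambda>s. map (\<lambda>c. g (c s)) cs @ env s) g"
    and args: "\<And>c. c \<in> set cs \<Longrightarrow> computables {s\<in>S. nd s} env (\<lambda>s. env (c s))"
    and closed: "\<And>c s. c \<in> set cs \<Longrightarrow> s \<in> S \<Longrightarrow> nd s \<Longrightarrow> c s \<in> S \<and> esz (env (c s)) \<le> esz (env s)"
    and len: "\<And>s. s \<in> S \<Longrightarrow> length (env s) = n"
    and w: "\<And>s. s \<in> S \<Longrightarrow> nd s \<Longrightarrow> 1 + (\<Sum>c\<leftarrow>cs. w (c s)) \<le> w s"
    and w1: "\<And>s. s \<in> S \<Longrightarrow> 1 \<le> w s \<and> w s \<le> esz (env s)"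
    and size: "qb S (\<lambda>s. esz (env s)) (\<lambda>s. data_size (g s))"
  shows "computable S env g"
proof -
  let ?N = "\<lambda>s. esz (env s)"
  let ?S1 = "{s\<in>S. nd s}" and ?S0 = "{s\<in>S. \<not> nd s}"
  let ?env1 = "\<lambda>s. map (\<lambda>c. g (c s)) cs @ env s"
  obtain B where B: "qb S ?N B" 
    "\<And>off. \<exists>Q e. \<forall>pre post. length pre = off \<longrightarrow>
        (\<forall>s\<in>S. \<exists>t\<le>B s. eval bar (pre @ Q @ post) (env s) e (truth (nd s)) t)"
    using compE[OF nd] by blast
  obtain L where L: "qb ?S0 ?N L" 
    "\<And>off. \<exists>Q e. \<forall>pre post. length pre = off \<longrightarrow>
        (\<forall>s\<in>?S0. \<exists>t\<le>L s. eval bar (pre @ Q @ post) (env s) e (g s) t)"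
    using compE[OF leaf] by blast
  obtain H where H: "qb ?S1 (\<lambda>s. esz (?env1 s)) H" 
    "\<And>off. \<exists>Q e. \<forall>pre post. length pre = off \<longrightarrow>
        (\<forall>s\<in>?S1. \<exists>t\<le>H s. eval bar (pre @ Q @ post) (?env1 s) e (g s) t)"
    using compE[OF node] by blast
  obtain A where A: "qb ?S1 ?N A" "\<And>off. \<exists>Q ess. \<forall>pre post. length pre = off \<longrightarrow>
        (\<forall>s\<in>?S1. list_all2 (\<lambda>c es. \<exists>t\<le>A s. evals bar (pre @ Q @ post) (env s) es (env (c s)) t) cs ess)"
    using comps_list[of cs ?S1 env env] args by blast
  obtain kg where kg: "\<And>s. s \<in> S \<Longrightarrow> data_size (g s) \<le> bd kg (?N s)" using size by (auto simp: qb_def)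
  obtain kb where kb: "\<And>s. s \<in> S \<Longrightarrow> B s \<le> bd kb (?N s)" using B(1) by (auto simp: qb_def)
  obtain kl where kl: "\<And>s. s \<in> S \<Longrightarrow> \<not> nd s \<Longrightarrow> L s \<le> bd kl (?N s)" using L(1) by (auto simp: qb_def)
  obtain ka where ka: "\<And>s. s \<in> S \<Longrightarrow> nd s \<Longrightarrow> A s \<le> bd ka (?N s)" using A(1) by (auto simp: qb_def)
  define m where "m = length cs"
  have gc: "data_size (g (c s)) \<le> bd kg (?N s)" if "c \<in> set cs" "s \<in> S" "nd s" for c s
    using kg[of "c s"] closed[OF that] bd_mono[of kg kg "?N (c s)" "?N s"] by auto
  have e1: "esz (?env1 s) \<le> m * bd kg (?N s) + ?N s" if "s \<in> S" "nd s" for s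
  proof -
    have "(\<Sum>c\<leftarrow>cs. data_size (g (c s))) \<le> (\<Sum>c\<leftarrow>cs. bd kg (?N s))"
      using gc that by (intro sum_list_mono) auto
    moreover have "esz (map (\<lambda>c. g (c s)) cs) = (\<Sum>c\<leftarrow>cs. data_size (g (c s)))"
      by (simp add: esz_def o_def)
    ultimately show ?thesis by (simp add: m_def sum_list_triv)
  qed
  have "qb ?S1 ?N H"
    by (rule qb_compose[OF H(1), of ?S1 "\<lambda>x. x" ?N, simplified])
      (rule qb_mono[where f = "\<lambda>s. m * bd kg (?N s) + ?N s"], intro qb_intros, use e1 in auto)
  then obtain kh where kh: "\<And>s. s \<in> S \<Longrightarrow> nd s \<Longrightarrow> H s \<le> bd kh (?N s)" by (auto simp: qb_def)
  \<comment> \<open>The cost of one call apart from its recursive calls, at input size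
    \<open>x\<close>: the test, the transfer of arguments and results for \<open>m\<close> children,
    the node body or the leaf, and the return of the value.\<close>
  define X where "X = (\<lambda>x. bd kb x + (m * (bd ka x + bd kg x) + x + bd kh x + bd kg x) + bd kl x + bd kg x)"
  have Xmono: "X x \<le> X y" if "x \<le> y" for x y
    unfolding X_def using that by (intro add_mono mult_le_mono bd_mono) auto
  have qbX: "qb S ?N (\<lambda>s. X (?N s))" unfolding X_def by (intro qb_intros)
  show ?thesis
  proof (rule compI)
    show "qb S ?N (\<lambda>s. ?N s + ?N s * X (?N s) + ?N s * X (?N s))" by (intro qb_intros qbX)
    fix off
    obtain Qb eb where Qb: "\<forall>pre post. length pre = off + 2 \<longrightarrow>
        (\<forall>s\<in>S. \<exists>t\<le>B s. eval bar (pre @ Qb @ post) (env s) eb (truth (nd s)) t)" using B(2) by blast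
    obtain Ql el where Ql: "\<forall>pre post. length pre = off + 2 + length Qb \<longrightarrow>
        (\<forall>s\<in>?S0. \<exists>t\<le>L s. eval bar (pre @ Ql @ post) (env s) el (g s) t)" using L(2) by blast
    obtain Qh eh where Qh: "\<forall>pre post. length pre = off + 2 + length Qb + length Ql \<longrightarrow>
        (\<forall>s\<in>?S1. \<exists>t\<le>H s. eval bar (pre @ Qh @ post) (?env1 s) eh (g s) t)" using H(2) by blast
    obtain Qa ess where Qa: "\<forall>pre post. length pre = off + 2 + length Qb + length Ql + length Qh \<longrightarrow>
        (\<forall>s\<in>?S1. list_all2 (\<lambda>c es. \<exists>t\<le>A s. evals bar (pre @ Qa @ post) (env s) es (env (c s)) t) cs ess)"
      using A(2) by blast
    \<comment> \<open>Index \<open>off\<close> is the recursive function, \<open>off + 1\<close> its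
      node body, which finds the results of the recursive calls in front of the original
      environment.\<close>
    define f where "f = Cond eb (Call (off + 1) (map (Call off) ess @ map Var [0..<n])) el"
    define Q where "Q = [f, eh] @ Qb @ Ql @ Qh @ Qa"
    show "\<exists>Q e. \<forall>pre post. length pre = off \<longrightarrow>
        (\<forall>s\<in>S. \<exists>t\<le>?N s + ?N s * X (?N s) + ?N s * X (?N s). eval bar (pre @ Q @ post) (env s) e (g s) t)"
    proof (rule exI, rule exI, intro allI impI ballI)
      fix pre post :: program and s0 assume pre: "length pre = off" and s0: "s0 \<in> S"
      define P where "P = pre @ Q @ post"
      have Pf: "off < length P" "P ! off = f" "off + 1 < length P" "P ! (off + 1) = eh"
        using pre by (auto simp: P_def Q_def nth_append)
      have Eb: "\<exists>t\<le>B s. eval bar P (env s) eb (truth (nd s)) t" if "s \<in> S" for s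
        using Qb[rule_format, of "pre @ [f, eh]" s "Ql @ Qh @ Qa @ post"] that pre by (simp add: P_def Q_def)
      have El: "\<exists>t\<le>L s. eval bar P (env s) el (g s) t" if "s \<in> S" "\<not> nd s" for s
        using Ql[rule_format, of "pre @ [f, eh] @ Qb" s "Qh @ Qa @ post"] that pre by (simp add: P_def Q_def)
      have Eh: "\<exists>t\<le>H s. eval bar P (?env1 s) eh (g s) t" if "s \<in> S" "nd s" for s
        using Qh[rule_format, of "pre @ [f, eh] @ Qb @ Ql" s "Qa @ post"] that pre by (simp add: P_def Q_def)
      have Ea: "list_all2 (\<lambda>c es. \<exists>t\<le>A s. evals bar P (env s) es (env (c s)) t) cs ess" if "s \<in> S" "nd s" for s
        using Qa[rule_format, of "pre @ [f, eh] @ Qb @ Ql @ Qh" s post] that pre by (simp add: P_def Q_def)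
      \<comment> \<open>The weights of the children sum to less than that of the node, so there are
        at most \<open>w s\<close> calls; environments do not grow, so each costs at most
        \<open>X\<close> at the size of the root.\<close>
      have main: "\<exists>t\<le>w s * X (?N s). eval bar P (env s) f (g s) t" if "s \<in> S" for s
        using that
      proof (induction "w s" arbitrary: s rule: less_induct)
        case less
        note s = \<open>s \<in> S\<close>
        obtain tb where tb: "tb \<le> B s" "eval bar P (env s) eb (truth (nd s)) tb" using Eb[OF s] by blast
        show ?case
        proof (cases "nd s")
          case False
          obtain tl where tl: "tl \<le> L s" "eval bar P (env s) el (g s) tl" using El[OF s False] by blast
          have "eval bar P (env s) f (g s) (tb + tl + data_size (g s))"
            unfolding f_def using tb(2) tl(2) False by (intro eval_evals.Cond_false) (auto simp: truth_def)
          moreover have "tb + tl + data_size (g s) \<le> X (?N s)"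
            using tb(1) kb[OF s] tl(1) kl[OF s False] kg[OF s] by (simp add: X_def)
          moreover have "1 * X (?N s) \<le> w s * X (?N s)" using w1[OF s] by (intro mult_le_mono) auto
          ultimately show ?thesis by (intro exI[of _ "tb + tl + data_size (g s)"]) linarith
        next
          case True
          let ?c = "bd ka (?N s) + bd kg (?N s)"
          have child: "\<exists>t\<le>w (c s) * X (?N s). eval bar P (env (c s)) f (g (c s)) t" if cc: "c \<in> set cs" for c
          proof -
            have "w (c s) < w s"
              using w[OF s True] member_le_sum_list[of "w (c s)" "map (\<lambda>c. w (c s)) cs"] cc by force
            then obtain t where "t \<le> w (c s) * X (?N (c s))" "eval bar P (env (c s)) f (g (c s)) t"
              using less(1)[of "c s"] closed[OF cc s True] by blast
            moreover have "w (c s) * X (?N (c s)) \<le> w (c s) * X (?N s)"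
              using closed[OF cc s True] Xmono by simp
            ultimately show ?thesis by (meson le_trans)
          qed
          have "\<exists>t\<le>(\<Sum>c\<leftarrow>cs'. w (c s)) * X (?N s) + length cs' * ?c.
             evals bar P (env s) (map (Call off) ess') (map (\<lambda>c. g (c s)) cs') t"
            if "list_all2 (\<lambda>c es. \<exists>t\<le>A s. evals bar P (env s) es (env (c s)) t) cs' ess'" "set cs' \<subseteq> set cs" for cs' ess'
            using that
          proof (induction rule: list_all2_induct)
            case Nil
            then show ?case by (auto intro: eval_evals.Nil)
          next
            case (Cons c cs' es ess')
            obtain t1 where t1: "t1 \<le> (\<Sum>c\<leftarrow>cs'. w (c s)) * X (?N s) + length cs' * ?c"
              "evals bar P (env s) (map (Call off) ess') (map (\<lambda>c. g (c s)) cs') t1" using Cons by auto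
            obtain ta where ta: "ta \<le> A s" "evals bar P (env s) es (env (c s)) ta" using Cons by auto
            obtain tc where tc: "tc \<le> w (c s) * X (?N s)" "eval bar P (env (c s)) f (g (c s)) tc"
              using child[of c] Cons by auto
            have "eval bar P (env s) (Call off es) (g (c s)) (ta + tc + data_size (g (c s)))"
              using Pf tc(2) by (intro eval_evals.Call[OF _ ta(2)]) auto
            then have "evals bar P (env s) (map (Call off) (es # ess')) (map (\<lambda>c. g (c s)) (c # cs'))
              (ta + tc + data_size (g (c s)) + t1)" using t1(2) by (auto intro: eval_evals.Cons)
            moreover have "ta + tc + data_size (g (c s)) + t1 \<le>
                (\<Sum>c\<leftarrow>c # cs'. w (c s)) * X (?N s) + length (c # cs') * ?c"
              using ta(1) ka[OF s True] tc(1) t1(1) gc[of c s] Cons.prems s True by (simp add: algebra_simps)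
            ultimately show ?case by blast
          qed
          from this[OF Ea[OF s True]] obtain tr where tr: "tr \<le> (\<Sum>c\<leftarrow>cs. w (c s)) * X (?N s) + m * ?c"
            "evals bar P (env s) (map (Call off) ess) (map (\<lambda>c. g (c s)) cs) tr" by (auto simp: m_def)
          obtain th where th: "th \<le> H s" "eval bar P (?env1 s) eh (g s) th" using Eh[OF s True] by blast
          have "eval bar P (env s) (Call (off + 1) (map (Call off) ess @ map Var [0..<n])) (g s)
             ((tr + ?N s) + th + data_size (g s))"
            using Pf th(2) by (intro eval_evals.Call[OF _ evals_append[OF tr(2) evals_all_Vars[OF len[OF s]]]]) auto
          then have "eval bar P (env s) f (g s) (tb + ((tr + ?N s) + th + data_size (g s)) + data_size (g s))"
            unfolding f_def using True by (intro eval_evals.Cond_true[OF tb(2)]) (auto simp: truth_def)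
          moreover have "tb + ((tr + ?N s) + th + data_size (g s)) + data_size (g s) \<le> w s * X (?N s)"
          proof -
            have "tb + ((tr + ?N s) + th + data_size (g s)) + data_size (g s) \<le>
               (\<Sum>c\<leftarrow>cs. w (c s)) * X (?N s) + X (?N s)"
              using tr(1) tb(1) th(1) kb[OF s] kh[OF s True] kg[OF s] by (simp add: X_def)
            also have "\<dots> = (1 + (\<Sum>c\<leftarrow>cs. w (c s))) * X (?N s)" by simp
            also have "\<dots> \<le> w s * X (?N s)" using w[OF s True] by (intro mult_le_mono) auto
            finally show ?thesis .
          qed
          ultimately show ?thesis by blast
        qed
      qed
      obtain t where t: "t \<le> w s0 * X (?N s0)" "eval bar P (env s0) f (g s0) t" using main[OF s0] by blast
      have t2: "t \<le> ?N s0 * X (?N s0)"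
        using order_trans[OF t(1) mult_le_mono1] w1[OF s0] by blast
      have "eval bar P (env s0) (Call off (map Var [0..<n])) (g s0) (?N s0 + t + data_size (g s0))"
        using Pf t(2) by (intro eval_evals.Call[OF _ evals_all_Vars[OF len[OF s0]]]) auto
      then show "\<exists>t\<le>?N s0 + ?N s0 * X (?N s0) + ?N s0 * X (?N s0).
          eval bar (pre @ Q @ post) (env s0) (Call off (map Var [0..<n])) (g s0) t"
        using t2 eval_data_size(1)[OF t(2)] by (intro exI[of _ "?N s0 + t + data_size (g s0)"]) (auto simp: P_def)
    qed
  qed
qed

end

section \<open>Formulae modulo equality and open deductions\<close>

\<comment> \<open>The rule \<open>=\<close> belongs to every subsystem, so premisses and conclusions
  need only be tracked modulo \<open>form_eq\<close>. On the classes the connectives are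
  associative, commutative operations with units, and rearrangement becomes simplification.\<close>
quotient_type 'a qform = "'a form" / form_eq
  by (intro equivpI reflpI sympI transpI) (auto intro: form_eq.intros)

lemma form_eq_Disj: "form_eq A A' \<Longrightarrow> form_eq B B' \<Longrightarrow> form_eq (Disj A B) (Disj A' B')"
  using form_eq.ctxt[of A A' "DisjL Hole B"] form_eq.ctxt[of B B' "DisjR A' Hole"]
  by (auto intro: form_eq.trans)

lemma form_eq_Conj: "form_eq A A' \<Longrightarrow> form_eq B B' \<Longrightarrow> form_eq (Conj A B) (Conj A' B')"
  using form_eq.ctxt[of A A' "ConjL Hole B"] form_eq.ctxt[of B B' "ConjR A' Hole"]
  by (auto intro: form_eq.trans)

lift_definition qor :: "'a qform \<Rightarrow> 'a qform \<Rightarrow> 'a qform" (infixr "\<oplus>" 65) is Disj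
  by (rule form_eq_Disj)
lift_definition qand :: "'a qform \<Rightarrow> 'a qform \<Rightarrow> 'a qform" (infixr "\<odot>" 70) is Conj
  by (rule form_eq_Conj)
lift_definition qF :: "'a qform" is FF .
lift_definition qT :: "'a qform" is TT .
lift_definition cls :: "'a form \<Rightarrow> 'a qform" is "\<lambda>A. A" .

lemma cls_eq_iff: "cls A = cls B \<longleftrightarrow> form_eq A B" by transfer simp

lemma cls_simps [simp]: "cls (Disj A B) = cls A \<oplus> cls B" "cls (Conj A B) = cls A \<odot> cls B"
  "cls FF = qF" "cls TT = qT"
  by (transfer, simp add: form_eq.refl)+

lemma q_ac:
  "(x \<oplus> y) \<oplus> z = x \<oplus> (y \<oplus> z)" "x \<oplus> y = y \<oplus> x"
  "(x \<odot> y) \<odot> z = x \<odot> (y \<odot> z)" "x \<odot> y = y \<odot> x"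
  by (transfer, rule form_eq.disj_comm form_eq.conj_comm form_eq.disj_assoc form_eq.conj_assoc
      form_eq.disj_FF form_eq.conj_TT form_eq.disj_TT form_eq.conj_FF)+

lemma q_left_comm: "x \<oplus> (y \<oplus> z) = y \<oplus> (x \<oplus> z)" "x \<odot> (y \<odot> z) = y \<odot> (x \<odot> z)"
  by (metis q_ac)+

text \<open>Conjunction with \<open>f\<close> is idempotent, but none of these laws swallows the
  other conjunct; what happens to a formula conjoined with \<open>f\<close> is the business of
  \<open>absorb\<close>.\<close>

lemma q_unit [simp]: "x \<oplus> qF = x" "x \<odot> qT = x" "qF \<oplus> x = x" "qT \<odot> x = x"
  "qT \<oplus> qT = qT" "qF \<odot> qF = qF" "qF \<odot> (qF \<odot> x) = qF \<odot> x"
proof -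
  show 1: "x \<oplus> qF = x" "x \<odot> qT = x" "qT \<oplus> qT = qT" "qF \<odot> qF = qF" for x :: "'a qform"
    by (transfer, rule form_eq.disj_comm form_eq.conj_comm form_eq.disj_assoc form_eq.conj_assoc
      form_eq.disj_FF form_eq.conj_TT form_eq.disj_TT form_eq.conj_FF)+
  show "qF \<oplus> x = x" "qT \<odot> x = x" using 1 q_ac by metis+
  show "qF \<odot> (qF \<odot> x) = qF \<odot> x" using 1 q_ac by metis
qed

lemmas q_simps = q_ac q_left_comm

text \<open>Open deductions compose derivations horizontally by the connectives and vertically by
  inference steps, so contexts need not be threaded through the construction.\<close>

datatype 'a ded =
    Fm "'a form"
  | DOr "'a ded" "'a ded"
  | DAnd "'a ded" "'a ded"
  | DSeq rule "'a ded" "'a ded"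

primrec pr :: "'a ded \<Rightarrow> 'a form" where
  "pr (Fm A) = A"
| "pr (DOr d e) = Disj (pr d) (pr e)"
| "pr (DAnd d e) = Conj (pr d) (pr e)"
| "pr (DSeq r d e) = pr d"

primrec cn :: "'a ded \<Rightarrow> 'a form" where
  "cn (Fm A) = A"
| "cn (DOr d e) = Disj (cn d) (cn e)"
| "cn (DAnd d e) = Conj (cn d) (cn e)"
| "cn (DSeq r d e) = cn e"

text \<open>Parallel components are independent, so any interleaving is a derivation; running the
  left one first yields exactly one step per vertical composition.\<close>

primrec steps :: "'a ded \<Rightarrow> (rule \<times> 'a form) list" where
  "steps (Fm A) = []"
| "steps (DOr d e) = map (\<lambda>(r, C). (r, Disj C (pr e))) (steps d) @ map (\<lambda>(r, C). (r, Disj (cn d) C)) (steps e)"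
| "steps (DAnd d e) = map (\<lambda>(r, C). (r, Conj C (pr e))) (steps d) @ map (\<lambda>(r, C). (r, Conj (cn d) C)) (steps e)"
| "steps (DSeq r d e) = steps d @ (r, pr e) # steps e"

primrec plug_ctxt :: "'a ctxt \<Rightarrow> 'a ctxt \<Rightarrow> 'a ctxt" where
  "plug_ctxt Hole \<eta> = \<eta>"
| "plug_ctxt (DisjL \<xi> B) \<eta> = DisjL (plug_ctxt \<xi> \<eta>) B"
| "plug_ctxt (DisjR A \<xi>) \<eta> = DisjR A (plug_ctxt \<xi> \<eta>)"
| "plug_ctxt (ConjL \<xi> B) \<eta> = ConjL (plug_ctxt \<xi> \<eta>) B"
| "plug_ctxt (ConjR A \<xi>) \<eta> = ConjR A (plug_ctxt \<xi> \<eta>)"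

lemma plug_plug_ctxt: "plug (plug_ctxt \<xi> \<eta>) A = plug \<xi> (plug \<eta> A)"
  by (induction \<xi>) auto

lemma inference_step_plug:
  "inference_step bar r A B \<Longrightarrow> inference_step bar r (plug \<xi> A) (plug \<xi> B)"
  by (auto elim!: inference_step.cases simp: plug_plug_ctxt[symmetric] intro: inference_step.intros)

lemma inference_step_top: "rule_inst bar r A B \<Longrightarrow> inference_step bar r A B"
  using inference_step.intros[of bar r A B Hole] by simp

lemmas inference_step_ctxt =
  inference_step_plug[where \<xi> = "DisjL Hole B" for B, simplified]
  inference_step_plug[where \<xi> = "DisjR A Hole" for A, simplified]
  inference_step_plug[where \<xi> = "ConjL Hole B" for B, simplified]
  inference_step_plug[where \<xi> = "ConjR A Hole" for A, simplified]

lemma chain_append: "chain bar S A xs B \<Longrightarrow> chain bar S B ys C \<Longrightarrow> chain bar S A (xs @ ys) C"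
  by (induction bar S A xs B rule: chain.induct) auto

lemma chain_map:
  assumes "\<And>r C D. inference_step bar r C D \<Longrightarrow> inference_step bar r (f C) (f D)"
  shows "chain bar S A xs B \<Longrightarrow> chain bar S (f A) (map (\<lambda>(r, C). (r, f C)) xs) (f B)"
  by (induction xs arbitrary: A) (auto intro: assms)

section \<open>Derived structural rules, absorption, and the merging of alternatives\<close>

definition seq :: "'a ded \<Rightarrow> 'a ded \<Rightarrow> 'a ded" where
  "seq d e = DSeq Equality d e"

definition sw :: "'a form \<Rightarrow> 'a form \<Rightarrow> 'a form \<Rightarrow> 'a ded" where
  "sw A B C = DSeq Switch (Fm (Conj A (Disj B C))) (Fm (Disj (Conj A B) C))"

definition md :: "'a form \<Rightarrow> 'a form \<Rightarrow> 'a form \<Rightarrow> 'a form \<Rightarrow> 'a ded" where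
  "md A B C D = DSeq Medial (Fm (Disj (Conj A B) (Conj C D))) (Fm (Conj (Disj A C) (Disj B D)))"

text \<open>Only \<open>TT\<close> needs a trick: since \<open>t \<or> t = t\<close>,
  \<open>f\<close> equals \<open>f \<and> (t \<or> t)\<close>, from which switch gives
  \<open>(f \<and> t) \<or> t = t\<close>.\<close>

primrec weak :: "'a form \<Rightarrow> 'a ded" where
  "weak FF = Fm FF"
| "weak TT = sw FF TT TT"
| "weak (Atom a) = DSeq AwDown (Fm FF) (Fm (Atom a))"
| "weak (Disj A B) = DOr (weak A) (weak B)"
| "weak (Conj A B) = DAnd (weak A) (weak B)"

primrec contr :: "'a form \<Rightarrow> 'a ded" where
  "contr FF = Fm FF"
| "contr TT = Fm TT"
| "contr (Atom a) = DSeq AcDown (Fm (Disj (Atom a) (Atom a))) (Fm (Atom a))"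
| "contr (Disj A B) = DOr (contr A) (contr B)"
| "contr (Conj A B) = seq (md A B A B) (DAnd (contr A) (contr B))"

primrec cocontr :: "'a form \<Rightarrow> 'a ded" where
  "cocontr FF = Fm FF"
| "cocontr TT = Fm TT"
| "cocontr (Atom a) = DSeq AcUp (Fm (Atom a)) (Fm (Conj (Atom a) (Atom a)))"
| "cocontr (Disj A B) = seq (DOr (cocontr A) (cocontr B)) (md A A B B)"
| "cocontr (Conj A B) = DAnd (cocontr A) (cocontr B)"

definition mix :: "'a form \<Rightarrow> 'a form \<Rightarrow> 'a ded" where
  "mix A B = seq (sw B FF A) (DOr (sw FF FF B) (Fm A))"

text \<open>Each of the two switches consumes one copy of \<open>C\<close>, hence the premiss with
  \<open>C\<close> doubled. The second copy comes from cocontraction or, for \<open>f\<close>, from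
  idempotence.\<close>

definition distr :: "'a form \<Rightarrow> 'a form \<Rightarrow> 'a form \<Rightarrow> 'a ded" where
  "distr C A B = seq (DAnd (Fm C) (sw C A B)) (sw C B (Conj C A))"

text \<open>Atoms are listed as formulae, so that lists of atoms share the encoding of
  formulae.\<close>

primrec afl :: "'a form \<Rightarrow> 'a form list" where
  "afl FF = []"
| "afl TT = []"
| "afl (Atom a) = [Atom a]"
| "afl (Disj A B) = afl A @ afl B"
| "afl (Conj A B) = afl A @ afl B"

text \<open>Leads from \<open>f \<and> P\<close> to \<open>G\<close> by growing \<open>G\<close>
  around one occurrence of \<open>P\<close>. The conjoined \<open>f\<close> pays for siblings under
  a conjunction: \<open>f \<and> P = (f \<and> P) \<and> f\<close>, and \<open>weak\<close> makes
  the sibling out of the second \<open>f\<close>. The leaf is the switch that drops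
  \<open>f\<close>.\<close>

primrec embed :: "'a form \<Rightarrow> 'a form \<Rightarrow> 'a ded" where
  "embed P FF = sw FF FF P"
| "embed P TT = sw FF FF P"
| "embed P (Atom a) = sw FF FF P"
| "embed P (Disj A B) =
    (if P \<in> set (afl A) then DOr (embed P A) (weak B) else DOr (weak A) (embed P B))"
| "embed P (Conj A B) =
    (if P \<in> set (afl A) then DAnd (embed P A) (weak B) else DAnd (weak A) (embed P B))"

text \<open>Leads from \<open>f \<and> A\<close> to \<open>G\<close> when all atoms of
  \<open>A\<close> occur in \<open>G\<close>. Idempotence of \<open>f\<close> gives each component
  of \<open>A\<close> its own \<open>f\<close>, and \<open>mix\<close> turns a conjunction into a
  disjunction, so both connectives end in two copies of \<open>G\<close> to be contracted.\<close>

primrec absorb :: "'a form \<Rightarrow> 'a form \<Rightarrow> 'a ded" where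
  "absorb G FF = weak G"
| "absorb G TT = weak G"
| "absorb G (Atom a) = embed (Atom a) G"
| "absorb G (Disj A B) = seq (distr FF A B) (seq (DOr (absorb G A) (absorb G B)) (contr G))"
| "absorb G (Conj A B) = seq (mix (Conj FF A) (Conj FF B)) (seq (DOr (absorb G A) (absorb G B)) (contr G))"

text \<open>\<open>R\<close> is the alternative that derivations carry along; \<open>joinO\<close>
  and \<open>joinA\<close> merge the alternatives of two components into one.\<close>

definition joinO :: "'a form \<Rightarrow> 'a form \<Rightarrow> 'a form \<Rightarrow> 'a ded" where
  "joinO A B R = DOr (Fm (Disj A B)) (contr R)"

definition joinA :: "'a form \<Rightarrow> 'a form \<Rightarrow> 'a form \<Rightarrow> 'a ded" where
  "joinA A B R = seq (sw (Disj A R) B R) (seq (DOr (sw B A R) (Fm R)) (DOr (Fm (Conj A B)) (contr R)))"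

primrec erase :: "'a form \<Rightarrow> 'a form \<Rightarrow> 'a form" where
  "erase P FF = FF"
| "erase P TT = TT"
| "erase P (Atom a) = (if Atom a = P then FF else Atom a)"
| "erase P (Disj A B) = Disj (erase P A) (erase P B)"
| "erase P (Conj A B) = Conj (erase P A) (erase P B)"

text \<open>Takes the role of the identity axiom: it leads from \<open>A\<close> to
  \<open>A{P := f} \<or> P\<close>, and when \<open>A\<close> is a threshold the first disjunct
  stands for the negation of \<open>P\<close>.\<close>

primrec pull_out :: "'a form \<Rightarrow> 'a form \<Rightarrow> 'a ded" where
  "pull_out P FF = DOr (weak P) (Fm FF)"
| "pull_out P TT = DOr (weak P) (Fm TT)"
| "pull_out P (Atom a) = (if Atom a = P then Fm P else DOr (weak P) (Fm (Atom a)))"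
| "pull_out P (Disj A B) = seq (DOr (pull_out P A) (pull_out P B)) (joinO (erase P A) (erase P B) P)"
| "pull_out P (Conj A B) = seq (DAnd (pull_out P A) (pull_out P B)) (joinA (erase P A) (erase P B) P)"

section \<open>Threshold formulae\<close>

primrec disj_list :: "'a form list \<Rightarrow> 'a form" where
  "disj_list [] = FF"
| "disj_list (A # As) = Disj A (disj_list As)"

text \<open>Lists of lists behave like polynomials given by their coefficients; this is addition,
  with concatenation of coefficients.\<close>

fun append_zip :: "'b list list \<Rightarrow> 'b list list \<Rightarrow> 'b list list" where
  "append_zip [] yss = yss"
| "append_zip (xs # xss) [] = xs # xss"
| "append_zip (xs # xss) (ys # yss) = (xs @ ys) # append_zip xss yss"

text \<open>Multiplication in the same sense: entry \<open>k\<close> collects the pairs whose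
  positions add up to \<open>k\<close>, just as \<open>k\<close> true leaves are distributed over
  two subtrees.\<close>

primrec conv :: "'b list \<Rightarrow> 'c list \<Rightarrow> ('b \<times> 'c) list list" where
  "conv [] ys = []"
| "conv (x # xs) ys = append_zip (map (\<lambda>y. [(x, y)]) ys) ([] # conv xs ys)"

text \<open>Conjunctions serve as binary trees of atoms; entry \<open>k\<close> of \<open>thr t\<close> says that at least \<open>k\<close> of
  the leaves are true.\<close>

primrec thr :: "'a form \<Rightarrow> 'a form list" where
  "thr FF = [TT]"
| "thr TT = [TT]"
| "thr (Atom a) = [TT, Atom a]"
| "thr (Disj l r) = [TT]"
| "thr (Conj l r) = map (\<lambda>ps. disj_list (map (\<lambda>(x, y). Conj x y) ps)) (conv (thr l) (thr r))"

section \<open>Derivations from one threshold to the next\<close>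

primrec inj_disj :: "'a form \<Rightarrow> 'a form \<Rightarrow> 'a ded" where
  "inj_disj A FF = Fm A"
| "inj_disj A TT = Fm A"
| "inj_disj A (Atom a) = Fm A"
| "inj_disj A (Conj B C) = Fm A"
| "inj_disj A (Disj B C) = (if A = B then DOr (Fm A) (weak C) else DOr (weak B) (inj_disj A C))"

text \<open>\<open>d\<close> has raised one factor to \<open>X\<close>, up to the alternative
  \<open>G\<close>, and \<open>Y\<close> is the other factor. If the raised threshold ran off the
  end, then \<open>X\<close> is \<open>f\<close>, and \<open>f \<and> Y\<close> is absorbed by
  \<open>G\<close>; otherwise \<open>A\<close> is a disjunct of the next threshold
  \<open>H\<close>.\<close>

definition raise_term :: "'a form \<Rightarrow> 'a ded \<Rightarrow> 'a form \<Rightarrow> 'a form \<Rightarrow> 'a form \<Rightarrow> 'a form \<Rightarrow> 'a ded" where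
  "raise_term G d X Y A H = seq (DAnd d (Fm Y)) (seq (sw Y X G)
     (seq (DOr (if X = FF then DOr (absorb G Y) (weak H) else DOr (inj_disj A H) (weak G)) (Fm G))
        (DOr (Fm H) (contr G))))"

text \<open>\<open>P\<close> is duplicated at every disjunct and distributed over the disjunction.
  The empty disjunction leaves \<open>P \<and> f\<close>, which \<open>embed\<close> takes to
  \<open>G\<close>.\<close>

primrec raise_disj :: "'a form \<Rightarrow> 'a form \<Rightarrow> 'a form \<Rightarrow> ('a form \<times> 'a ded) list \<Rightarrow> 'a ded" where
  "raise_disj P G H [] = DOr (embed P G) (weak H)"
| "raise_disj P G H (x # xs) = seq (DAnd (cocontr P) (Fm (Disj (fst x) (disj_list (map fst xs)))))
     (seq (distr P (fst x) (disj_list (map fst xs))) (seq (DOr (snd x) (raise_disj P G H xs)) (contr (Disj H G))))"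

text \<open>Entry \<open>k\<close> is \<open>\<theta>\<^sub>k\<^sub>+\<^sub>1\<close>; a threshold
  beyond the number of leaves is \<open>f\<close>.\<close>

definition succs :: "'a form list \<Rightarrow> 'a form list" where
  "succs X = tl X @ [FF]"

definition triples :: "'a form list \<Rightarrow> 'a ded list \<Rightarrow> ('a form \<times> ('a form \<times> 'a ded)) list" where
  "triples X D = zip X (zip (succs X) D)"

text \<open>\<open>P\<close> occurs in only one of the two subtrees, and \<open>lf\<close> tells
  whether it is the left one. Only the factor from that subtree is raised; erasing \<open>P\<close>
  leaves the other factor as it is.\<close>

definition raise_pair :: "'a form \<Rightarrow> 'a form \<Rightarrow> bool \<Rightarrow> 'a form \<Rightarrow>
    ('a form \<times> ('a form \<times> 'a ded)) \<times> ('a form \<times> ('a form \<times> 'a ded)) \<Rightarrow> 'a form \<times> 'a ded" where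
  "raise_pair P G lf H q = (erase P (Conj (fst (fst q)) (fst (snd q))),
     if lf then raise_term G (snd (snd (fst q))) (fst (snd (fst q))) (fst (snd q))
                  (Conj (fst (snd (fst q))) (fst (snd q))) H
     else raise_term G (snd (snd (snd q))) (fst (snd (snd q))) (fst (fst q))
                  (Conj (fst (fst q)) (fst (snd (snd q)))) H)"

text \<open>Entry \<open>k\<close> of \<open>raise P G t\<close> derives \<open>\<theta>\<^sub>k\<^sub>+\<^sub>1 \<or> G\<close> from \<open>P \<and> \<theta>\<^sub>k{P := f}\<close>. The alternative \<open>G\<close>
  takes up what would have to be coweakened: \<open>f \<and> p\<close> entails \<open>G\<close> as soon as \<open>p\<close> occurs in \<open>G\<close>.\<close>

primrec raise :: "'a form \<Rightarrow> 'a form \<Rightarrow> 'a form \<Rightarrow> 'a ded list" where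
  "raise P G FF = [Fm FF]"
| "raise P G TT = [Fm FF]"
| "raise P G (Disj l r) = [Fm FF]"
| "raise P G (Atom a) = [DOr (Fm P) (weak G), embed P G]"
| "raise P G (Conj l r) =
     map (\<lambda>z. raise_disj P G (snd z) (map (raise_pair P G (P \<in> set (afl l)) (snd z)) (fst z)))
       (zip (conv (triples (thr l) (raise P G l)) (triples (thr r) (raise P G r))) (succs (thr (Conj l r))))"

section \<open>Indices of convolutions and thresholds\<close>

lemma length_append_zip: "length (append_zip xs ys) = max (length xs) (length ys)"
  by (induction xs ys rule: append_zip.induct) auto

lemma nth_append_zip: "k < length (append_zip xs ys) \<Longrightarrow>
  append_zip xs ys ! k = (if k < length xs then xs ! k else []) @ (if k < length ys then ys ! k else [])"
  by (induction xs ys arbitrary: k rule: append_zip.induct) (auto simp: nth_Cons split: nat.split)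

lemma length_conv: "ys \<noteq> [] \<Longrightarrow> length (conv xs ys) = (if xs = [] then 0 else length xs + length ys - 1)"
  by (induction xs) (auto simp: length_append_zip max_def Suc_diff_le neq_Nil_conv)

lemma set_conv: "k < length (conv xs ys) \<Longrightarrow> ys \<noteq> [] \<Longrightarrow>
  set (conv xs ys ! k) = {(xs ! a, ys ! b) | a b. a < length xs \<and> b < length ys \<and> a + b = k}"
proof (induction xs arbitrary: k)
  case (Cons x xs)
  let ?R = "\<lambda>xs k. {(xs ! a, ys ! b) | a b. a < length xs \<and> b < length ys \<and> a + b = k}"
  have R: "?R (x # xs) k = (if k < length ys then {(x, ys ! k)} else {}) \<union> (case k of 0 \<Rightarrow> {} | Suc k' \<Rightarrow> ?R xs k')"
  proof (rule set_eqI)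
    fix p
    \<comment> \<open>Left position 0 is the head \<open>x\<close>; the successors are the positions
      of \<open>xs\<close>.\<close>
    have ex_nat: "(\<exists>a. Q a) \<longleftrightarrow> Q 0 \<or> (\<exists>a. Q (Suc a))" for Q :: "nat \<Rightarrow> bool"
      by (metis not0_implies_Suc)
    have "p \<in> ?R (x # xs) k \<longleftrightarrow> (\<exists>a. a < Suc (length xs) \<and> (\<exists>b<length ys. p = ((x # xs) ! a, ys ! b) \<and> a + b = k))"
      by auto
    also have "\<dots> \<longleftrightarrow> (k < length ys \<and> p = (x, ys ! k)) \<or>
        (\<exists>a<length xs. \<exists>b<length ys. p = (xs ! a, ys ! b) \<and> Suc (a + b) = k)"
      by (subst ex_nat) auto
    also have "\<dots> \<longleftrightarrow> p \<in> (if k < length ys then {(x, ys ! k)} else {}) \<union> (case k of 0 \<Rightarrow> {} | Suc k' \<Rightarrow> ?R xs k')"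
      by (cases k) auto
    finally show "p \<in> ?R (x # xs) k \<longleftrightarrow> p \<in> (if k < length ys then {(x, ys ! k)} else {}) \<union> (case k of 0 \<Rightarrow> {} | Suc k' \<Rightarrow> ?R xs k')" .
  qed
  have "set (conv (x # xs) ys ! k) = (if k < length ys then {(x, ys ! k)} else {}) \<union>
      (case k of 0 \<Rightarrow> {} | Suc k' \<Rightarrow> if k' < length (conv xs ys) then set (conv xs ys ! k') else {})"
    using Cons.prems(1) by (simp add: nth_append_zip nth_Cons split: nat.split)
  moreover have "?R xs k' = {}" if "\<not> k' < length (conv xs ys)" for k'
    using that Cons.prems(2) by (auto simp: length_conv split: if_splits)
  ultimately show ?case unfolding R using Cons.IH Cons.prems(2) by (auto split: nat.split)
qed simp

lemma append_zip_map: "append_zip (map (map f) xs) (map (map f) ys) = map (map f) (append_zip xs ys)"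
  by (induction xs ys rule: append_zip.induct) auto

text \<open>Naturality: projecting the convolution of the annotated lists from
  \<open>triples\<close> gives back the convolution used in \<open>thr\<close>.\<close>

lemma conv_map: "conv (map f xs) (map g ys) = map (map (map_prod f g)) (conv xs ys)"
proof (induction xs)
  case (Cons x xs)
  let ?h = "map (map_prod f g)"
  have "conv (map f (x # xs)) (map g ys) = append_zip (map ?h (map (\<lambda>y. [(x, y)]) ys)) (map ?h ([] # conv xs ys))"
    by (simp add: Cons.IH o_def del: append_zip.simps)
  also have "\<dots> = map ?h (append_zip (map (\<lambda>y. [(x, y)]) ys) ([] # conv xs ys))"
    by (rule append_zip_map)
  finally show ?case by simp
qed simp

lemma conv_nonempty: "xs \<noteq> [] \<Longrightarrow> ys \<noteq> [] \<Longrightarrow> conv xs ys \<noteq> []"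
  by (cases xs; cases ys) auto

lemma thr_nonempty: "thr t \<noteq> []"
  by (induction t) (auto simp: conv_nonempty)

lemma length_thr_Conj: "length (thr (Conj l r)) = length (thr l) + length (thr r) - 1"
  using length_conv[OF thr_nonempty[of r], of "thr l"] thr_nonempty[of l] by simp

lemma length_succs: "X \<noteq> [] \<Longrightarrow> length (succs X) = length X"
  by (simp add: succs_def)

text \<open>Subtrees without \<open>P\<close> also receive one entry per threshold, so the lists
  combined by \<open>triples\<close> and \<open>conv\<close> stay aligned by position.\<close>

lemma length_raise: "length (raise P G t) = length (thr t)"
proof (induction t)
  case (Conj l r)
  have "length (triples (thr l) (raise P G l)) = length (thr l)" 
    "length (triples (thr r) (raise P G r)) = length (thr r)"
    using Conj by (simp_all add: triples_def length_succs[OF thr_nonempty])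
  then have "length (conv (triples (thr l) (raise P G l)) (triples (thr r) (raise P G r))) = length (thr (Conj l r))"
    using thr_nonempty[of l] thr_nonempty[of r] length_conv
    by (metis (no_types, lifting) length_0_conv length_thr_Conj)
  then show ?case using length_succs[OF thr_nonempty[of "Conj l r"]] by (simp del: thr.simps)
qed auto

lemma erase_id: "P \<notin> set (afl A) \<Longrightarrow> erase P A = A"
  by (induction A) auto

lemma erase_disj_list: "erase P (disj_list As) = disj_list (map (erase P) As)"
  by (induction As) auto

lemma afl_disj_list: "set (afl (disj_list As)) = (\<Union>A\<in>set As. set (afl A))"
  by (induction As) auto

lemma afl_erase: "set (afl (erase P A)) \<subseteq> set (afl A)"
  by (induction A) auto

lemma set_conv_subset:
  fixes X :: "'b list" and Y :: "'c list"
  shows "xs \<in> set (conv X Y) \<Longrightarrow> p \<in> set xs \<Longrightarrow> fst p \<in> set X \<and> snd p \<in> set Y"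
proof -
  assume a: "xs \<in> set (conv X Y)" "p \<in> set xs"
  show ?thesis
  proof (cases "Y = []")
    case True
    have e: "ys = []" if "ys \<in> set (conv X ([] :: 'c list))" for ys using that by (induction X) auto
    have "xs = []" using a(1) True by (intro e) simp
    then show ?thesis using a(2) by simp
  next
    case False
    obtain k where k: "k < length (conv X Y)" "xs = conv X Y ! k" using a(1) by (auto simp: in_set_conv_nth)
    then have "p \<in> {(X ! a, Y ! b) | a b. a < length X \<and> b < length Y \<and> a + b = k}"
      using a(2) set_conv[OF k(1) False] by simp
    then show ?thesis by auto
  qed
qed

lemma afl_thr: "A \<in> set (thr t) \<Longrightarrow> set (afl A) \<subseteq> set (afl t)"
proof (induction t arbitrary: A)
  case (Conj l r)
  then show ?case using set_conv_subset[of _ "thr l" "thr r"]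
    by (fastforce simp: afl_disj_list)
qed auto

text \<open>Recursive insertion into the right subtree and exchange of the subtrees keeps Braun trees
  balanced.\<close>

primrec ins :: "'a form \<Rightarrow> 'a form \<Rightarrow> 'a form" where
  "ins P FF = P"
| "ins P TT = Conj P TT"
| "ins P (Atom a) = Conj P (Atom a)"
| "ins P (Disj l r) = Conj P (Disj l r)"
| "ins P (Conj l r) = Conj (ins P r) l"

primrec leaves :: "'a form \<Rightarrow> nat" where
  "leaves FF = 0"
| "leaves TT = 0"
| "leaves (Atom a) = 1"
| "leaves (Disj l r) = 0"
| "leaves (Conj l r) = leaves l + leaves r"

text \<open>The extra leaf is on the left, matching \<open>ins\<close>, which moves the enlarged
  right subtree there. The empty tree \<open>FF\<close> is possible only at the root; it belongs to
  a conclusion without atoms.\<close>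

primrec braun :: "'a form \<Rightarrow> bool" where
  "braun FF \<longleftrightarrow> True"
| "braun TT \<longleftrightarrow> False"
| "braun (Atom a) \<longleftrightarrow> True"
| "braun (Disj l r) \<longleftrightarrow> False"
| "braun (Conj l r) \<longleftrightarrow> braun l \<and> braun r \<and> 1 \<le> leaves r \<and> leaves r \<le> leaves l \<and> leaves l \<le> leaves r + 1"

primrec dep :: "'a form \<Rightarrow> nat" where
  "dep FF = 0"
| "dep TT = 0"
| "dep (Atom a) = 0"
| "dep (Disj l r) = 0"
| "dep (Conj l r) = 1 + max (dep l) (dep r)"

lemma ins_Atom:
  assumes "P = Atom a" "braun t" 
  shows "braun (ins P t) \<and> leaves (ins P t) = leaves t + 1 \<and> set (afl (ins P t)) = insert P (set (afl t))
    \<and> (P \<notin> set (afl t) \<longrightarrow> distinct (afl t) \<longrightarrow> distinct (afl (ins P t)))"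
  using assms by (induction t) auto

text \<open>Depth at most twice the logarithm is precise enough for a quasipolynomial. With
  \<open>l\<close> and \<open>r\<close> leaves in the subtrees and \<open>l \<le> 2 * r\<close>,
  twice \<open>l * l\<close> is at most \<open>(l + r) * (l + r)\<close>.\<close>

lemma dep_braun: "braun t \<Longrightarrow> 1 \<le> leaves t \<Longrightarrow> 2 ^ dep t \<le> leaves t * leaves t"
proof (induction t)
  case (Conj l r)
  then have a: "leaves r \<le> leaves l" "leaves l \<le> leaves r + 1" "1 \<le> leaves r" by auto
  have l: "2 ^ dep l \<le> leaves l * leaves l" and r: "2 ^ dep r \<le> leaves r * leaves r" using Conj a by auto
  have "leaves r * leaves r \<le> leaves l * leaves l" using a by (intro mult_le_mono)
  with l r have m: "2 ^ max (dep l) (dep r) \<le> leaves l * leaves l" by (auto simp: max_def)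
  have "leaves l * leaves l \<le> leaves l * (2 * leaves r)" using a by (intro mult_le_mono) auto
  with m have "2 * 2 ^ max (dep l) (dep r) \<le> leaves l * leaves l + leaves l * (2 * leaves r)" by linarith
  then show ?case by (simp add: algebra_simps)
qed auto

section \<open>Validity of these derivations in the analytic system\<close>

context sks
begin

primrec valid :: "'a ded \<Rightarrow> bool" where
  "valid (Fm A) \<longleftrightarrow> True"
| "valid (DOr d e) \<longleftrightarrow> valid d \<and> valid e"
| "valid (DAnd d e) \<longleftrightarrow> valid d \<and> valid e"
| "valid (DSeq r d e) \<longleftrightarrow> valid d \<and> valid e \<and> r \<in> aSKS \<and> inference_step bar r (cn d) (pr e)"

lemma valid_chain: "valid d \<Longrightarrow> chain bar aSKS (pr d) (steps d) (cn d)"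
proof (induction d)
  case (DOr d e)
  have "chain bar aSKS (Disj (pr d) (pr e)) (map (\<lambda>(r, C). (r, Disj C (pr e))) (steps d)) (Disj (cn d) (pr e))"
    "chain bar aSKS (Disj (cn d) (pr e)) (map (\<lambda>(r, C). (r, Disj (cn d) C)) (steps e)) (Disj (cn d) (cn e))"
    using DOr by (auto intro: inference_step_ctxt chain_map[where f = "\<lambda>C. Disj C (pr e)"] chain_map[where f = "\<lambda>C. Disj (cn d) C"])
  then show ?case by (auto intro: chain_append)
next
  case (DAnd d e)
  have "chain bar aSKS (Conj (pr d) (pr e)) (map (\<lambda>(r, C). (r, Conj C (pr e))) (steps d)) (Conj (cn d) (pr e))"
    "chain bar aSKS (Conj (cn d) (pr e)) (map (\<lambda>(r, C). (r, Conj (cn d) C)) (steps e)) (Conj (cn d) (cn e))"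
    using DAnd by (auto intro: inference_step_ctxt chain_map[where f = "\<lambda>C. Conj C (pr e)"] chain_map[where f = "\<lambda>C. Conj (cn d) C"])
  then show ?case by (auto intro: chain_append)
next
  case (DSeq r d e)
  then have "chain bar aSKS (cn d) ((r, pr e) # steps e) (cn e)" by simp
  then show ?case using DSeq by (auto intro: chain_append)
qed auto

text \<open>Premiss and conclusion are prescribed only as classes; the equality steps inserted by
  \<open>seq\<close> close the gaps between adjacent pieces.\<close>

definition der :: "'a ded \<Rightarrow> 'a qform \<Rightarrow> 'a qform \<Rightarrow> bool" where
  "der d x y \<longleftrightarrow> valid d \<and> cls (pr d) = x \<and> cls (cn d) = y"

lemma der_Fm [intro]: "der (Fm A) (cls A) (cls A)" by (simp add: der_def)

lemma der_or: "der d x y \<Longrightarrow> der e x' y' \<Longrightarrow> der (DOr d e) (x \<oplus> x') (y \<oplus> y')"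
  by (simp add: der_def)

lemma der_and: "der d x y \<Longrightarrow> der e x' y' \<Longrightarrow> der (DAnd d e) (x \<odot> x') (y \<odot> y')"
  by (simp add: der_def)

lemma valid_seq [simp]: "valid d \<Longrightarrow> valid e \<Longrightarrow> cls (cn d) = cls (pr e) \<Longrightarrow> valid (seq d e)"
  by (simp add: seq_def cls_eq_iff aSKS_def SKS_def inference_step_top rule_inst.equality)

lemma seq_ends [simp]: "pr (seq d e) = pr d" "cn (seq d e) = cn e"
  by (simp_all add: seq_def)

lemma der_seq: "der d x y \<Longrightarrow> der e y' z \<Longrightarrow> y = y' \<Longrightarrow> der (seq d e) x z"
  by (simp add: der_def)

lemma valid_rule:
  "r \<in> aSKS \<Longrightarrow> rule_inst bar r A B \<Longrightarrow> valid (DSeq r (Fm A) (Fm B))"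
  by (simp add: inference_step_top)

lemma sw_valid [simp]: "valid (sw A B C)"
  unfolding sw_def by (rule valid_rule) (auto simp: aSKS_def SKS_def intro: rule_inst.intros)

lemma md_valid [simp]: "valid (md A B C D)"
  unfolding md_def by (rule valid_rule) (auto simp: aSKS_def SKS_def intro: rule_inst.intros)

lemma sw_md_ends [simp]: "pr (sw A B C) = Conj A (Disj B C)" "cn (sw A B C) = Disj (Conj A B) C"
  "pr (md A B C D) = Disj (Conj A B) (Conj C D)" "cn (md A B C D) = Conj (Disj A C) (Disj B D)"
  by (simp_all add: sw_def md_def)

lemma atomic_valid [simp]:
  "valid (DSeq AwDown (Fm FF) (Fm (Atom a)))"
  "valid (DSeq AcDown (Fm (Disj (Atom a) (Atom a))) (Fm (Atom a)))"
  "valid (DSeq AcUp (Fm (Atom a)) (Fm (Conj (Atom a) (Atom a))))"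
  "valid (DSeq AiDown (Fm TT) (Fm (Disj (Atom a) (Atom (bar a)))))"
  by (rule valid_rule, simp add: aSKS_def SKS_def, rule rule_inst.intros)+

declare valid.simps(4) [simp del]

lemma weak_der: "der (weak A) qF (cls A)"
  by (induction A) (auto simp: der_def)

lemma contr_der: "der (contr A) (cls A \<oplus> cls A) (cls A)"
  by (induction A) (auto simp: der_def q_simps)

lemma cocontr_der: "der (cocontr A) (cls A) (cls A \<odot> cls A)"
  by (induction A) (auto simp: der_def q_simps)

lemma mix_der: "der (mix A B) (cls A \<odot> cls B) (cls A \<oplus> cls B)"
  by (auto simp: der_def mix_def q_simps)

lemma distr_der: "der (distr C A B) ((cls C \<odot> cls C) \<odot> (cls A \<oplus> cls B)) ((cls C \<odot> cls A) \<oplus> (cls C \<odot> cls B))"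
  by (auto simp: der_def distr_def q_simps)

lemma embed_der: "P = Atom a \<Longrightarrow> P \<in> set (afl G) \<Longrightarrow> der (embed P G) (qF \<odot> cls P) (cls G)"
  using weak_der by (induction G) (auto simp: der_def q_simps)

lemma absorb_der: "set (afl A) \<subseteq> set (afl G) \<Longrightarrow> der (absorb G A) (qF \<odot> cls A) (cls G)"
proof (induction A)
  case FF then show ?case using weak_der[of G] by simp
next
  case TT then show ?case using weak_der[of G] by simp
next
  case (Atom a) then show ?case using embed_der[of "Atom a" a G] by simp
next
  case (Disj A B)
  have "der (distr FF A B) (qF \<odot> cls (Disj A B)) ((qF \<odot> cls A) \<oplus> (qF \<odot> cls B))"
    using distr_der[of FF A B] by simp
  moreover have "der (DOr (absorb G A) (absorb G B)) ((qF \<odot> cls A) \<oplus> (qF \<odot> cls B)) (cls G \<oplus> cls G)"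
    using Disj by (intro der_or) auto
  ultimately show ?case using contr_der[of G] by (auto intro: der_seq)
next
  case (Conj A B)
  have "der (mix (Conj FF A) (Conj FF B)) (qF \<odot> cls (Conj A B)) ((qF \<odot> cls A) \<oplus> (qF \<odot> cls B))"
    using mix_der[of "Conj FF A" "Conj FF B"] by (simp add: q_simps)
  moreover have "der (DOr (absorb G A) (absorb G B)) ((qF \<odot> cls A) \<oplus> (qF \<odot> cls B)) (cls G \<oplus> cls G)"
    using Conj by (intro der_or) auto
  ultimately show ?case using contr_der[of G] by (auto intro: der_seq)
qed

lemma joinO_der: "der (joinO A B R) ((cls A \<oplus> cls R) \<oplus> (cls B \<oplus> cls R)) ((cls A \<oplus> cls B) \<oplus> cls R)"
  using contr_der[of R] by (auto simp: joinO_def der_def q_simps)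

lemma joinA_der: "der (joinA A B R) ((cls A \<oplus> cls R) \<odot> (cls B \<oplus> cls R)) ((cls A \<odot> cls B) \<oplus> cls R)"
  using contr_der[of R] by (auto simp: joinA_def der_def q_simps)

lemma pull_out_der: "P = Atom a \<Longrightarrow> der (pull_out P A) (cls A) (cls (erase P A) \<oplus> cls P)"
proof (induction A)
  case (Disj A B)
  then show ?case using der_seq[OF der_or joinO_der] by simp
next
  case (Conj A B)
  then show ?case using der_seq[OF der_and joinA_der] by simp
qed (use weak_der in \<open>auto simp: der_def q_simps\<close>)

lemma inj_disj_der: "A \<in> set As \<Longrightarrow> der (inj_disj A (disj_list As)) (cls A) (cls (disj_list As))"
  using weak_der by (induction As) (auto simp: der_def q_simps)

lemma raise_term_der:
  assumes d: "der d x (cls X \<oplus> cls G)" and Y: "set (afl Y) \<subseteq> set (afl G)"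
    and A: "cls A = cls X \<odot> cls Y" and H: "X \<noteq> FF \<Longrightarrow> \<exists>As. H = disj_list As \<and> A \<in> set As"
  shows "der (raise_term G d X Y A H) (x \<odot> cls Y) (cls H \<oplus> cls G)"
proof -
  let ?e = "if X = FF then DOr (absorb G Y) (weak H) else DOr (inj_disj A H) (weak G)"
  have e: "der ?e (cls X \<odot> cls Y) (cls H \<oplus> cls G)"
  proof (cases "X = FF")
    case True
    then show ?thesis using der_or[OF absorb_der[OF Y] weak_der[of H]] by (simp add: q_simps)
  next
    case False
    then show ?thesis using der_or[OF inj_disj_der weak_der[of G]] H by (auto simp flip: A)
  qed
  have "der (DOr ?e (Fm G)) ((cls X \<odot> cls Y) \<oplus> cls G) ((cls H \<oplus> cls G) \<oplus> cls G)"
    by (intro der_or e der_Fm)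
  moreover have "der (DOr (Fm H) (contr G)) (cls H \<oplus> (cls G \<oplus> cls G)) (cls H \<oplus> cls G)"
    by (intro der_or der_Fm contr_der)
  ultimately have 1: "der (seq (DOr ?e (Fm G)) (DOr (Fm H) (contr G))) ((cls X \<odot> cls Y) \<oplus> cls G) (cls H \<oplus> cls G)"
    by (rule der_seq) (simp add: q_simps)
  have "der (DAnd d (Fm Y)) (x \<odot> cls Y) ((cls X \<oplus> cls G) \<odot> cls Y)" by (intro der_and d der_Fm)
  moreover have "der (sw Y X G) (cls Y \<odot> (cls X \<oplus> cls G)) ((cls Y \<odot> cls X) \<oplus> cls G)" by (simp add: der_def)
  ultimately show ?thesis unfolding raise_term_def using 1
    by (intro der_seq[of "DAnd d (Fm Y)" _ _ _ _ "cls H \<oplus> cls G"] der_seq[of "sw Y X G"]) (auto simp: q_simps)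
qed

lemma raise_disj_der:
  assumes "P = Atom a" "P \<in> set (afl G)"
    and "\<And>x. x \<in> set xs \<Longrightarrow> der (snd x) (cls P \<odot> cls (fst x)) (cls H \<oplus> cls G)"
  shows "der (raise_disj P G H xs) (cls P \<odot> cls (disj_list (map fst xs))) (cls H \<oplus> cls G)"
  using assms(3)
proof (induction xs)
  case Nil
  then show ?case using embed_der[OF assms(1,2)] weak_der[of H] by (auto simp: der_def q_simps)
next
  case (Cons x xs)
  let ?D = "disj_list (map fst xs)"
  have "der (DAnd (cocontr P) (Fm (Disj (fst x) ?D))) (cls P \<odot> (cls (fst x) \<oplus> cls ?D)) 
     ((cls P \<odot> cls P) \<odot> (cls (fst x) \<oplus> cls ?D))"
    using der_and[OF cocontr_der der_Fm, of P "Disj (fst x) ?D"] by simp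
  moreover have "der (seq (DOr (snd x) (raise_disj P G H xs)) (contr (Disj H G)))
     ((cls P \<odot> cls (fst x)) \<oplus> (cls P \<odot> cls ?D)) (cls H \<oplus> cls G)"
    using der_seq[OF der_or contr_der, of "snd x" _ "cls (Disj H G)" "raise_disj P G H xs" _ "cls (Disj H G)" "Disj H G"] Cons by simp
  ultimately show ?case using der_seq[OF _ der_seq[OF distr_der]] by auto
qed

fun ptree :: "'a form \<Rightarrow> bool" where
  "ptree (Atom a) \<longleftrightarrow> True"
| "ptree (Conj l r) \<longleftrightarrow> ptree l \<and> ptree r"
| "ptree FF \<longleftrightarrow> True"
| "ptree _ \<longleftrightarrow> False"

lemma nth_succs: "k < length X \<Longrightarrow> succs X ! k = (if k + 1 < length X then X ! (k + 1) else FF)"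
  by (cases X) (auto simp: succs_def nth_append)

text \<open>\<open>P\<close> is distributed over the disjuncts
  \<open>X\<^sub>i \<and> Y\<^sub>j\<close> with \<open>i + j = k\<close>, and the factor whose
  subtree contains \<open>P\<close> is raised, say to \<open>X\<^sub>i\<^sub>+\<^sub>1\<close>. Then
  \<open>X\<^sub>i\<^sub>+\<^sub>1 \<and> Y\<^sub>j\<close> is a disjunct of the next threshold,
  unless \<open>i\<close> was the last index and the raised factor is \<open>f\<close>. Distinctness
  of the leaves keeps \<open>P\<close> out of the other factor.\<close>

lemma raise_der:
  assumes P: "P = Atom a" and "P \<in> set (afl t)" "distinct (afl t)" "ptree t" "set (afl t) \<subseteq> set (afl G)"
    and "k < length (thr t)"
  shows "der (raise P G t ! k) (cls P \<odot> cls (erase P (thr t ! k))) (cls (succs (thr t) ! k) \<oplus> cls G)"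
  using assms(2-)
proof (induction t arbitrary: k)
  case (Atom b)
  then have b: "P = Atom b" and PG: "P \<in> set (afl G)" by auto
  consider "k = 0" | "k = 1" using Atom by force
  then show ?case
  proof cases
    case 1
    then show ?thesis using der_or[OF der_Fm weak_der, of P G] b by (simp add: succs_def q_simps)
  next
    case 2
    then show ?thesis using embed_der[OF P PG] b by (simp add: succs_def q_simps)
  qed
next
  case (Conj l r)
  define X where "X = thr l"
  define Y where "Y = thr r"
  define TX where "TX = triples X (raise P G l)"
  define TY where "TY = triples Y (raise P G r)"
  define H where "H = succs (thr (Conj l r)) ! k"
  have XY: "X \<noteq> []" "Y \<noteq> []" by (auto simp: X_def Y_def thr_nonempty)
  have lT: "length TX = length X" "length TY = length Y"
    by (simp_all add: TX_def TY_def X_def Y_def triples_def length_raise length_succs[OF thr_nonempty])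
  have TXn: "TX ! i = (X ! i, (succs X ! i, raise P G l ! i))" if "i < length X" for i
    using that by (simp add: TX_def triples_def length_raise length_succs[OF thr_nonempty] X_def)
  have TYn: "TY ! i = (Y ! i, (succs Y ! i, raise P G r ! i))" if "i < length Y" for i
    using that by (simp add: TY_def triples_def length_raise length_succs[OF thr_nonempty] Y_def)
  have mT: "X = map fst TX" "Y = map fst TY"
    by (rule nth_equalityI; simp add: lT TXn TYn)+
  have TY: "TY \<noteq> []" using lT XY by auto
  define q where "q = conv TX TY ! k"
  have lc: "length (conv X Y) = length (thr (Conj l r))" "length (conv TX TY) = length (conv X Y)"
    by (simp add: X_def Y_def) (simp add: mT conv_map)
  have k: "k < length (conv TX TY)" using Conj.prems(5) lc by simp
  have thrk: "thr (Conj l r) ! j = disj_list (map (\<lambda>(x, y). Conj x y) (conv X Y ! j))" if "j < length (conv X Y)" for j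
    using that by (simp add: X_def Y_def)
  have cq: "conv X Y ! k = map (map_prod fst fst) q"
    unfolding mT conv_map q_def using k by simp
  have rk: "raise P G (Conj l r) ! k = raise_disj P G H (map (raise_pair P G (P \<in> set (afl l)) H) q)"
  proof -
    have "length (succs (thr (Conj l r))) = length (conv TX TY)"
      using lc length_succs[OF thr_nonempty[of "Conj l r"]] by simp
    then show ?thesis using k by (simp add: q_def TX_def TY_def X_def Y_def H_def del: thr.simps)
  qed
  have "erase P (thr (Conj l r) ! k) = disj_list (map fst (map (raise_pair P G (P \<in> set (afl l)) H) q))"
    using k lc by (simp add: thrk cq erase_disj_list o_def raise_pair_def case_prod_beta map_prod_def del: thr.simps)
  moreover have "der (snd x) (cls P \<odot> cls (fst x)) (cls H \<oplus> cls G)" 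
    if xin: "x \<in> set (map (raise_pair P G (P \<in> set (afl l)) H) q)" for x
  proof -
    obtain p where p: "p \<in> set q" "x = raise_pair P G (P \<in> set (afl l)) H p"
      using xin unfolding set_map by blast
    have "p \<in> {(TX ! a, TY ! b) | a b. a < length TX \<and> b < length TY \<and> a + b = k}"
      using p(1) set_conv[OF k TY] by (simp add: q_def)
    then obtain i j where ij: "i < length X" "j < length Y" "i + j = k" "p = (TX ! i, TY ! j)"
      using lT by auto
    have Xi: "set (afl (X ! i)) \<subseteq> set (afl l)" and Yj: "set (afl (Y ! j)) \<subseteq> set (afl r)"
      using afl_thr[of "X ! i" l] afl_thr[of "Y ! j" r] ij nth_mem[of i X] nth_mem[of j Y]
      by (auto simp: X_def Y_def)
    have lk: "length (conv X Y) = length X + length Y - 1" using XY by (simp add: length_conv)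
    \<comment> \<open>Raising one of the two indices by one leads to the diagonal
      \<open>k + 1\<close>, whose pairs make up the next threshold.\<close>
    have ex: "\<exists>As. H = disj_list As \<and> Conj (X ! i') (Y ! j') \<in> set As"
      if "i' < length X" "j' < length Y" "i' + j' = k + 1" for i' j'
    proof -
      have k1: "k + 1 < length (conv X Y)" using that lk by linarith
      have "H = thr (Conj l r) ! (k + 1)"
        unfolding H_def by (subst nth_succs) (use k1 lc in auto)
      also have "\<dots> = disj_list (map (\<lambda>(x, y). Conj x y) (conv X Y ! (k + 1)))"
        using k1 by (rule thrk)
      finally have H: "H = disj_list (map (\<lambda>(x, y). Conj x y) (conv X Y ! (k + 1)))" .
      have "(X ! i', Y ! j') \<in> set (conv X Y ! (k + 1))"
        unfolding set_conv[OF k1 XY(2)] using that by blast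
      then show ?thesis using H by force
    qed
    show ?thesis
    proof (cases "P \<in> set (afl l)")
      case True
      then have nr: "P \<notin> set (afl r)" using Conj.prems by auto
      then have eY: "erase P (Y ! j) = Y ! j" using Yj by (intro erase_id) auto
      have IH: "der (raise P G l ! i) (cls P \<odot> cls (erase P (X ! i))) (cls (succs X ! i) \<oplus> cls G)"
        using Conj.IH(1)[of i] Conj.prems True ij by (auto simp: X_def)
      have "der (raise_term G (raise P G l ! i) (succs X ! i) (Y ! j) (Conj (succs X ! i) (Y ! j)) H)
         ((cls P \<odot> cls (erase P (X ! i))) \<odot> cls (Y ! j)) (cls H \<oplus> cls G)"
      proof (rule raise_term_der[OF IH])
        show "set (afl (Y ! j)) \<subseteq> set (afl G)" using Yj Conj.prems by auto
        assume "succs X ! i \<noteq> FF"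
        then show "\<exists>As. H = disj_list As \<and> Conj (succs X ! i) (Y ! j) \<in> set As"
          using ex[of "i + 1" j] ij by (auto simp: nth_succs split: if_splits)
      qed simp
      then show ?thesis using True by (simp add: p(2) raise_pair_def ij TXn TYn eY q_simps)
    next
      case False
      then have nl: "P \<in> set (afl r)" using Conj.prems by auto
      have eX: "erase P (X ! i) = X ! i" using Xi False by (intro erase_id) auto
      have IH: "der (raise P G r ! j) (cls P \<odot> cls (erase P (Y ! j))) (cls (succs Y ! j) \<oplus> cls G)"
        using Conj.IH(2)[of j] Conj.prems nl ij by (auto simp: Y_def)
      have "der (raise_term G (raise P G r ! j) (succs Y ! j) (X ! i) (Conj (X ! i) (succs Y ! j)) H)
         ((cls P \<odot> cls (erase P (Y ! j))) \<odot> cls (X ! i)) (cls H \<oplus> cls G)"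
      proof (rule raise_term_der[OF IH])
        show "set (afl (X ! i)) \<subseteq> set (afl G)" using Xi Conj.prems by auto
        show "cls (Conj (X ! i) (succs Y ! j)) = cls (succs Y ! j) \<odot> cls (X ! i)" by (simp add: q_simps)
        assume "succs Y ! j \<noteq> FF"
        then show "\<exists>As. H = disj_list As \<and> Conj (X ! i) (succs Y ! j) \<in> set As"
          using ex[of i "j + 1"] ij by (auto simp: nth_succs split: if_splits)
      qed
      then show ?thesis using False by (simp add: p(2) raise_pair_def ij TXn TYn eX q_simps)
    qed
  qed
  moreover have "P \<in> set (afl G)" using Conj.prems by auto
  ultimately show ?case unfolding rk H_def[symmetric] using raise_disj_der[OF P, of G] by (metis (no_types, lifting))
qed auto

end

section \<open>A slice of the proof\<close>

fun isD :: "'a form \<Rightarrow> bool" where "isD (Disj A B) \<longleftrightarrow> True" | "isD _ \<longleftrightarrow> False"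
fun isC :: "'a form \<Rightarrow> bool" where "isC (Conj A B) \<longleftrightarrow> True" | "isC _ \<longleftrightarrow> False"
fun isA :: "'a form \<Rightarrow> bool" where "isA (Atom a) \<longleftrightarrow> True" | "isA _ \<longleftrightarrow> False"

fun lft :: "'a form \<Rightarrow> 'a form" where "lft (Disj A B) = A" | "lft (Conj A B) = A" | "lft _ = FF"
fun rgt :: "'a form \<Rightarrow> 'a form" where "rgt (Disj A B) = B" | "rgt (Conj A B) = B" | "rgt _ = FF"

text \<open>The parameters of a slice: \<open>th\<close> and \<open>th2\<close> are consecutive thresholds,
  \<open>al\<close> is the conclusion of the proof, \<open>ls\<close> contains one atom of each dual pair occurring in
  \<open>al\<close>, \<open>ms\<close> one of each pair occurring in the proof, and \<open>cts\<close> assigns to an atom \<open>P\<close> of \<open>ls\<close>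
  a derivation from \<open>P \<and> th{P := f}\<close> to \<open>th2 \<or> al\<close>.\<close>

datatype 'a slc = Slc (th: "'a form") (th2: "'a form") (al: "'a form") (ls: "'a form list")
  (ms: "'a form list") (cts: "('a form \<times> 'a ded) list")

text \<open>The alternative at which every step of a slice may arrive instead of its proper result;
  it is also where the slice ends.\<close>

definition RR :: "'a slc \<Rightarrow> 'a form" where "RR p = Disj (al p) (th2 p)"

text \<open>Takes the place of coweakening on \<open>A\<close>: from
  \<open>A \<and> (f \<or> X)\<close> switch gives \<open>(A \<and> f) \<or> X\<close>, and
  \<open>A \<and> f\<close> disappears into \<open>al\<close>. The price is the alternative
  \<open>RR\<close>.\<close>

definition discard :: "'a slc \<Rightarrow> 'a form \<Rightarrow> 'a form \<Rightarrow> 'a ded" where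
  "discard p A X = seq (sw A FF X) (DOr (DOr (absorb (al p) A) (weak (th2 p))) (Fm X))"

primrec lookup :: "'b \<Rightarrow> ('b \<times> 'a ded) list \<Rightarrow> 'a ded" where
  "lookup x [] = Fm FF"
| "lookup x (y # ys) = (if x = fst y then snd y else lookup x ys)"

definition cutd :: "'a slc \<Rightarrow> 'a form \<Rightarrow> 'a ded" where
  "cutd p P = lookup P (cts p)"

text \<open>Programs have no numbers, so an index is given by a list: the entry chosen is the one at
  position \<open>length ks\<close>. The thresholds still to come will serve as \<open>ks\<close>;
  they become fewer as \<open>k\<close> grows, which is why \<open>cut_table\<close> stores its rows
  reversed.\<close>

fun pick :: "'a ded list \<Rightarrow> 'b list \<Rightarrow> 'a ded" where
  "pick [] ks = Fm FF"
| "pick (d # ds) [] = d"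
| "pick (d # ds) (k # ks) = pick ds ks"

lemma pick_nth: "length ks < length ds \<Longrightarrow> pick ds ks = ds ! length ks"
  by (induction ds ks rule: pick.induct) auto

lemma lookup_map: "x \<in> set xs \<Longrightarrow> lookup x (map (\<lambda>y. (y, f y)) xs) = f x"
  by (induction xs) auto

context sks
begin

text \<open>The value \<open>FF\<close> outside the atoms agrees with \<open>data_bar\<close> on
  encodings, as \<open>FF\<close> is encoded by \<open>Null\<close>.\<close>

fun barf :: "'a form \<Rightarrow> 'a form" where
  "barf (Atom a) = Atom (bar a)"
| "barf _ = FF"

text \<open>Negated atoms of \<open>ls\<close> are read as thresholds, the atoms outside \<open>al\<close> as units.\<close>

definition tau :: "'a slc \<Rightarrow> 'a form \<Rightarrow> 'a form" where
  "tau p A = (if A \<in> set (ls p) then A else if barf A \<in> set (ls p) then erase (barf A) (th p)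
     else if A \<in> set (ms p) then TT else FF)"

primrec tr :: "'a slc \<Rightarrow> 'a form \<Rightarrow> 'a form" where
  "tr p FF = FF"
| "tr p TT = TT"
| "tr p (Atom a) = tau p (Atom a)"
| "tr p (Disj A B) = Disj (tr p A) (tr p B)"
| "tr p (Conj A B) = Conj (tr p A) (tr p B)"

text \<open>Leads from \<open>th\<close> to the disjunction of the readings of a dual pair, up to
  \<open>RR\<close>. For a pair foreign to \<open>al\<close> the readings are \<open>t\<close> and
  \<open>f\<close>, so it suffices to discard \<open>th\<close>.\<close>

definition idn :: "'a slc \<Rightarrow> 'a form \<Rightarrow> 'a ded" where
  "idn p A = (if A \<in> set (ls p) then seq (pull_out A (th p)) (DOr (Fm (Disj A (erase A (th p)))) (weak (RR p)))
     else if barf A \<in> set (ls p) then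
       seq (pull_out (barf A) (th p)) (DOr (Fm (Disj (barf A) (erase (barf A) (th p)))) (weak (RR p)))
     else discard p (th p) TT)"

definition cutx :: "'a slc \<Rightarrow> 'a form \<Rightarrow> 'a ded" where
  "cutx p A = (if A \<in> set (ls p) then cutd p A else if barf A \<in> set (ls p) then cutd p (barf A)
     else DOr (Fm FF) (weak (RR p)))"

text \<open>The atomic rule is recognised from the shapes of its premiss and conclusion; the last
  case is an unchanged unit or atom. For coweakening the reading of the atom is discarded together
  with the threshold.\<close>

definition leafd :: "'a slc \<Rightarrow> 'a form \<Rightarrow> 'a form \<Rightarrow> 'a ded" where
  "leafd p C D =
    (if C = TT \<and> isD D then idn p (lft D)
     else if isC C \<and> D = FF then
       seq (discard p (th p) (tr p C)) (seq (DOr (cutx p (lft C)) (Fm (RR p))) (contr (RR p)))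
     else if C = FF \<and> isA D then seq (discard p (th p) FF) (DOr (weak (tr p D)) (Fm (RR p)))
     else if isA C \<and> D = TT then discard p (Conj (th p) (tr p C)) TT
     else if isD C \<and> isA D then seq (discard p (th p) (tr p C)) (DOr (contr (tr p D)) (Fm (RR p)))
     else if isA C \<and> isC D then seq (discard p (th p) (tr p C)) (DOr (cocontr (tr p C)) (Fm (RR p)))
     else discard p (th p) (tr p C))"

text \<open>A step records neither its context nor its redex. An atomic rule never has the same main
  connective in premiss and conclusion, so a parallel descent stops exactly at the redex, and on the
  unchanged siblings at their leaves. Every node cocontracts \<open>th\<close>, because the redex
  may lie in either branch.\<close>

fun fwd :: "'a slc \<Rightarrow> 'a form \<Rightarrow> 'a form \<Rightarrow> 'a ded" where
  "fwd p (Disj A B) (Disj A' B') = seq (DAnd (cocontr (th p)) (Fm (Disj (tr p A) (tr p B))))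
     (seq (distr (th p) (tr p A) (tr p B)) 
       (seq (DOr (fwd p A A') (fwd p B B')) (joinO (tr p A') (tr p B') (RR p))))"
| "fwd p (Conj A B) (Conj A' B') = seq (DAnd (cocontr (th p)) (Fm (Conj (tr p A) (tr p B))))
     (seq (DAnd (fwd p A A') (fwd p B B')) (joinA (tr p A') (tr p B') (RR p)))"
| "fwd p C D = leafd p C D"

text \<open>Recovers the genuine negated atom \<open>A\<close> from its reading: identity introduces
  the dual of \<open>A\<close> beside \<open>A\<close>, switch brings the reading to that dual, and
  the substitute for cut leads on to \<open>RR\<close>.\<close>

definition negd :: "'a slc \<Rightarrow> 'a form \<Rightarrow> 'a ded" where
  "negd p A = seq (DAnd (Fm (erase (barf A) (th p))) (DSeq AiDown (Fm TT) (Fm (Disj (barf A) A))))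
     (seq (sw (erase (barf A) (th p)) (barf A) A) (DOr (cutd p (barf A)) (Fm A)))"

primrec unfold :: "'a slc \<Rightarrow> 'a form \<Rightarrow> 'a ded" where
  "unfold p FF = DOr (Fm FF) (weak (RR p))"
| "unfold p TT = DOr (Fm TT) (weak (RR p))"
| "unfold p (Atom a) = (if Atom a \<in> set (ls p) then DOr (Fm (Atom a)) (weak (RR p)) else negd p (Atom a))"
| "unfold p (Disj A B) = seq (DOr (unfold p A) (unfold p B)) (joinO A B (RR p))"
| "unfold p (Conj A B) = seq (DAnd (unfold p A) (unfold p B)) (joinA A B (RR p))"

text \<open>The invariant of a slice is \<open>th \<and> (tr C \<or> RR)\<close>. Since
  \<open>tr\<close> is a homomorphism, switch, medial and \<open>=\<close> carry over with the same
  rule name, whereas an atomic step consumes a copy of \<open>th\<close> made by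
  cocontraction.\<close>

definition stepd :: "'a slc \<Rightarrow> 'a form \<Rightarrow> rule \<Rightarrow> 'a form \<Rightarrow> 'a ded" where
  "stepd p C r D = (if r = Switch \<or> r = Medial \<or> r = Equality
     then DSeq r (Fm (Conj (th p) (Disj (tr p C) (RR p)))) (Fm (Conj (th p) (Disj (tr p D) (RR p))))
     else seq (DAnd (cocontr (th p)) (Fm (Disj (tr p C) (RR p))))
       (seq (DAnd (Fm (th p)) (sw (th p) (tr p C) (RR p)))
         (DAnd (Fm (th p)) (seq (DOr (fwd p C D) (Fm (RR p))) (DOr (Fm (tr p D)) (contr (RR p)))))))"

fun loopd :: "'a slc \<Rightarrow> 'a form \<Rightarrow> (rule \<times> 'a form) list \<Rightarrow> 'a ded" where
  "loopd p C [] = Fm (Conj (th p) (Disj (tr p C) (RR p)))"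
| "loopd p C ((r, D) # ss) = seq (stepd p C r D) (loopd p D ss)"

text \<open>The conclusion \<open>al\<close>, weakened to \<open>RR\<close>, stands beside the
  alternatives produced by \<open>unfold\<close>, by the loop and by discarding \<open>th\<close>;
  hence four copies to contract.\<close>

definition sliced :: "'a slc \<Rightarrow> (rule \<times> 'a form) list \<Rightarrow> 'a ded" where
  "sliced p ss = seq (DAnd (Fm (th p)) (DOr (Fm TT) (weak (RR p)))) (seq (loopd p TT ss)
     (seq (DAnd (Fm (th p)) (DOr (unfold p (al p)) (Fm (RR p))))
       (seq (discard p (th p) (Disj (Disj (al p) (RR p)) (RR p)))
          (seq (DOr (DOr (DOr (DOr (Fm (al p)) (weak (th2 p))) (Fm (RR p))) (Fm (RR p))) (Fm (RR p)))
            (seq (DOr (contr (RR p)) (contr (RR p))) (contr (RR p)))))))"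

text \<open>\<open>ls\<close> has exactly one atom of each pair occurring in \<open>al\<close>,
  \<open>ms\<close> exactly one of each pair occurring in \<open>S\<close>, the atoms of the proof.
  The first clause lets \<open>al\<close> absorb thresholds; the last is the substitute for cut, to
  be supplied by \<open>raise_der\<close>.\<close>

definition good :: "'a slc \<Rightarrow> 'a form set \<Rightarrow> bool" where
  "good p S \<longleftrightarrow> set (afl (th p)) \<subseteq> set (afl (al p)) \<and>
     (\<forall>P\<in>set (ls p). \<exists>a. P = Atom a) \<and> set (ls p) \<subseteq> set (afl (al p)) \<and>
     (\<forall>a. Atom a \<in> set (ls p) \<longrightarrow> Atom (bar a) \<notin> set (ls p)) \<and>
     (\<forall>a. Atom a \<in> set (afl (al p)) \<longrightarrow> Atom a \<in> set (ls p) \<or> Atom (bar a) \<in> set (ls p)) \<and>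
     (\<forall>a. Atom a \<in> S \<longrightarrow> (Atom a \<in> set (ms p) \<longleftrightarrow> Atom (bar a) \<notin> set (ms p))) \<and>
     (\<forall>P\<in>set (ls p). der (cutd p P) (cls P \<odot> cls (erase P (th p))) (cls (RR p)))"

section \<open>Correctness of a slice\<close>

lemma discard_der:
  assumes "good p S" "set (afl A) \<subseteq> set (afl (al p))"
  shows "der (discard p A X) (cls A \<odot> cls X) (cls X \<oplus> cls (RR p))"
proof -
  have "der (DOr (DOr (absorb (al p) A) (weak (th2 p))) (Fm X)) (((qF \<odot> cls A) \<oplus> qF) \<oplus> cls X)
    ((cls (al p) \<oplus> cls (th2 p)) \<oplus> cls X)"
    by (intro der_or absorb_der weak_der der_Fm assms)
  then show ?thesis unfolding discard_def
    by (auto simp: der_def RR_def q_simps)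
qed

lemma discard_th: "good p S \<Longrightarrow> der (discard p (th p) X) (cls (th p) \<odot> cls X) (cls X \<oplus> cls (RR p))"
  by (rule discard_der) (auto simp: good_def)

text \<open>For coweakening: the reading of an atom can be absorbed by \<open>al\<close>, because
  foreign atoms are read as units and thresholds count only atoms of \<open>al\<close>.\<close>

lemma tau_afl: "good p S \<Longrightarrow> set (afl (tau p (Atom a))) \<subseteq> set (afl (al p))"
  using afl_erase[of "Atom (bar a)" "th p"] by (auto simp: good_def tau_def)

lemma idn_der:
  assumes "good p S" "Atom a \<in> S"
  shows "der (idn p (Atom a)) (cls (th p)) ((cls (tau p (Atom a)) \<oplus> cls (tau p (Atom (bar a)))) \<oplus> cls (RR p))"
proof -
  have n: "Atom a \<in> set (ls p) \<Longrightarrow> Atom (bar a) \<notin> set (ls p)" using assms by (auto simp: good_def)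
  have 1: "der (seq (pull_out P (th p)) (DOr (Fm (Disj P (erase P (th p)))) (weak (RR p))))
     (cls (th p)) ((cls P \<oplus> cls (erase P (th p))) \<oplus> cls (RR p))" if "P = Atom b" for P b
    using pull_out_der[OF that, of "th p"] weak_der[of "RR p"] by (auto simp: der_def q_simps)
  show ?thesis
  proof (cases "Atom a \<in> set (ls p)")
    case True
    then show ?thesis using 1[of "Atom a" a] n[OF True] by (simp add: idn_def tau_def bar_bar)
  next
    case False
    note F = this
    show ?thesis
    proof (cases "Atom (bar a) \<in> set (ls p)")
      case True
      then show ?thesis using 1[of "Atom (bar a)" "bar a"] F by (simp add: idn_def tau_def bar_bar q_simps)
    next
      case False
      have "Atom a \<in> set (ms p) \<longleftrightarrow> Atom (bar a) \<notin> set (ms p)" using assms by (auto simp: good_def)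
      then show ?thesis using False F discard_th[OF assms(1), of TT]
        by (auto simp: idn_def tau_def bar_bar q_simps)
    qed
  qed
qed

lemma cutx_der:
  assumes "good p S" "Atom a \<in> S"
  shows "der (cutx p (Atom a)) (cls (tau p (Atom a)) \<odot> cls (tau p (Atom (bar a)))) (cls (RR p))"
proof -
  have n: "Atom a \<in> set (ls p) \<Longrightarrow> Atom (bar a) \<notin> set (ls p)" using assms by (auto simp: good_def)
  have 1: "der (cutd p P) (cls P \<odot> cls (erase P (th p))) (cls (RR p))" if "P \<in> set (ls p)" for P
    using assms that by (auto simp: good_def)
  show ?thesis
  proof (cases "Atom a \<in> set (ls p)")
    case True
    then show ?thesis using 1[of "Atom a"] n[OF True] by (simp add: cutx_def tau_def bar_bar)
  next
    case False
    note F = this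
    show ?thesis
    proof (cases "Atom (bar a) \<in> set (ls p)")
      case True
      then show ?thesis using 1[of "Atom (bar a)"] F by (simp add: cutx_def tau_def bar_bar q_simps)
    next
      case False
      have "Atom a \<in> set (ms p) \<longleftrightarrow> Atom (bar a) \<notin> set (ms p)" using assms by (auto simp: good_def)
      then show ?thesis using False F der_or[OF der_Fm[of FF] weak_der[of "RR p"]]
        by (auto simp: cutx_def tau_def bar_bar q_simps)
    qed
  qed
qed

lemma der_orR: "der d x y \<Longrightarrow> der (DOr d (Fm (RR p))) (x \<oplus> cls (RR p)) (y \<oplus> cls (RR p))"
  by (intro der_or der_Fm)

text \<open>Stated for \<open>fwd\<close>, which falls through to \<open>leafd\<close> on these
  instances because the main connectives differ.\<close>

lemma leafd_der:
  assumes g: "good p S" and r: "rule_inst bar r C D" "r \<noteq> Switch" "r \<noteq> Medial" "r \<noteq> Equality"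
    and S: "set (afl C) \<union> set (afl D) \<subseteq> S"
  shows "der (fwd p C D) (cls (th p) \<odot> cls (tr p C)) (cls (tr p D) \<oplus> cls (RR p))"
  using r(1)
proof (cases rule: rule_inst.cases)
  case (ai_down a)
  then show ?thesis using idn_der[OF g, of a] S by (simp add: leafd_def)
next
  case (aw_down a)
  then show ?thesis
    using der_seq[OF discard_th[OF g, of FF] der_orR[OF weak_der[of "tau p (Atom a)"]]] by (simp add: leafd_def)
next
  case (ac_down a)
  then show ?thesis
    using der_seq[OF discard_th[OF g, of "tr p C"] der_orR[OF contr_der[of "tau p (Atom a)"]]] by (simp add: leafd_def)
next
  case (ai_up a)
  have "der (seq (DOr (cutx p (Atom a)) (Fm (RR p))) (contr (RR p)))
     (cls (tr p C) \<oplus> cls (RR p)) (cls (RR p))"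
    using der_seq[OF der_orR[OF cutx_der[OF g, of a]] contr_der[of "RR p"]] ai_up S by simp
  then show ?thesis
    using der_seq[OF discard_th[OF g, of "tr p C"], of _ _ "cls (RR p)"] ai_up by (simp add: leafd_def)
next
  case (aw_up a)
  then show ?thesis
    using discard_der[OF g, of "Conj (th p) (tau p (Atom a))" TT] g tau_afl[OF g, of a] by (auto simp: leafd_def good_def)
next
  case (ac_up a)
  then show ?thesis
    using der_seq[OF discard_th[OF g, of "tr p C"] der_orR[OF cocontr_der[of "tau p (Atom a)"]]] by (simp add: leafd_def)
qed (use r in auto)

lemma fwd_Disj:
  assumes "der (fwd p A A') (cls (th p) \<odot> cls (tr p A)) (cls (tr p A') \<oplus> cls (RR p))"
    "der (fwd p B B') (cls (th p) \<odot> cls (tr p B)) (cls (tr p B') \<oplus> cls (RR p))"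
  shows "der (fwd p (Disj A B) (Disj A' B')) (cls (th p) \<odot> cls (tr p (Disj A B))) (cls (tr p (Disj A' B')) \<oplus> cls (RR p))"
proof -
  have "der (DAnd (cocontr (th p)) (Fm (Disj (tr p A) (tr p B)))) (cls (th p) \<odot> cls (tr p (Disj A B)))
     ((cls (th p) \<odot> cls (th p)) \<odot> (cls (tr p A) \<oplus> cls (tr p B)))"
    using der_and[OF cocontr_der der_Fm, of "th p" "Disj (tr p A) (tr p B)"] by simp
  from der_seq[OF this der_seq[OF distr_der der_seq[OF der_or[OF assms] joinO_der]]]
  show ?thesis by simp
qed

lemma fwd_Conj:
  assumes "der (fwd p A A') (cls (th p) \<odot> cls (tr p A)) (cls (tr p A') \<oplus> cls (RR p))"
    "der (fwd p B B') (cls (th p) \<odot> cls (tr p B)) (cls (tr p B') \<oplus> cls (RR p))"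
  shows "der (fwd p (Conj A B) (Conj A' B')) (cls (th p) \<odot> cls (tr p (Conj A B))) (cls (tr p (Conj A' B')) \<oplus> cls (RR p))"
proof -
  have "der (DAnd (cocontr (th p)) (Fm (Conj (tr p A) (tr p B)))) (cls (th p) \<odot> cls (tr p (Conj A B)))
     ((cls (th p) \<odot> cls (tr p A)) \<odot> (cls (th p) \<odot> cls (tr p B)))"
    using der_and[OF cocontr_der der_Fm, of "th p" "Conj (tr p A) (tr p B)"] by (simp add: q_simps)
  from der_seq[OF this der_seq[OF der_and[OF assms] joinA_der]]
  show ?thesis by simp
qed

text \<open>The siblings of the path to the redex receive copies of \<open>th\<close> as well; these
  are discarded at the leaves.\<close>

lemma fwd_refl:
  assumes "good p S"
  shows "der (fwd p C C) (cls (th p) \<odot> cls (tr p C)) (cls (tr p C) \<oplus> cls (RR p))"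
proof (induction C)
  case (Disj A B) then show ?case by (rule fwd_Disj)
next
  case (Conj A B) then show ?case by (rule fwd_Conj)
qed (use discard_th[OF assms, of FF] discard_th[OF assms, of TT] discard_th[OF assms] in \<open>auto simp: leafd_def\<close>)

lemma fwd_plug:
  assumes g: "good p S" and r: "rule_inst bar r C D" "r \<noteq> Switch" "r \<noteq> Medial" "r \<noteq> Equality"
    and S: "set (afl (plug \<xi> C)) \<union> set (afl (plug \<xi> D)) \<subseteq> S"
  shows "der (fwd p (plug \<xi> C) (plug \<xi> D)) (cls (th p) \<odot> cls (tr p (plug \<xi> C)))
     (cls (tr p (plug \<xi> D)) \<oplus> cls (RR p))"
  using S
proof (induction \<xi>)
  case Hole
  then show ?case using leafd_der[OF g r] by simp
next
  case (DisjL \<xi> B)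
  then show ?case using fwd_Disj[OF _ fwd_refl[OF g]] by simp
next
  case (DisjR A \<xi>)
  then show ?case using fwd_Disj[OF fwd_refl[OF g]] by simp
next
  case (ConjL \<xi> B)
  then show ?case using fwd_Conj[OF _ fwd_refl[OF g]] by simp
next
  case (ConjR A \<xi>)
  then show ?case using fwd_Conj[OF fwd_refl[OF g]] by simp
qed

primrec trc :: "'a slc \<Rightarrow> 'a ctxt \<Rightarrow> 'a ctxt" where
  "trc p Hole = Hole"
| "trc p (DisjL \<xi> B) = DisjL (trc p \<xi>) (tr p B)"
| "trc p (DisjR A \<xi>) = DisjR (tr p A) (trc p \<xi>)"
| "trc p (ConjL \<xi> B) = ConjL (trc p \<xi>) (tr p B)"
| "trc p (ConjR A \<xi>) = ConjR (tr p A) (trc p \<xi>)"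

lemma tr_plug: "tr p (plug \<xi> C) = plug (trc p \<xi>) (tr p C)"
  by (induction \<xi>) auto

lemma tr_form_eq: "form_eq C D \<Longrightarrow> form_eq (tr p C) (tr p D)"
  by (induction rule: form_eq.induct) (auto simp: tr_plug intro: form_eq.intros)

lemma tr_inference_step:
  assumes "inference_step bar r C D" "r = Switch \<or> r = Medial \<or> r = Equality"
  shows "inference_step bar r (tr p C) (tr p D)"
  using assms(1)
proof (cases rule: inference_step.cases)
  case (1 C' D' \<xi>)
  have "rule_inst bar r (tr p C') (tr p D')"
    using 1(3) assms(2) by (cases rule: rule_inst.cases) (auto intro: rule_inst.intros tr_form_eq)
  then show ?thesis using 1 by (auto simp: tr_plug intro: inference_step.intros)
qed

lemma stepd_der:
  assumes g: "good p S" and r: "inference_step bar r C D" and S: "set (afl C) \<union> set (afl D) \<subseteq> S"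
  shows "der (stepd p C r D) (cls (th p) \<odot> (cls (tr p C) \<oplus> cls (RR p))) (cls (th p) \<odot> (cls (tr p D) \<oplus> cls (RR p)))"
proof (cases "r = Switch \<or> r = Medial \<or> r = Equality")
  case True
  have "inference_step bar r (tr p C) (tr p D)" using tr_inference_step[OF r True] .
  then have "inference_step bar r (Conj (th p) (Disj (tr p C) (RR p))) (Conj (th p) (Disj (tr p D) (RR p)))"
    by (intro inference_step_ctxt)
  then show ?thesis using True by (auto simp: stepd_def der_def valid.simps(4) aSKS_def SKS_def)
next
  case False
  have f: "der (fwd p C D) (cls (th p) \<odot> cls (tr p C)) (cls (tr p D) \<oplus> cls (RR p))"
    using r
  proof (cases rule: inference_step.cases)
    case (1 C' D' \<xi>)
    then show ?thesis using fwd_plug[OF g 1(3)] False S by auto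
  qed
  let ?T = "cls (th p)" and ?R = "cls (RR p)"
  have 1: "der (DAnd (cocontr (th p)) (Fm (Disj (tr p C) (RR p)))) (?T \<odot> (cls (tr p C) \<oplus> ?R)) (?T \<odot> (?T \<odot> (cls (tr p C) \<oplus> ?R)))"
    using der_and[OF cocontr_der der_Fm, of "th p" "Disj (tr p C) (RR p)"] by (simp add: q_simps)
  have 2: "der (DAnd (Fm (th p)) (sw (th p) (tr p C) (RR p))) (?T \<odot> (?T \<odot> (cls (tr p C) \<oplus> ?R))) (?T \<odot> ((?T \<odot> cls (tr p C)) \<oplus> ?R))"
    by (intro der_and der_Fm) (simp add: der_def)
  have 3: "der (seq (DOr (fwd p C D) (Fm (RR p))) (DOr (Fm (tr p D)) (contr (RR p)))) ((?T \<odot> cls (tr p C)) \<oplus> ?R) (cls (tr p D) \<oplus> ?R)"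
    by (rule der_seq[OF der_orR[OF f] der_or[OF der_Fm contr_der]]) (simp add: q_simps)
  have 4: "der (DAnd (Fm (th p)) (seq (DOr (fwd p C D) (Fm (RR p))) (DOr (Fm (tr p D)) (contr (RR p)))))
     (?T \<odot> ((?T \<odot> cls (tr p C)) \<oplus> ?R)) (?T \<odot> (cls (tr p D) \<oplus> ?R))"
    by (intro der_and der_Fm 3)
  show ?thesis using der_seq[OF 1 der_seq[OF 2 4 HOL.refl] HOL.refl] False by (simp add: stepd_def)
qed

lemma loopd_der:
  assumes g: "good p S" 
  shows "chain bar SKS C ss D \<Longrightarrow> set (afl C) \<union> (\<Union>x\<in>set ss. set (afl (snd x))) \<subseteq> S \<Longrightarrow>
    der (loopd p C ss) (cls (th p) \<odot> (cls (tr p C) \<oplus> cls (RR p))) (cls (th p) \<odot> (cls (tr p D) \<oplus> cls (RR p)))"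
proof (induction ss arbitrary: C)
  case Nil
  then show ?case by (auto simp: der_def)
next
  case (Cons x ss)
  obtain r E where x: "x = (r, E)" by (cases x)
  show ?case using der_seq[OF stepd_der[OF g] Cons.IH[of E] HOL.refl, of r C] Cons.prems x by simp
qed

lemma negd_der:
  assumes g: "good p S" and A: "A = Atom a" "A \<notin> set (ls p)" "Atom (bar a) \<in> set (ls p)"
  shows "der (negd p A) (cls (tau p A)) (cls A \<oplus> cls (RR p))"
proof -
  let ?P = "Atom (bar a)" let ?E = "erase ?P (th p)"
  have 1: "der (DAnd (Fm ?E) (DSeq AiDown (Fm TT) (Fm (Disj ?P A)))) (cls ?E) (cls ?E \<odot> (cls ?P \<oplus> cls A))"
    using atomic_valid(4)[of "bar a"] A by (simp add: der_def bar_bar)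
  have "der (cutd p ?P) (cls ?P \<odot> cls ?E) (cls (RR p))" using g A by (auto simp: good_def)
  then have 2: "der (DOr (cutd p ?P) (Fm A)) ((cls ?E \<odot> cls ?P) \<oplus> cls A) (cls A \<oplus> cls (RR p))"
    using der_or[OF _ der_Fm[of A]] by (fastforce simp: q_simps)
  have 3: "der (sw ?E ?P A) (cls ?E \<odot> (cls ?P \<oplus> cls A)) ((cls ?E \<odot> cls ?P) \<oplus> cls A)"
    by (simp add: der_def)
  show ?thesis using der_seq[OF 1 der_seq[OF 3 2 HOL.refl] HOL.refl] A by (simp add: negd_def tau_def)
qed

lemma unfold_der:
  assumes g: "good p S"
  shows "set (afl A) \<subseteq> set (afl (al p)) \<Longrightarrow> der (unfold p A) (cls (tr p A)) (cls A \<oplus> cls (RR p))"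
proof (induction A)
  case FF
  then show ?case using der_or[OF der_Fm[of FF] weak_der[of "RR p"]] by simp
next
  case TT
  then show ?case using der_or[OF der_Fm[of TT] weak_der[of "RR p"]] by simp
next
  case (Atom a)
  show ?case
  proof (cases "Atom a \<in> set (ls p)")
    case True
    then show ?thesis using der_or[OF der_Fm[of "Atom a"] weak_der[of "RR p"]] by (simp add: tau_def)
  next
    case False
    then have "Atom (bar a) \<in> set (ls p)" using g Atom by (auto simp: good_def)
    then show ?thesis using negd_der[OF g HOL.refl False] False by simp
  qed
next
  case (Disj A B)
  then show ?case using der_seq[OF der_or joinO_der] by simp
next
  case (Conj A B)
  then show ?case using der_seq[OF der_and joinA_der] by simp
qed

lemma sliced_der:
  assumes g: "good p S" and c: "chain bar SKS TT ss (al p)" and S: "(\<Union>x\<in>set ss. set (afl (snd x))) \<subseteq> S"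
  shows "der (sliced p ss) (cls (th p)) (cls (RR p))"
proof -
  let ?T = "cls (th p)" and ?R = "cls (RR p)" and ?A = "cls (al p)"
  have 1: "der (DAnd (Fm (th p)) (DOr (Fm TT) (weak (RR p)))) ?T (?T \<odot> (qT \<oplus> ?R))"
    using der_and[OF der_Fm[of "th p"] der_or[OF der_Fm[of TT] weak_der[of "RR p"]]] by simp
  have 2: "der (loopd p TT ss) (?T \<odot> (qT \<oplus> ?R)) (?T \<odot> (cls (tr p (al p)) \<oplus> ?R))"
    using loopd_der[OF g c] S by simp
  have 3: "der (DAnd (Fm (th p)) (DOr (unfold p (al p)) (Fm (RR p))))
     (?T \<odot> (cls (tr p (al p)) \<oplus> ?R)) (?T \<odot> ((?A \<oplus> ?R) \<oplus> ?R))"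
    by (intro der_and der_Fm der_or unfold_der[OF g]) auto
  have 4: "der (discard p (th p) (Disj (Disj (al p) (RR p)) (RR p))) (?T \<odot> ((?A \<oplus> ?R) \<oplus> ?R)) (((?A \<oplus> ?R) \<oplus> ?R) \<oplus> ?R)"
    using discard_th[OF g, of "Disj (Disj (al p) (RR p)) (RR p)"] by simp
  have 5: "der (DOr (DOr (DOr (DOr (Fm (al p)) (weak (th2 p))) (Fm (RR p))) (Fm (RR p))) (Fm (RR p)))
     (((?A \<oplus> ?R) \<oplus> ?R) \<oplus> ?R) (((?R \<oplus> ?R) \<oplus> ?R) \<oplus> ?R)"
    using der_or[OF der_or[OF der_or[OF der_or[OF der_Fm[of "al p"] weak_der[of "th2 p"]] der_Fm] der_Fm] der_Fm, of "RR p" "RR p" "RR p"]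
    by (simp add: RR_def)
  have 6: "der (seq (DOr (contr (RR p)) (contr (RR p))) (contr (RR p))) (((?R \<oplus> ?R) \<oplus> ?R) \<oplus> ?R) ?R"
    using der_seq[OF der_or[OF contr_der contr_der] contr_der HOL.refl, of "RR p"] by (simp add: q_simps)
  show ?thesis unfolding sliced_def
    by (rule der_seq[OF 1 der_seq[OF 2 der_seq[OF 3 der_seq[OF 4 der_seq[OF 5 6 HOL.refl] HOL.refl] HOL.refl] HOL.refl] HOL.refl])
qed

section \<open>Normalisation\<close>

primrec ors :: "'a form list \<Rightarrow> 'a form list" where
  "ors [] = []"
| "ors (A # As) = (if A \<in> set (ors As) \<or> barf A \<in> set (ors As) then ors As else A # ors As)"

text \<open>The copies are chained along the thresholds, and the two copies of \<open>G\<close> are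
  contracted after each. \<open>Xs\<close>, the thresholds still ahead, doubles as the index into
  the rows of \<open>R\<close>, so the rows are computed once for all copies.\<close>

primrec outerd :: "'a form \<Rightarrow> 'a form list \<Rightarrow> 'a form list \<Rightarrow> ('a form \<times> 'a ded list) list \<Rightarrow>
    (rule \<times> 'a form) list \<Rightarrow> 'a form list \<Rightarrow> 'a ded" where
  "outerd G L M R ss [] = Fm G"
| "outerd G L M R ss (X # Xs) =
    seq (DOr (Fm G) (sliced (Slc X (if Xs = [] then FF else hd Xs) G L M (map (\<lambda>q. (fst q, pick (snd q) Xs)) R)) ss))
      (seq (DOr (contr G) (Fm (if Xs = [] then FF else hd Xs))) (outerd G L M R ss Xs))"

text \<open>The conclusion is read off the steps alone; the premiss of a proof being
  \<open>t\<close>, the empty list proves \<open>t\<close>.\<close>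

primrec concl :: "(rule \<times> 'a form) list \<Rightarrow> 'a form" where
  "concl [] = TT"
| "concl (x # xs) = (if xs = [] then snd x else concl xs)"

primrec all_atoms :: "(rule \<times> 'a form) list \<Rightarrow> 'a form list" where
  "all_atoms [] = []"
| "all_atoms (x # xs) = afl (snd x) @ all_atoms xs"

definition atree :: "'a form list \<Rightarrow> 'a form" where
  "atree L = foldr ins L FF"

definition cut_table :: "'a form \<Rightarrow> 'a form \<Rightarrow> 'a form list \<Rightarrow> ('a form \<times> 'a ded list) list" where
  "cut_table G t L = map (\<lambda>P. (P, rev (raise P G t))) L"

text \<open>The outer compositions with \<open>Fm TT\<close> and \<open>Fm G\<close> make premiss
  and conclusion literally \<open>TT\<close> and \<open>G\<close>, as \<open>is_proof\<close>
  demands; what lies between them is controlled only modulo \<open>=\<close>.\<close>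

definition normal_from :: "'a form \<Rightarrow> 'a form list \<Rightarrow> (rule \<times> 'a form) list \<Rightarrow> 'a ded" where
  "normal_from G L ss = seq (Fm TT) (seq (seq (DOr (weak G) (Fm TT))
     (outerd G L (ors (all_atoms ss)) (cut_table G (atree L) L) ss (thr (atree L)))) (Fm G))"

definition normal :: "(rule \<times> 'a form) list \<Rightarrow> 'a ded" where
  "normal ss = normal_from (concl ss) (ors (afl (concl ss))) ss"

section \<open>Correctness of the normal form\<close>

lemma ors_subset: "set (ors As) \<subseteq> set As"
  by (induction As) auto

lemma ors_covers: "Atom a \<in> set As \<Longrightarrow> Atom a \<in> set (ors As) \<or> Atom (bar a) \<in> set (ors As)"
  by (induction As) auto

lemma ors_exclusive: "Atom a \<in> set (ors As) \<Longrightarrow> Atom (bar a) \<notin> set (ors As)"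
proof (induction As)
  case (Cons A As)
  then show ?case using bar_neq[of a] bar_bar[of a] by (auto split: if_splits)
qed simp

lemma distinct_ors: "distinct (ors As)"
  by (induction As) auto

lemma afl_Atom: "P \<in> set (afl A) \<Longrightarrow> \<exists>a. P = Atom a"
  by (induction A) auto

lemma concl_chain: "chain bar S G ss D \<Longrightarrow> D = (if ss = [] then G else concl ss)"
  by (induction ss arbitrary: G) auto

lemma all_atoms_set: "set (all_atoms ss) = (\<Union>x\<in>set ss. set (afl (snd x)))"
  by (induction ss) auto

lemma atree_props:
  assumes "\<forall>P\<in>set L. \<exists>a. P = Atom a"
  shows "braun (atree L) \<and> set (afl (atree L)) = set L \<and> leaves (atree L) = length L \<and> (distinct L \<longrightarrow> distinct (afl (atree L)))"
  using assms unfolding atree_def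
proof (induction L)
  case (Cons P L)
  then obtain a where "P = Atom a" by auto
  then show ?case using Cons ins_Atom[of P a "foldr ins L FF"] by auto
qed simp

lemma braun_ptree: "braun t \<Longrightarrow> ptree t" by (induction t) auto

lemma cls_thr_0: "cls (thr t ! 0) = qT"
proof (induction t)
  case (Conj l r)
  obtain X Xs Y Ys where "thr l = X # Xs" "thr r = Y # Ys" using thr_nonempty by (metis neq_Nil_conv)
  then show ?case using Conj by simp
qed auto

text \<open>Induction on the number of thresholds left. Past the last one the disjunct is
  \<open>f\<close>, so only \<open>G\<close> remains.\<close>

lemma outerd_der:
  assumes c: "chain bar SKS TT ss G" and L: "L = ors (afl G)" and M: "M = ors (all_atoms ss)" and t: "t = atree L"
    and X: "X = thr t" and R: "R = cut_table G t L"
  shows "k \<le> length X \<Longrightarrow> der (outerd G L M R ss (drop k X)) (cls G \<oplus> (if k < length X then cls (X ! k) else qF)) (cls G)"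
proof (induction "length X - k" arbitrary: k)
  case 0
  then show ?case by (auto simp: der_def)
next
  case (Suc m)
  then have k: "k < length X" by simp
  define Xs where "Xs = drop (k + 1) X"
  define Z where "Z = succs X ! k"
  have dk: "drop k X = X ! k # Xs" using k by (simp add: Xs_def Cons_nth_drop_Suc)
  have Z: "Z = (if Xs = [] then FF else hd Xs)"
    using k by (auto simp: Z_def Xs_def nth_succs hd_drop_conv_nth)
  define p where "p = Slc (X ! k) Z G L M (map (\<lambda>q. (fst q, pick (snd q) Xs)) R)"
  have at: "\<forall>P\<in>set L. \<exists>a. P = Atom a" using ors_subset[of "afl G"] afl_Atom L by auto
  have tp: "braun t" "set (afl t) = set L" "distinct (afl t)"
    using atree_props[OF at] distinct_ors L t by auto
  have LG: "set L \<subseteq> set (afl G)" using L ors_subset by auto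
  have "good p (set (all_atoms ss))"
    unfolding good_def
  proof (intro conjI ballI allI impI)
    have [simp]: "th p = X ! k" "al p = G" "ls p = L" "ms p = M" by (simp_all add: p_def)
    show "set (afl (th p)) \<subseteq> set (afl (al p))" using afl_thr[of "X ! k" t] k X tp LG by auto
    show "\<exists>a. P = Atom a" if "P \<in> set (ls p)" for P using at that by auto
    show "Atom (bar a) \<notin> set (ls p)" if "Atom a \<in> set (ls p)" for a using ors_exclusive that L by auto
    show "Atom a \<in> set (ls p) \<or> Atom (bar a) \<in> set (ls p)" if "Atom a \<in> set (afl (al p))" for a using ors_covers that L by auto
    show "Atom a \<in> set (ms p) \<longleftrightarrow> Atom (bar a) \<notin> set (ms p)" if "Atom a \<in> set (all_atoms ss)" for a
      using ors_covers[OF that] ors_exclusive[of a "all_atoms ss"] M by auto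
    show "set (ls p) \<subseteq> set (afl (al p))" using LG by simp
    fix P assume "P \<in> set (ls p)"
    then have P: "P \<in> set L" by simp
    then obtain a where Pa: "P = Atom a" using at by auto
    have "length (raise P G t) = length X" using length_raise X by auto
    \<comment> \<open>\<open>Xs\<close> has \<open>length X - (k + 1)\<close> entries, and this
      position in the reversed row is entry \<open>k\<close> of the row itself.\<close>
    then have pk: "pick (rev (raise P G t)) Xs = raise P G t ! k"
      using k by (simp add: pick_nth Xs_def rev_nth)
    have "map (\<lambda>q. (fst q, pick (snd q) Xs)) R = map (\<lambda>P. (P, pick (rev (raise P G t)) Xs)) L"
      by (simp add: R cut_table_def)
    then have "cutd p P = raise P G t ! k"
      using P pk by (simp add: cutd_def p_def lookup_map)
    moreover have "der (raise P G t ! k) (cls P \<odot> cls (erase P (X ! k))) (cls Z \<oplus> cls G)"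
      unfolding Z_def X using raise_der[OF Pa, of t G k] P tp LG k X braun_ptree[OF tp(1)] by auto
    ultimately show "der (cutd p P) (cls P \<odot> cls (erase P (th p))) (cls (RR p))"
      by (simp add: RR_def p_def q_simps)
  qed
  from sliced_der[OF this, of ss] c all_atoms_set
  have 1: "der (sliced p ss) (cls (X ! k)) (cls G \<oplus> cls Z)" by (simp add: p_def RR_def)
  have 2: "der (outerd G L M R ss Xs) (cls G \<oplus> cls Z) (cls G)"
    using Suc.hyps(1)[of "k + 1"] Suc.hyps(2) k by (auto simp: Xs_def Z_def nth_succs split: if_splits)
  have 3: "der (DOr (Fm G) (sliced p ss)) (cls G \<oplus> cls (X ! k)) (cls G \<oplus> (cls G \<oplus> cls Z))"
    by (intro der_or der_Fm 1)
  have 4: "der (DOr (contr G) (Fm Z)) ((cls G \<oplus> cls G) \<oplus> cls Z) (cls G \<oplus> cls Z)"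
    by (intro der_or der_Fm contr_der)
  have "der (outerd G L M R ss (X ! k # Xs)) (cls G \<oplus> cls (X ! k)) (cls G)"
    unfolding outerd.simps Z[symmetric] p_def[symmetric]
    by (rule der_seq[OF 3 der_seq[OF 4 2 HOL.refl]]) (simp add: q_simps)
  then show ?case using k dk by simp
qed

lemma normal_proof:
  assumes "is_proof bar SKS \<Pi> G"
  shows "is_proof bar aSKS (TT, steps (normal (snd \<Pi>))) G"
proof -
  have c: "chain bar SKS TT (snd \<Pi>) G" using assms by (simp add: is_proof_def is_derivation_def)
  have G: "G = concl (snd \<Pi>)" using concl_chain[OF c] by (auto split: if_splits)
  let ?L = "ors (afl G)" let ?t = "atree ?L"
  have 1: "der (outerd G ?L (ors (all_atoms (snd \<Pi>))) (cut_table G ?t ?L) (snd \<Pi>) (thr ?t)) (cls G \<oplus> qT) (cls G)"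
    using outerd_der[OF c HOL.refl HOL.refl HOL.refl HOL.refl HOL.refl, of 0] thr_nonempty[of ?t] cls_thr_0[of ?t] by simp
  have 2: "der (DOr (weak G) (Fm TT)) qT (cls G \<oplus> qT)" using der_or[OF weak_der der_Fm[of TT]] by simp
  have "der (normal (snd \<Pi>)) qT (cls G)"
    unfolding normal_def normal_from_def G[symmetric]
    using der_seq[OF der_Fm[of TT] der_seq[OF der_seq[OF 2 1] der_Fm[of G]]] by simp
  then have "valid (normal (snd \<Pi>))" by (simp add: der_def)
  from valid_chain[OF this] show ?thesis
    by (simp add: is_proof_def is_derivation_def normal_def normal_from_def G)
qed

end

section \<open>Recursion schemes\<close>

named_theorems comp_intro

fun enc_pair :: "('b \<Rightarrow> 'a data) \<Rightarrow> ('c \<Rightarrow> 'a data) \<Rightarrow> 'b \<times> 'c \<Rightarrow> 'a data" where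
  "enc_pair e1 e2 (x, y) = Node (e1 x) (e2 y)"

lemma enc_pair_fst_snd: "enc_pair e1 e2 q = Node (e1 (fst q)) (e2 (snd q))"
  by (cases q) simp

primrec enc_ded :: "'a ded \<Rightarrow> 'a data" where
  "enc_ded (Fm A) = Node Null (encode_form A)"
| "enc_ded (DOr d e) = Node (tag 1) (Node (enc_ded d) (enc_ded e))"
| "enc_ded (DAnd d e) = Node (tag 2) (Node (enc_ded d) (enc_ded e))"
| "enc_ded (DSeq r d e) = Node (tag 3) (Node (encode_rule r) (Node (enc_ded d) (enc_ded e)))"

lemma data_size_tag: "data_size (tag n) = 2 * n + 1" by (induction n) auto

lemma data_size_rule: "data_size (encode_rule r) \<le> 17"
  by (cases r) (simp_all add: data_size_tag del: tag.simps)

context sks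
begin

lemma comp_v0: "computable S (\<lambda>s. g s # r s) g"
  by (rule comp_var[of _ 0]) simp
lemma comp_v1: "computable S (\<lambda>s. a0 s # g s # r s) g"
  by (rule comp_var[of _ 1]) simp
lemma comp_v2: "computable S (\<lambda>s. a0 s # a1 s # g s # r s) g"
  by (rule comp_var[of _ 2]) simp
lemma comp_v3: "computable S (\<lambda>s. a0 s # a1 s # a2 s # g s # r s) g"
  by (rule comp_var[of _ 3]) simp
lemma comp_v4: "computable S (\<lambda>s. a0 s # a1 s # a2 s # a3 s # g s # r s) g"
  by (rule comp_var[of _ 4]) simp
lemma comp_v5: "computable S (\<lambda>s. a0 s # a1 s # a2 s # a3 s # a4 s # g s # r s) g"
  by (rule comp_var[of _ 5]) simp
lemma comp_v6: "computable S (\<lambda>s. a0 s # a1 s # a2 s # a3 s # a4 s # a5 s # g s # r s) g"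
  by (rule comp_var[of _ 6]) simp
lemma comp_v7: "computable S (\<lambda>s. a0 s # a1 s # a2 s # a3 s # a4 s # a5 s # a6 s # g s # r s) g"
  by (rule comp_var[of _ 7]) simp
lemma comp_v8: "computable S (\<lambda>s. a0 s # a1 s # a2 s # a3 s # a4 s # a5 s # a6 s # a7 s # g s # r s) g"
  by (rule comp_var[of _ 8]) simp
lemma comp_v9: "computable S (\<lambda>s. a0 s # a1 s # a2 s # a3 s # a4 s # a5 s # a6 s # a7 s # a8 s # g s # r s) g"
  by (rule comp_var[of _ 9]) simp

lemmas comp_vs = comp_v0 comp_v1 comp_v2 comp_v3 comp_v4 comp_v5 comp_v6 comp_v7 comp_v8 comp_v9

lemma comps_drop:
  assumes "\<And>s. s \<in> S \<Longrightarrow> length (env s) = n"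
  shows "computables S env (\<lambda>s. drop k (env s))"
proof (rule compsI)
  show "qb S (\<lambda>s. esz (env s)) (\<lambda>s. esz (env s))" by (rule qb_N)
  have e: "esz (drop k xs) \<le> esz xs" for xs :: "'a data list"
    by (metis append_take_drop_id esz_simps(3) le_add2)
  have m: "map ((!) xs) [k..<length xs] = drop k xs" for xs :: "'a data list"
    by (intro nth_equalityI) auto
  have eq: "(\<Sum>i\<leftarrow>[k..<length xs]. data_size (xs ! i)) = esz (drop k xs)" for xs :: "'a data list"
    unfolding esz_def m[symmetric] map_map o_def ..
  have v: "evals bar P (env s) (map Var [k..<n]) (drop k (env s)) (esz (drop k (env s)))" if "s \<in> S" for s P
    using evals_Vars[of "[k..<n]" "env s" bar P] assms[OF that] m[of "env s"] eq[of "env s"] by simp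
  show "\<exists>Q es. \<forall>pre post. length pre = off \<longrightarrow>
     (\<forall>s\<in>S. \<exists>t\<le>esz (env s). evals bar (pre @ Q @ post) (env s) es (drop k (env s)) t)" for off
  proof (rule exI[of _ "[]"], rule exI[of _ "map Var [k..<n]"], intro allI impI ballI)
    fix pre post :: program and s assume "s \<in> S"
    from v[OF this] show "\<exists>t\<le>esz (env s). evals bar (pre @ [] @ post) (env s) (map Var [k..<n]) (drop k (env s)) t"
      by (intro exI[of _ "esz (drop k (env s))"]) (simp add: e)
  qed
qed

text \<open>Discharges the size hypothesis of \<open>comp_rec\<close> when a node adds at most
  \<open>H\<close> to the results of its children. Unrolled, the result consists of at most
  \<open>w s\<close> contributions, each from a leaf or from \<open>H\<close>.\<close>

lemma comp_rec_add:
  fixes w :: "'s \<Rightarrow> nat"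
  assumes nd: "computable S env (\<lambda>s. truth (nd s))"
    and leaf: "computable {s\<in>S. \<not> nd s} env g"
    and node: "computable {s\<in>S. nd s} (\<lambda>s. map (\<lambda>c. g (c s)) cs @ env s) g"
    and args: "\<And>c. c \<in> set cs \<Longrightarrow> computables {s\<in>S. nd s} env (\<lambda>s. env (c s))"
    and closed: "\<And>c s. c \<in> set cs \<Longrightarrow> s \<in> S \<Longrightarrow> nd s \<Longrightarrow> c s \<in> S \<and> esz (env (c s)) \<le> esz (env s)"
    and len: "\<And>s. s \<in> S \<Longrightarrow> length (env s) = n"
    and w: "\<And>s. s \<in> S \<Longrightarrow> nd s \<Longrightarrow> 1 + (\<Sum>c\<leftarrow>cs. w (c s)) \<le> w s"
    and w1: "\<And>s. s \<in> S \<Longrightarrow> 1 \<le> w s \<and> w s \<le> esz (env s)"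
    and h: "qb {s\<in>S. nd s} (\<lambda>s. esz (env s)) H"
    and size: "\<And>s. s \<in> S \<Longrightarrow> nd s \<Longrightarrow> data_size (g s) \<le> (\<Sum>c\<leftarrow>cs. data_size (g (c s))) + H s"
  shows "computable S env g"
proof (rule comp_rec[where S = S and env = env and g = g and nd = nd and cs = cs and w = w and n = n,
      OF nd leaf node])
  let ?N = "\<lambda>s. esz (env s)"
  obtain kl where kl: "\<And>s. s \<in> S \<Longrightarrow> \<not> nd s \<Longrightarrow> data_size (g s) \<le> bd kl (?N s)"
    using comp_qb[OF leaf] by (auto simp: qb_def)
  obtain kh where kh: "\<And>s. s \<in> S \<Longrightarrow> nd s \<Longrightarrow> H s \<le> bd kh (?N s)"
    using h by (auto simp: qb_def)
  \<comment> \<open>\<open>X\<close> bounds the environment at the root; keeping it fixed in the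
    induction gives all calls below the root the same summand.\<close>
  have main: "data_size (g s) \<le> w s * (bd kl X + bd kh X)" if "s \<in> S" "?N s \<le> X" for s X
    using that
  proof (induction "w s" arbitrary: s rule: less_induct)
    case less
    note s = \<open>s \<in> S\<close>
    let ?B = "bd kl X + bd kh X"
    show ?case
    proof (cases "nd s")
      case False
      have "data_size (g s) \<le> bd kl X" using kl[OF s False] bd_mono[OF order_refl less(3), of kl] by linarith
      also have "\<dots> \<le> 1 * ?B" by simp
      also have "\<dots> \<le> w s * ?B" using w1[OF s] by (intro mult_le_mono) auto
      finally show ?thesis .
    next
      case True
      have c: "data_size (g (c s)) \<le> w (c s) * ?B" if cc: "c \<in> set cs" for c
      proof -
        have "w (c s) < w s"
          using w[OF s True] member_le_sum_list[of "w (c s)" "map (\<lambda>c. w (c s)) cs"] cc by force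
        then show ?thesis using less(1)[of "c s"] closed[OF cc s True] less(3) by auto
      qed
      have "(\<Sum>c\<leftarrow>cs. data_size (g (c s))) \<le> (\<Sum>c\<leftarrow>cs. w (c s) * ?B)"
        using c by (intro sum_list_mono) auto
      also have "\<dots> = (\<Sum>c\<leftarrow>cs. w (c s)) * ?B" by (rule sum_list_mult_const)
      finally have "data_size (g s) \<le> (1 + (\<Sum>c\<leftarrow>cs. w (c s))) * ?B"
        using size[OF s True] kh[OF s True] bd_mono[OF order_refl less(3), of kh] by simp
      also have "\<dots> \<le> w s * ?B" using w[OF s True] by (intro mult_le_mono) auto
      finally show ?thesis .
    qed
  qed
  have "data_size (g s) \<le> ?N s * (bd kl (?N s) + bd kh (?N s))" if "s \<in> S" for s
    using main[OF that order_refl] w1[OF that] mult_le_mono1 le_trans by blast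
  moreover have "qb S ?N (\<lambda>s. ?N s * (bd kl (?N s) + bd kh (?N s)))"
    by (intro qb_intros)
  ultimately show "qb S ?N (\<lambda>s. data_size (g s))" by (rule qb_mono[rotated])
qed (rule args closed len w w1; assumption)+

text \<open>\<open>h\<close> is any computable value at least as large as what one list element adds
  to the result; being computable, it is bounded by \<open>comp_qb\<close>.\<close>

lemma comp_list_rec:
  fixes g :: "'b list \<times> 'p \<Rightarrow> 'a data"
  assumes nil: "computable S env (\<lambda>p. g ([], p))"
    and cons: "computable {s. snd (snd s) \<in> S} (\<lambda>s. g (fst (snd s), snd (snd s)) # e (fst s) # encode_list e (fst (snd s)) # env (snd (snd s)))
        (\<lambda>s. g (fst s # fst (snd s), snd (snd s)))"
    and h: "computable {s. snd (snd s) \<in> S} (\<lambda>s. e (fst s) # encode_list e (fst (snd s)) # env (snd (snd s))) h"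
    and size: "\<And>x xs p. p \<in> S \<Longrightarrow> data_size (g (x # xs, p)) \<le> data_size (g (xs, p)) + data_size (h (x, xs, p))"
    and len: "\<And>p. p \<in> S \<Longrightarrow> length (env p) = n"
  shows "computable {s. snd s \<in> S} (\<lambda>s. encode_list e (fst s) # env (snd s)) g"
proof -
  define S1 where "S1 = {s :: 'b list \<times> 'p. snd s \<in> S \<and> fst s \<noteq> []}"
  define c where "c = (\<lambda>s :: 'b list \<times> 'p. (tl (fst s), snd s))"
  let ?env = "\<lambda>s. encode_list e (fst s) # env (snd s)"
  let ?nd = "\<lambda>s :: 'b list \<times> 'p. fst s \<noteq> []"
  have l: "encode_list e xs = Node (e (hd xs)) (encode_list e (tl xs))" if "xs \<noteq> []" for xs
    using that by (cases xs) auto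
  have drop1: "computables T ?env (\<lambda>s. env (snd s))" if "\<And>s. s \<in> T \<Longrightarrow> snd s \<in> S" for T
    using comps_drop[of T ?env "Suc n" 1] that len by simp
  have drop2: "computables S1 (\<lambda>s. f s # ?env s) (\<lambda>s. env (snd s))" for f
    using comps_drop[of S1 "\<lambda>s. f s # ?env s" "Suc (Suc n)" 2] len by (simp add: S1_def)
  have tl: "computable S1 (\<lambda>s. f s # ?env s) (\<lambda>s. encode_list e (tl (fst s)))" for f
    by (rule comp_cong[OF comp_Snd[OF comp_v1]]) (simp add: S1_def l)
  have hd: "computable S1 (\<lambda>s. f s # ?env s) (\<lambda>s. e (hd (fst s)))" for f
    by (rule comp_cong[OF comp_Fst[OF comp_v1]]) (simp add: S1_def l)
  have tl0: "computable S1 ?env (\<lambda>s. encode_list e (tl (fst s)))"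
    by (rule comp_cong[OF comp_Snd[OF comp_v0]]) (simp add: S1_def l)
  have hd0: "computable S1 ?env (\<lambda>s. e (hd (fst s)))"
    by (rule comp_cong[OF comp_Fst[OF comp_v0]]) (simp add: S1_def l)
  show ?thesis
  proof (rule comp_rec_add[where S = "{s. snd s \<in> S}" and env = ?env and g = g and nd = ?nd and cs = "[c]" 
        and w = "\<lambda>s. data_size (encode_list e (fst s))" 
        and n = "Suc n" and H = "\<lambda>s. data_size (h (hd (fst s), tl (fst s), snd s))"])
    have S1: "{s \<in> {s. snd s \<in> S}. ?nd s} = S1" by (auto simp: S1_def)
    have "computable {s. snd s \<in> S} ?env (\<lambda>s. if encode_list e (fst s) = Null then Null else Node Null Null)"
      by (intro comp_if comp_Eq comp_v0 comp_Null comp_Node)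
    then show "computable {s. snd s \<in> S} ?env (\<lambda>s. truth (?nd s))"
      by (rule comp_cong) (auto simp: truth_def l)
    have "computable {s \<in> {s. snd s \<in> S}. \<not> ?nd s} ?env (\<lambda>s. g ([], snd s))"
      by (rule comp_call[where \<phi> = snd and env' = env and g = "\<lambda>p. g ([], p)", OF drop1 nil]) auto
    then show "computable {s \<in> {s. snd s \<in> S}. \<not> ?nd s} ?env g"
    proof (rule comp_cong)
      fix s assume "s \<in> {s \<in> {s. snd s \<in> S}. \<not> ?nd s}"
      then show "g s = g ([], snd s)" by (cases s) auto
    qed
    have "computables S1 (\<lambda>s. g (c s) # ?env s) (\<lambda>s. g (tl (fst s), snd s) # e (hd (fst s)) # encode_list e (tl (fst s)) # env (snd s))"
      by (intro comps_Cons hd tl drop2) (simp add: c_def comp_v0)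
    from comp_call[where \<phi> = "\<lambda>s. (hd (fst s), tl (fst s), snd s)", OF _ cons, of S1 "\<lambda>s. g (c s) # ?env s", unfolded fst_conv snd_conv, OF this]
    have "computable S1 (\<lambda>s. g (c s) # ?env s) (\<lambda>s. g (hd (fst s) # tl (fst s), snd s))" by (simp add: S1_def)
    then have "computable S1 (\<lambda>s. g (c s) # ?env s) g"
      by (rule comp_cong) (auto simp: S1_def)
    then show "computable {s \<in> {s. snd s \<in> S}. ?nd s} (\<lambda>s. map (\<lambda>c. g (c s)) [c] @ ?env s) g"
      unfolding S1 by simp
    show "computables {s \<in> {s. snd s \<in> S}. ?nd s} ?env (\<lambda>s. ?env (c' s))" if "c' \<in> set [c]" for c'
      unfolding S1 using that by (simp add: c_def) (intro comps_Cons tl0 drop1, simp add: S1_def)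
    have "computables S1 ?env (\<lambda>s. e (hd (fst s)) # encode_list e (tl (fst s)) # env (snd s))"
      by (intro comps_Cons hd0 tl0 drop1) (simp add: S1_def)
    from comp_call[where \<phi> = "\<lambda>s. (hd (fst s), tl (fst s), snd s)", OF _ h, of S1 ?env, unfolded fst_conv snd_conv, OF this]
    have "computable S1 ?env (\<lambda>s. h (hd (fst s), tl (fst s), snd s))" by (simp add: S1_def)
    then show "qb {s \<in> {s. snd s \<in> S}. ?nd s} (\<lambda>s. esz (?env s)) (\<lambda>s. data_size (h (hd (fst s), tl (fst s), snd s)))"
      unfolding S1 by (rule comp_qb)
    show "data_size (g s) \<le> (\<Sum>c\<leftarrow>[c]. data_size (g (c s))) + data_size (h (hd (fst s), tl (fst s), snd s))"
      if "s \<in> {s. snd s \<in> S}" "?nd s" for s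
      using size[of "snd s" "hd (fst s)" "tl (fst s)"] that by (cases s) (simp add: c_def)
  qed (auto simp: c_def l data_size_pos[simplified] len)
qed

text \<open>\<open>hD\<close> and \<open>hC\<close> bound what a connective adds to the results of
  its subformulae. Typically they are the defining clause with those results replaced by trivial
  deductions.\<close>

lemma comp_form_rec:
  fixes g :: "'a form \<times> 'p \<Rightarrow> 'a data"
  assumes FF: "computable UNIV env (\<lambda>p. g (FF, p))"
    and TT: "computable UNIV env (\<lambda>p. g (TT, p))"
    and Atom: "computable UNIV (\<lambda>s. encode_form (Atom (fst s)) # env (snd s)) (\<lambda>s. g (Atom (fst s), snd s))"
    and Disj: "computable UNIV (\<lambda>s. g (fst s, snd (snd s)) # g (fst (snd s), snd (snd s)) # encode_form (fst s) #
          encode_form (fst (snd s)) # env (snd (snd s))) (\<lambda>s. g (Disj (fst s) (fst (snd s)), snd (snd s)))"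
    and Conj: "computable UNIV (\<lambda>s. g (fst s, snd (snd s)) # g (fst (snd s), snd (snd s)) # encode_form (fst s) #
          encode_form (fst (snd s)) # env (snd (snd s))) (\<lambda>s. g (Conj (fst s) (fst (snd s)), snd (snd s)))"
    and hD: "computable UNIV (\<lambda>s. encode_form (fst s) # encode_form (fst (snd s)) # env (snd (snd s))) hD"
    and hC: "computable UNIV (\<lambda>s. encode_form (fst s) # encode_form (fst (snd s)) # env (snd (snd s))) hC"
    and sizeD: "\<And>A B p. data_size (g (Disj A B, p)) \<le> data_size (g (A, p)) + data_size (g (B, p)) + data_size (hD (A, B, p))"
    and sizeC: "\<And>A B p. data_size (g (Conj A B, p)) \<le> data_size (g (A, p)) + data_size (g (B, p)) + data_size (hC (A, B, p))"
    and len: "\<And>p. length (env p) = n"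
  shows "computable UNIV (\<lambda>s. encode_form (fst s) # env (snd s)) g"
proof -
  let ?env = "\<lambda>s. encode_form (fst s) # env (snd s)"
  define nd where "nd = (\<lambda>s :: 'a form \<times> 'p. isD (fst s) \<or> isC (fst s))"
  define c1 where "c1 = (\<lambda>s :: 'a form \<times> 'p. (lft (fst s), snd s))"
  define c2 where "c2 = (\<lambda>s :: 'a form \<times> 'p. (rgt (fst s), snd s))"
  define h where "h = (\<lambda>s. if isD (fst s) then hD (lft (fst s), rgt (fst s), snd s) else hC (lft (fst s), rgt (fst s), snd s))"
  have drop1: "computables T ?env (\<lambda>s. env (snd s))" for T
    using comps_drop[of T ?env "Suc n" 1] len by simp
  have drop3: "computables T (\<lambda>s. f s # f' s # ?env s) (\<lambda>s. env (snd s))" for T f f'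
    using comps_drop[of T "\<lambda>s. f s # f' s # ?env s" "Suc (Suc (Suc n))" 3] len by simp
  have L: "encode_form (lft A) = data_fst (data_snd (encode_form A))" for A by (cases A) auto
  have R: "encode_form (rgt A) = data_snd (data_snd (encode_form A))" for A by (cases A) auto
  have isD: "isD A \<longleftrightarrow> data_fst (encode_form A) = Node Null Null" for A by (cases A) (auto simp: numeral_2_eq_2)
  have isC: "isC A \<longleftrightarrow> data_fst (encode_form A) = Node Null (Node Null Null)" for A by (cases A) (auto simp: numeral_2_eq_2)
  have cD: "computable T e (\<lambda>s. truth (isD (fst s)))" if "computable T e (\<lambda>s. encode_form (fst s))"
    for T and e :: "'a form \<times> 'p \<Rightarrow> 'a data list"
    unfolding isD by (intro comp_Eq comp_Fst comp_Node comp_Null that)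
  have cC: "computable T e (\<lambda>s. truth (isC (fst s)))" if "computable T e (\<lambda>s. encode_form (fst s))"
    for T and e :: "'a form \<times> 'p \<Rightarrow> 'a data list"
    unfolding isC by (intro comp_Eq comp_Fst comp_Node comp_Null that)
  have DC: "isD A \<Longrightarrow> A = Disj (lft A) (rgt A)" "isC A \<Longrightarrow> A = Conj (lft A) (rgt A)" for A :: "'a form"
    by (cases A; auto)+
  show ?thesis
  proof (rule comp_rec_add[where S = UNIV and env = ?env and g = g and nd = nd and cs = "[c1, c2]" 
        and w = "\<lambda>s. data_size (encode_form (fst s))" and n = "Suc n" and H = "\<lambda>s. data_size (h s)"])
    have "computable UNIV ?env (\<lambda>s. if isD (fst s) then Node Null Null else truth (isC (fst s)))"
      by (intro comp_if cD cC comp_v0 comp_Null comp_Node)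
    then show "computable UNIV ?env (\<lambda>s. truth (nd s))"
      by (rule comp_cong) (auto simp: truth_def nd_def)
    let ?T = "{s \<in> UNIV. \<not> nd s}"
    have 1: "computable T ?env (\<lambda>s. g (FF, snd s))" for T
      by (rule comp_call[where \<phi> = snd and env' = env and g = "\<lambda>p. g (FF, p)", OF drop1 FF]) auto
    have 2: "computable T ?env (\<lambda>s. g (TT, snd s))" for T
      by (rule comp_call[where \<phi> = snd and env' = env and g = "\<lambda>p. g (TT, p)", OF drop1 TT]) auto
    \<comment> \<open>The hypothesis is indexed by the atom, the claim by the formula;
      \<open>atm\<close> translates between the two and leaves the encoding unchanged.\<close>
    have 3: "computable (T \<inter> {s. isA (fst s)}) ?env g" for T
    proof -
      define atm where "atm = (\<lambda>A :: 'a form. case A of Atom a \<Rightarrow> a | _ \<Rightarrow> undefined)"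
      have "computables (T \<inter> {s. isA (fst s)}) ?env (\<lambda>s. encode_form (Atom (atm (fst s))) # env (snd s))"
        by (intro comps_Cons drop1, rule comp_cong[OF comp_v0]) (auto simp: atm_def elim!: isA.elims)
      then have "computable (T \<inter> {s. isA (fst s)}) ?env (\<lambda>s. g (Atom (atm (fst s)), snd s))"
        using comp_call[where \<phi> = "\<lambda>s. (atm (fst s), snd s)", OF _ Atom, of "T \<inter> {s. isA (fst s)}" ?env] by simp
      then show ?thesis
      proof (rule comp_cong)
        fix s :: "'a form \<times> 'p" assume "s \<in> T \<inter> {s. isA (fst s)}"
        then show "g s = g (Atom (atm (fst s)), snd s)" by (cases s) (auto simp: atm_def elim!: isA.elims)
      qed
    qed
    have "computable ?T ?env (\<lambda>s. if is_tok (encode_form (fst s)) then g s else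
       if encode_form (fst s) = Null then g (FF, snd s) else g (TT, snd s))"
      by (intro comp_if comp_IsTok comp_Eq comp_Null comp_v0 1 2, rule comp_subset[OF 3[of UNIV]])
        (auto, case_tac a, auto)
    then show "computable ?T ?env g"
    proof (rule comp_cong)
      fix s assume "s \<in> ?T"
      then show "g s = (if is_tok (encode_form (fst s)) then g s else
       if encode_form (fst s) = Null then g (FF, snd s) else g (TT, snd s))"
        by (cases s; cases "fst s") (auto simp: nd_def)
    qed
    let ?env3 = "\<lambda>s. g (c1 s) # g (c2 s) # ?env s"
    have LR: "computables T ?env3 (\<lambda>s. g (lft (fst s), snd s) # g (rgt (fst s), snd s) # encode_form (lft (fst s)) # 
          encode_form (rgt (fst s)) # env (snd s))" for T
      unfolding L R by (intro comps_Cons drop3 comp_Fst comp_Snd comp_v2) (auto simp: c1_def c2_def intro: comp_v0 comp_v1)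
    have "computable T ?env3 (\<lambda>s. g (Disj (lft (fst s)) (rgt (fst s)), snd s))" for T
      using comp_call[where \<phi> = "\<lambda>s. (lft (fst s), rgt (fst s), snd s)", OF _ Disj, of T ?env3] LR by simp
    moreover have "computable T ?env3 (\<lambda>s. g (Conj (lft (fst s)) (rgt (fst s)), snd s))" for T
      using comp_call[where \<phi> = "\<lambda>s. (lft (fst s), rgt (fst s), snd s)", OF _ Conj, of T ?env3] LR by simp
    ultimately have "computable {s \<in> UNIV. nd s} ?env3 (\<lambda>s. if isD (fst s) then g (Disj (lft (fst s)) (rgt (fst s)), snd s) else
         g (Conj (lft (fst s)) (rgt (fst s)), snd s))"
      by (intro comp_if cD comp_v2)
    then have "computable {s \<in> UNIV. nd s} ?env3 g"
      by (rule comp_cong) (auto simp: nd_def simp flip: DC)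
    then show "computable {s \<in> UNIV. nd s} (\<lambda>s. map (\<lambda>c. g (c s)) [c1, c2] @ ?env s) g" by simp
    show "computables {s \<in> UNIV. nd s} ?env (\<lambda>s. ?env (c s))" if "c \<in> set [c1, c2]" for c
    proof -
      have "computables {s \<in> UNIV. nd s} ?env (\<lambda>s. encode_form (lft (fst s)) # env (snd s))"
        "computables {s \<in> UNIV. nd s} ?env (\<lambda>s. encode_form (rgt (fst s)) # env (snd s))"
        unfolding L R by (intro comps_Cons drop1 comp_Fst comp_Snd comp_v0)+
      then show ?thesis using that by (auto simp: c1_def c2_def)
    qed
    have LR0: "computables T ?env (\<lambda>s. encode_form (lft (fst s)) # encode_form (rgt (fst s)) # env (snd s))" for T
      unfolding L R by (intro comps_Cons drop1 comp_Fst comp_Snd comp_v0)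
    have "computable T ?env (\<lambda>s. hD (lft (fst s), rgt (fst s), snd s))" for T
      using comp_call[where \<phi> = "\<lambda>s. (lft (fst s), rgt (fst s), snd s)", OF _ hD, of T ?env] LR0 by simp
    moreover have "computable T ?env (\<lambda>s. hC (lft (fst s), rgt (fst s), snd s))" for T
      using comp_call[where \<phi> = "\<lambda>s. (lft (fst s), rgt (fst s), snd s)", OF _ hC, of T ?env] LR0 by simp
    ultimately have "computable {s \<in> UNIV. nd s} ?env h"
      unfolding h_def by (intro comp_if cD comp_v0)
    then show "qb {s \<in> UNIV. nd s} (\<lambda>s. esz (?env s)) (\<lambda>s. data_size (h s))" by (rule comp_qb)
    show "data_size (g s) \<le> (\<Sum>c\<leftarrow>[c1, c2]. data_size (g (c s))) + data_size (h s)" if "nd s" for s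
      using that sizeD[of "lft (fst s)" "rgt (fst s)" "snd s"] sizeC[of "lft (fst s)" "rgt (fst s)" "snd s"]
      by (cases s; cases "fst s") (auto simp: nd_def h_def c1_def c2_def)
    show "c \<in> set [c1, c2] \<Longrightarrow> s \<in> UNIV \<Longrightarrow> nd s \<Longrightarrow> c s \<in> UNIV \<and> esz (?env (c s)) \<le> esz (?env s)" for c s
      by (cases s; cases "fst s") (auto simp: nd_def c1_def c2_def)
    show "s \<in> UNIV \<Longrightarrow> nd s \<Longrightarrow> 1 + (\<Sum>c\<leftarrow>[c1, c2]. data_size (encode_form (fst (c s)))) \<le> data_size (encode_form (fst s))" for s
      by (cases s; cases "fst s") (auto simp: nd_def c1_def c2_def)
  qed (auto simp: len data_size_pos[simplified])
qed

end

section \<open>Computability of the constructions\<close>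

context sks
begin

lemma comp_FF [comp_intro]: "computable S env (\<lambda>s. encode_form FF)"
  using comp_Null by simp

lemma comp_TT [comp_intro]: "computable S env (\<lambda>s. encode_form TT)"
  using comp_Node[OF comp_Null comp_Null] by simp

lemma comp_tag: "computable S env (\<lambda>s. tag n)"
  by (induction n) (auto intro: comp_Null comp_Node)

lemma comp_rule_const [comp_intro]: "computable S env (\<lambda>s. encode_rule r)"
  by (cases r) (simp_all add: comp_tag del: tag.simps)

lemma comp_Disj [comp_intro]: "computable S env (\<lambda>s. encode_form (A s)) \<Longrightarrow> computable S env (\<lambda>s. encode_form (B s)) \<Longrightarrow>
   computable S env (\<lambda>s. encode_form (Disj (A s) (B s)))"
  by (simp del: tag.simps add: comp_Node comp_tag)

lemma comp_Conj [comp_intro]: "computable S env (\<lambda>s. encode_form (A s)) \<Longrightarrow> computable S env (\<lambda>s. encode_form (B s)) \<Longrightarrow>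
   computable S env (\<lambda>s. encode_form (Conj (A s) (B s)))"
  by (simp del: tag.simps add: comp_Node comp_tag)

lemma comp_lft [comp_intro]: "computable S env (\<lambda>s. encode_form (A s)) \<Longrightarrow> computable S env (\<lambda>s. encode_form (lft (A s)))"
  by (rule comp_cong[OF comp_Fst[OF comp_Snd]]) (assumption, case_tac "A s", auto)

lemma comp_rgt [comp_intro]: "computable S env (\<lambda>s. encode_form (A s)) \<Longrightarrow> computable S env (\<lambda>s. encode_form (rgt (A s)))"
  by (rule comp_cong[OF comp_Snd[OF comp_Snd]]) (assumption, case_tac "A s", auto)

lemma comp_barf [comp_intro]: "computable S env (\<lambda>s. encode_form (A s)) \<Longrightarrow> computable S env (\<lambda>s. encode_form (barf (A s)))"
  by (rule comp_cong[OF comp_Bar]) (assumption, case_tac "A s", auto)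

lemma comp_eqF [comp_intro]: "computable S env (\<lambda>s. encode_form (A s)) \<Longrightarrow> computable S env (\<lambda>s. encode_form (B s)) \<Longrightarrow>
   computable S env (\<lambda>s. truth (A s = B s))"
  by (rule comp_cong[OF comp_Eq]) (assumption, assumption, simp add: encode_form_inject)

lemma comp_isD [comp_intro]: "computable S env (\<lambda>s. encode_form (A s)) \<Longrightarrow> computable S env (\<lambda>s. truth (isD (A s)))"
  by (rule comp_cong[OF comp_Eq[OF comp_Fst comp_tag[of _ _ 1]]]) (assumption, case_tac "A s", auto simp: numeral_2_eq_2)

lemma comp_isC [comp_intro]: "computable S env (\<lambda>s. encode_form (A s)) \<Longrightarrow> computable S env (\<lambda>s. truth (isC (A s)))"
  by (rule comp_cong[OF comp_Eq[OF comp_Fst comp_tag[of _ _ 2]]]) (assumption, case_tac "A s", auto simp: numeral_2_eq_2)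

lemma comp_isA [comp_intro]: "computable S env (\<lambda>s. encode_form (A s)) \<Longrightarrow> computable S env (\<lambda>s. truth (isA (A s)))"
  by (rule comp_cong[OF comp_IsTok]) (assumption, case_tac "A s", auto)

lemma comp_True [comp_intro]: "computable S env (\<lambda>s. truth True)"
  using comp_Node[OF comp_Null comp_Null] by (simp add: truth_def)

lemma comp_False [comp_intro]: "computable S env (\<lambda>s. truth False)"
  using comp_Null by (simp add: truth_def)

lemma comp_and [comp_intro]: "computable S env (\<lambda>s. truth (a s)) \<Longrightarrow> computable S env (\<lambda>s. truth (b s)) \<Longrightarrow>
   computable S env (\<lambda>s. truth (a s \<and> b s))"
  by (rule comp_cong[OF comp_if[of S env a "\<lambda>s. truth (b s)" "\<lambda>s. truth False"]])
    (auto intro: comp_False comp_subset)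

lemma comp_or [comp_intro]: "computable S env (\<lambda>s. truth (a s)) \<Longrightarrow> computable S env (\<lambda>s. truth (b s)) \<Longrightarrow>
   computable S env (\<lambda>s. truth (a s \<or> b s))"
  by (rule comp_cong[OF comp_if[of S env a "\<lambda>s. truth True" "\<lambda>s. truth (b s)"]])
    (auto intro: comp_True comp_subset)

lemma comp_ifF [comp_intro]:
  "computable S env (\<lambda>s. truth (b s)) \<Longrightarrow> computable {s\<in>S. b s} env (\<lambda>s. encode_form (A s)) \<Longrightarrow>
   computable {s\<in>S. \<not> b s} env (\<lambda>s. encode_form (B s)) \<Longrightarrow> computable S env (\<lambda>s. encode_form (if b s then A s else B s))"
  by (rule comp_cong[OF comp_if[of S env b]]) auto

lemma comp_ifD [comp_intro]:
  "computable S env (\<lambda>s. truth (b s)) \<Longrightarrow> computable {s\<in>S. b s} env (\<lambda>s. enc_ded (A s)) \<Longrightarrow>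
   computable {s\<in>S. \<not> b s} env (\<lambda>s. enc_ded (B s)) \<Longrightarrow> computable S env (\<lambda>s. enc_ded (if b s then A s else B s))"
  by (rule comp_cong[OF comp_if[of S env b]]) auto

lemma comp_ifL [comp_intro]:
  "computable S env (\<lambda>s. truth (b s)) \<Longrightarrow> computable {s\<in>S. b s} env (\<lambda>s. encode_list e (A s)) \<Longrightarrow>
   computable {s\<in>S. \<not> b s} env (\<lambda>s. encode_list e (B s)) \<Longrightarrow> computable S env (\<lambda>s. encode_list e (if b s then A s else B s))"
  by (rule comp_cong[OF comp_if[of S env b]]) auto

lemma comp_Nil [comp_intro]: "computable S env (\<lambda>s. encode_list e [])"
  using comp_Null by simp

lemma comp_Cons [comp_intro]: "computable S env (\<lambda>s. e (x s)) \<Longrightarrow> computable S env (\<lambda>s. encode_list e (xs s)) \<Longrightarrow>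
   computable S env (\<lambda>s. encode_list e (x s # xs s))"
  by (simp add: comp_Node)

lemma comp_tl [comp_intro]: "computable S env (\<lambda>s. encode_list e (xs s)) \<Longrightarrow> computable S env (\<lambda>s. encode_list e (tl (xs s)))"
  by (rule comp_cong[OF comp_Snd]) (assumption, case_tac "xs s", auto)

lemma comp_isNil: "computable S env (\<lambda>s. encode_list e (xs s)) \<Longrightarrow> computable S env (\<lambda>s. truth (xs s = []))"
  by (rule comp_cong[OF comp_Eq[OF _ comp_Null]]) (assumption, case_tac "xs s", auto)

lemma comp_hd: "computable S env (\<lambda>s. encode_list e (xs s)) \<Longrightarrow> (\<And>s. s \<in> S \<Longrightarrow> xs s \<noteq> []) \<Longrightarrow> 
   computable S env (\<lambda>s. e (hd (xs s)))"
  by (rule comp_cong[OF comp_Fst]) (assumption, case_tac "xs s", auto)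

lemma comp_pair [comp_intro]: "computable S env (\<lambda>s. e1 (x s)) \<Longrightarrow> computable S env (\<lambda>s. e2 (y s)) \<Longrightarrow>
   computable S env (\<lambda>s. enc_pair e1 e2 (x s, y s))"
  by (simp add: comp_Node)

lemma comp_fst: "computable S env (\<lambda>s. enc_pair e1 e2 (q s)) \<Longrightarrow> computable S env (\<lambda>s. e1 (fst (q s)))"
  by (rule comp_cong[OF comp_Fst]) (assumption, simp add: enc_pair_fst_snd)

lemma comp_snd: "computable S env (\<lambda>s. enc_pair e1 e2 (q s)) \<Longrightarrow> computable S env (\<lambda>s. e2 (snd (q s)))"
  by (rule comp_cong[OF comp_Snd]) (assumption, simp add: enc_pair_fst_snd)

lemma comp_Fm [comp_intro]: "computable S env (\<lambda>s. encode_form (A s)) \<Longrightarrow> computable S env (\<lambda>s. enc_ded (Fm (A s)))"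
  by (simp add: comp_Node comp_Null)

lemma comp_DOr [comp_intro]: "computable S env (\<lambda>s. enc_ded (d s)) \<Longrightarrow> computable S env (\<lambda>s. enc_ded (e s)) \<Longrightarrow>
   computable S env (\<lambda>s. enc_ded (DOr (d s) (e s)))"
  by (simp del: tag.simps add: comp_Node comp_tag)

lemma comp_DAnd [comp_intro]: "computable S env (\<lambda>s. enc_ded (d s)) \<Longrightarrow> computable S env (\<lambda>s. enc_ded (e s)) \<Longrightarrow>
   computable S env (\<lambda>s. enc_ded (DAnd (d s) (e s)))"
  by (simp del: tag.simps add: comp_Node comp_tag)

lemma comp_DSeq [comp_intro]: "computable S env (\<lambda>s. encode_rule (r s)) \<Longrightarrow> computable S env (\<lambda>s. enc_ded (d s)) \<Longrightarrow>
   computable S env (\<lambda>s. enc_ded (e s)) \<Longrightarrow> computable S env (\<lambda>s. enc_ded (DSeq (r s) (d s) (e s)))"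
  by (simp del: tag.simps add: comp_Node comp_tag)

lemma comp_seq [comp_intro]: "computable S env (\<lambda>s. enc_ded (d s)) \<Longrightarrow> computable S env (\<lambda>s. enc_ded (e s)) \<Longrightarrow>
   computable S env (\<lambda>s. enc_ded (seq (d s) (e s)))"
  unfolding seq_def by (intro comp_intro)

lemma comp_sw [comp_intro]: "computable S env (\<lambda>s. encode_form (A s)) \<Longrightarrow> computable S env (\<lambda>s. encode_form (B s)) \<Longrightarrow>
   computable S env (\<lambda>s. encode_form (C s)) \<Longrightarrow> computable S env (\<lambda>s. enc_ded (sw (A s) (B s) (C s)))"
  unfolding sw_def by (intro comp_intro)

lemma comp_md [comp_intro]: "computable S env (\<lambda>s. encode_form (A s)) \<Longrightarrow> computable S env (\<lambda>s. encode_form (B s)) \<Longrightarrow>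
   computable S env (\<lambda>s. encode_form (C s)) \<Longrightarrow> computable S env (\<lambda>s. encode_form (D s)) \<Longrightarrow>
   computable S env (\<lambda>s. enc_ded (md (A s) (B s) (C s) (D s)))"
  unfolding md_def by (intro comp_intro)

lemmas size_simps = data_size_tag seq_def sw_def md_def

text \<open>The pattern for most constructions: the lemma with suffix 0 fixes a standard
  environment, and \<open>comp_call\<close> then transfers it to arbitrary environments, in the form
  required of a rule in \<open>comp_intro\<close>.\<close>

lemma comp_weak0: "computable UNIV (\<lambda>s :: 'a form \<times> unit. encode_form (fst s) # []) (\<lambda>s. enc_ded (weak (fst s)))"
  apply (rule comp_form_rec[where env = "\<lambda>_. []" and g = "\<lambda>s. enc_ded (weak (fst s))" and n = 0
        and hD = "\<lambda>s. enc_ded (DOr (Fm FF) (Fm FF))" and hC = "\<lambda>s. enc_ded (DAnd (Fm FF) (Fm FF))"])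
           apply (simp_all only: fst_conv snd_conv weak.simps)
           apply ((rule comp_vs comp_intro)+)[7]
    apply (simp_all add: size_simps)
  done

lemma comp_weak [comp_intro]: "computable S env (\<lambda>s. encode_form (A s)) \<Longrightarrow> computable S env (\<lambda>s. enc_ded (weak (A s)))"
  by (rule comp_call[where \<phi> = "\<lambda>s. (A s, ())", OF _ comp_weak0, of S env, unfolded fst_conv snd_conv])
    (intro comps_Cons comps_Nil, simp_all)

lemma comp_contr0: "computable UNIV (\<lambda>s :: 'a form \<times> unit. encode_form (fst s) # []) (\<lambda>s. enc_ded (contr (fst s)))"
  apply (rule comp_form_rec[where env = "\<lambda>_. []" and g = "\<lambda>s. enc_ded (contr (fst s))" and n = 0
        and hD = "\<lambda>s. enc_ded (DOr (Fm FF) (Fm FF))"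
        and hC = "\<lambda>s. enc_ded (seq (md (fst s) (fst (snd s)) (fst s) (fst (snd s))) (DAnd (Fm FF) (Fm FF)))"])
           apply (simp_all only: fst_conv snd_conv contr.simps)
           apply ((rule comp_vs comp_intro)+)[7]
    apply (simp_all add: size_simps)
  done

lemma comp_contr [comp_intro]: "computable S env (\<lambda>s. encode_form (A s)) \<Longrightarrow> computable S env (\<lambda>s. enc_ded (contr (A s)))"
  by (rule comp_call[where \<phi> = "\<lambda>s. (A s, ())", OF _ comp_contr0, of S env, unfolded fst_conv snd_conv])
    (intro comps_Cons comps_Nil, simp_all)

lemma comp_cocontr0: "computable UNIV (\<lambda>s :: 'a form \<times> unit. encode_form (fst s) # []) (\<lambda>s. enc_ded (cocontr (fst s)))"
  apply (rule comp_form_rec[where env = "\<lambda>_. []" and g = "\<lambda>s. enc_ded (cocontr (fst s))" and n = 0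
        and hC = "\<lambda>s. enc_ded (DOr (Fm FF) (Fm FF))"
        and hD = "\<lambda>s. enc_ded (seq (DOr (Fm FF) (Fm FF)) (md (fst s) (fst s) (fst (snd s)) (fst (snd s))))"])
           apply (simp_all only: fst_conv snd_conv cocontr.simps)
           apply ((rule comp_vs comp_intro)+)[7]
    apply (simp_all add: size_simps)
  done

lemma comp_cocontr [comp_intro]: "computable S env (\<lambda>s. encode_form (A s)) \<Longrightarrow> computable S env (\<lambda>s. enc_ded (cocontr (A s)))"
  by (rule comp_call[where \<phi> = "\<lambda>s. (A s, ())", OF _ comp_cocontr0, of S env, unfolded fst_conv snd_conv])
    (intro comps_Cons comps_Nil, simp_all)


lemma comp_mix [comp_intro]: "computable S env (\<lambda>s. encode_form (A s)) \<Longrightarrow> computable S env (\<lambda>s. encode_form (B s)) \<Longrightarrow>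
   computable S env (\<lambda>s. enc_ded (mix (A s) (B s)))"
  unfolding mix_def by (intro comp_intro)

lemma comp_distr [comp_intro]: "computable S env (\<lambda>s. encode_form (A s)) \<Longrightarrow> computable S env (\<lambda>s. encode_form (B s)) \<Longrightarrow>
   computable S env (\<lambda>s. encode_form (C s)) \<Longrightarrow> computable S env (\<lambda>s. enc_ded (distr (A s) (B s) (C s)))"
  unfolding distr_def by (intro comp_intro)

lemma comp_joinO [comp_intro]: "computable S env (\<lambda>s. encode_form (A s)) \<Longrightarrow> computable S env (\<lambda>s. encode_form (B s)) \<Longrightarrow>
   computable S env (\<lambda>s. encode_form (C s)) \<Longrightarrow> computable S env (\<lambda>s. enc_ded (joinO (A s) (B s) (C s)))"
  unfolding joinO_def by (intro comp_intro)

lemma comp_joinA [comp_intro]: "computable S env (\<lambda>s. encode_form (A s)) \<Longrightarrow> computable S env (\<lambda>s. encode_form (B s)) \<Longrightarrow>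
   computable S env (\<lambda>s. encode_form (C s)) \<Longrightarrow> computable S env (\<lambda>s. enc_ded (joinA (A s) (B s) (C s)))"
  unfolding joinA_def by (intro comp_intro)

section \<open>Programs for lists of atoms and for the basic derivations\<close>

lemma data_size_append: "data_size (encode_list e (xs @ ys)) \<le> data_size (encode_list e xs) + data_size (encode_list e ys)"
  by (induction xs) auto

lemma comp_append0: "computable {s. snd s \<in> UNIV} (\<lambda>s. encode_list e (fst s) # [encode_list e (snd s)]) (\<lambda>s. encode_list e (fst s @ snd s))"
  apply (rule comp_list_rec[where env = "\<lambda>p. [encode_list e p]" and g = "\<lambda>s. encode_list e (fst s @ snd s)" and n = 1
        and h = "\<lambda>s. Node (e (fst s)) Null"])
      apply (simp_all only: fst_conv snd_conv append.simps)
      apply ((rule comp_vs comp_intro comp_Node comp_Null)+)[3]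
   apply simp_all
  done

lemma comp_append [comp_intro]: "computable S env (\<lambda>s. encode_list e (A s)) \<Longrightarrow> computable S env (\<lambda>s. encode_list e (B s)) \<Longrightarrow>
    computable S env (\<lambda>s. encode_list e (A s @ B s))"
  by (rule comp_call[where \<phi> = "\<lambda>s. (A s, B s)", OF _ comp_append0, of S env, unfolded fst_conv snd_conv])
    (intro comps_Cons comps_Nil, simp_all)

lemma comp_mem0: "computable {s. snd s \<in> UNIV} (\<lambda>s. encode_list encode_form (fst s) # [encode_form (snd s)]) (\<lambda>s. truth (snd s \<in> set (fst s)))"
  apply (rule comp_list_rec[where env = "\<lambda>p. [encode_form p]" and g = "\<lambda>s. truth (snd s \<in> set (fst s))" and n = 1
        and h = "\<lambda>s. truth True"])
      apply (simp_all only: fst_conv snd_conv list.set insert_iff empty_iff)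
      apply ((rule comp_vs comp_intro)+)[3]
   apply (simp_all add: truth_def)
  done

lemma comp_mem [comp_intro]: "computable S env (\<lambda>s. encode_form (A s)) \<Longrightarrow> computable S env (\<lambda>s. encode_list encode_form (B s)) \<Longrightarrow>
    computable S env (\<lambda>s. truth (A s \<in> set (B s)))"
  by (rule comp_call[where \<phi> = "\<lambda>s. (B s, A s)", OF _ comp_mem0, of S env, unfolded fst_conv snd_conv])
    (intro comps_Cons comps_Nil, simp_all)

lemma comp_afl0: "computable UNIV (\<lambda>s :: 'a form \<times> unit. encode_form (fst s) # []) (\<lambda>s. encode_list encode_form (afl (fst s)))"
  apply (rule comp_form_rec[where env = "\<lambda>_. []" and g = "\<lambda>s. encode_list encode_form (afl (fst s))" and n = 0
        and hD = "\<lambda>s. Null" and hC = "\<lambda>s. Null"])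
           apply (simp_all only: fst_conv snd_conv afl.simps)
           apply ((rule comp_vs comp_intro comp_Null)+)[7]
    apply (auto intro: le_SucI data_size_append)
  done

lemma comp_afl [comp_intro]: "computable S env (\<lambda>s. encode_form (A s)) \<Longrightarrow> computable S env (\<lambda>s. encode_list encode_form (afl (A s)))"
  by (rule comp_call[where \<phi> = "\<lambda>s. (A s, ())", OF _ comp_afl0, of S env, unfolded fst_conv snd_conv])
    (intro comps_Cons comps_Nil, simp_all)

lemma comp_erase0: "computable UNIV (\<lambda>s. encode_form (fst s) # [encode_form (snd s)]) (\<lambda>s. encode_form (erase (snd s) (fst s)))"
  apply (rule comp_form_rec[where env = "\<lambda>p. [encode_form p]" and g = "\<lambda>s. encode_form (erase (snd s) (fst s))" and n = 1
        and hD = "\<lambda>s. encode_form (Disj FF FF)" and hC = "\<lambda>s. encode_form (Conj FF FF)"])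
           apply (simp_all only: fst_conv snd_conv erase.simps)
           apply ((rule comp_vs comp_intro)+)[7]
    apply (simp_all add: size_simps)
  done

lemma comp_erase [comp_intro]: "computable S env (\<lambda>s. encode_form (P s)) \<Longrightarrow> computable S env (\<lambda>s. encode_form (A s)) \<Longrightarrow>
    computable S env (\<lambda>s. encode_form (erase (P s) (A s)))"
  by (rule comp_call[where \<phi> = "\<lambda>s. (A s, P s)", OF _ comp_erase0, of S env, unfolded fst_conv snd_conv])
    (intro comps_Cons comps_Nil, simp_all)

text \<open>A connective adds one recursive result and one weakening; \<open>hD\<close> and
  \<open>hC\<close> contain both weakenings and so bound either branch.\<close>

lemma comp_embed0: "computable UNIV (\<lambda>s. encode_form (fst s) # [encode_form (snd s)]) (\<lambda>s. enc_ded (embed (snd s) (fst s)))"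
  apply (rule comp_form_rec[where env = "\<lambda>p. [encode_form p]" and g = "\<lambda>s. enc_ded (embed (snd s) (fst s))" and n = 1
        and hD = "\<lambda>s. enc_ded (DOr (weak (fst s)) (weak (fst (snd s))))" and hC = "\<lambda>s. enc_ded (DAnd (weak (fst s)) (weak (fst (snd s))))"])
           apply (simp_all only: fst_conv snd_conv embed.simps)
           apply ((rule comp_vs comp_intro)+)[7]
    apply (simp_all add: size_simps)
  done

lemma comp_embed [comp_intro]: "computable S env (\<lambda>s. encode_form (P s)) \<Longrightarrow> computable S env (\<lambda>s. encode_form (A s)) \<Longrightarrow>
    computable S env (\<lambda>s. enc_ded (embed (P s) (A s)))"
  by (rule comp_call[where \<phi> = "\<lambda>s. (A s, P s)", OF _ comp_embed0, of S env, unfolded fst_conv snd_conv])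
    (intro comps_Cons comps_Nil, simp_all)

lemma comp_absorb0: "computable UNIV (\<lambda>s. encode_form (fst s) # [encode_form (snd s)]) (\<lambda>s. enc_ded (absorb (snd s) (fst s)))"
  apply (rule comp_form_rec[where env = "\<lambda>p. [encode_form p]" and g = "\<lambda>s. enc_ded (absorb (snd s) (fst s))" and n = 1
        and hD = "\<lambda>s. enc_ded (seq (distr FF (fst s) (fst (snd s))) (seq (DOr (Fm FF) (Fm FF)) (contr (snd (snd s)))))"
        and hC = "\<lambda>s. enc_ded (seq (mix (Conj FF (fst s)) (Conj FF (fst (snd s)))) (seq (DOr (Fm FF) (Fm FF)) (contr (snd (snd s)))))"])
           apply (simp_all only: fst_conv snd_conv absorb.simps)
           apply ((rule comp_vs comp_intro)+)[7]
    apply (simp_all add: size_simps)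
  done

lemma comp_absorb [comp_intro]: "computable S env (\<lambda>s. encode_form (P s)) \<Longrightarrow> computable S env (\<lambda>s. encode_form (A s)) \<Longrightarrow>
    computable S env (\<lambda>s. enc_ded (absorb (P s) (A s)))"
  by (rule comp_call[where \<phi> = "\<lambda>s. (A s, P s)", OF _ comp_absorb0, of S env, unfolded fst_conv snd_conv])
    (intro comps_Cons comps_Nil, simp_all)

lemma comp_pull_out0: "computable UNIV (\<lambda>s. encode_form (fst s) # [encode_form (snd s)]) (\<lambda>s. enc_ded (pull_out (snd s) (fst s)))"
  apply (rule comp_form_rec[where env = "\<lambda>p. [encode_form p]" and g = "\<lambda>s. enc_ded (pull_out (snd s) (fst s))" and n = 1
        and hD = "\<lambda>s. enc_ded (seq (DOr (Fm FF) (Fm FF)) (joinO (erase (snd (snd s)) (fst s)) (erase (snd (snd s)) (fst (snd s))) (snd (snd s))))"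
        and hC = "\<lambda>s. enc_ded (seq (DAnd (Fm FF) (Fm FF)) (joinA (erase (snd (snd s)) (fst s)) (erase (snd (snd s)) (fst (snd s))) (snd (snd s))))"])
           apply (simp_all only: fst_conv snd_conv pull_out.simps)
           apply ((rule comp_vs comp_intro)+)[7]
    apply (simp_all add: size_simps)
  done

lemma comp_pull_out [comp_intro]: "computable S env (\<lambda>s. encode_form (P s)) \<Longrightarrow> computable S env (\<lambda>s. encode_form (A s)) \<Longrightarrow>
    computable S env (\<lambda>s. enc_ded (pull_out (P s) (A s)))"
  by (rule comp_call[where \<phi> = "\<lambda>s. (A s, P s)", OF _ comp_pull_out0, of S env, unfolded fst_conv snd_conv])
    (intro comps_Cons comps_Nil, simp_all)

lemma comp_inj_disj0: "computable UNIV (\<lambda>s. encode_form (fst s) # [encode_form (snd s)]) (\<lambda>s. enc_ded (inj_disj (snd s) (fst s)))"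
  apply (rule comp_form_rec[where env = "\<lambda>p. [encode_form p]" and g = "\<lambda>s. enc_ded (inj_disj (snd s) (fst s))" and n = 1
        and hD = "\<lambda>s. enc_ded (seq (DOr (weak (fst s)) (weak (fst (snd s)))) (Fm (snd (snd s))))"
        and hC = "\<lambda>s. enc_ded (Fm (snd (snd s)))"])
           apply (simp_all only: fst_conv snd_conv inj_disj.simps)
           apply ((rule comp_vs comp_intro)+)[7]
    apply (simp_all add: size_simps)
  done

lemma comp_inj_disj [comp_intro]: "computable S env (\<lambda>s. encode_form (P s)) \<Longrightarrow> computable S env (\<lambda>s. encode_form (A s)) \<Longrightarrow>
    computable S env (\<lambda>s. enc_ded (inj_disj (P s) (A s)))"
  by (rule comp_call[where \<phi> = "\<lambda>s. (A s, P s)", OF _ comp_inj_disj0, of S env, unfolded fst_conv snd_conv])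
    (intro comps_Cons comps_Nil, simp_all)

lemma comp_disj_list0: "computable {s. snd s \<in> UNIV} (\<lambda>s :: 'a form list \<times> unit. encode_list encode_form (fst s) # []) (\<lambda>s. encode_form (disj_list (fst s)))"
  apply (rule comp_list_rec[where env = "\<lambda>p. []" and g = "\<lambda>s. encode_form (disj_list (fst s))" and n = 0
        and h = "\<lambda>s. encode_form (Disj (fst s) FF)"])
      apply (simp_all only: fst_conv snd_conv disj_list.simps)
      apply ((rule comp_vs comp_intro)+)[3]
   apply (simp_all add: size_simps)
  done

lemma comp_disj_list [comp_intro]: "computable S env (\<lambda>s. encode_list encode_form (A s)) \<Longrightarrow> computable S env (\<lambda>s. encode_form (disj_list (A s)))"
  by (rule comp_call[where \<phi> = "\<lambda>s. (A s, ())", OF _ comp_disj_list0, of S env, unfolded fst_conv snd_conv])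
    (intro comps_Cons comps_Nil, simp_all)

text \<open>The mapped function may depend on the parameters kept in \<open>env\<close>.\<close>

lemma comp_map0:
  assumes f: "computable {s. snd s \<in> S} (\<lambda>s. e (fst s) # env (snd s)) (\<lambda>s. e' (f (snd s) (fst s)))"
    and len: "\<And>p. p \<in> S \<Longrightarrow> length (env p) = n"
  shows "computable {s. snd s \<in> S} (\<lambda>s. encode_list e (fst s) # env (snd s)) (\<lambda>s. encode_list e' (map (f (snd s)) (fst s)))"
proof (rule comp_list_rec[where S = S and env = env and n = n and h = "\<lambda>s. Node (e' (f (snd (snd s)) (fst s))) Null"], simp_all only: fst_conv snd_conv list.map)
  show "computable S env (\<lambda>p. encode_list e' [])" by (rule comp_Nil)
  let ?S = "{s. snd (snd s) \<in> S}"
  have 1: "computables ?S (\<lambda>s. encode_list e' (map (f (snd (snd s))) (fst (snd s))) # e (fst s) # encode_list e (fst (snd s)) # env (snd (snd s)))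
     (\<lambda>s. e (fst s) # env (snd (snd s)))"
    using comps_drop[of ?S "\<lambda>s. encode_list e' (map (f (snd (snd s))) (fst (snd s))) # e (fst s) # encode_list e (fst (snd s)) # env (snd (snd s))" "n + 3" 3] len
    by (intro comps_Cons comp_vs) simp
  have "computable ?S (\<lambda>s. encode_list e' (map (f (snd (snd s))) (fst (snd s))) # e (fst s) # encode_list e (fst (snd s)) # env (snd (snd s)))
     (\<lambda>s. e' (f (snd (snd s)) (fst s)))"
    by (rule comp_call[where \<phi> = "\<lambda>s. (fst s, snd (snd s))", OF _ f, unfolded fst_conv snd_conv, OF 1]) simp
  then show "computable ?S (\<lambda>s. encode_list e' (map (f (snd (snd s))) (fst (snd s))) # e (fst s) # encode_list e (fst (snd s)) # env (snd (snd s)))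
     (\<lambda>s. encode_list e' (f (snd (snd s)) (fst s) # map (f (snd (snd s))) (fst (snd s))))"
    by (intro comp_Cons comp_v0)
  have 2: "computables ?S (\<lambda>s. e (fst s) # encode_list e (fst (snd s)) # env (snd (snd s)))
     (\<lambda>s. e (fst s) # env (snd (snd s)))"
    using comps_drop[of ?S "\<lambda>s. e (fst s) # encode_list e (fst (snd s)) # env (snd (snd s))" "n + 2" 2] len
    by (intro comps_Cons comp_vs) simp
  have "computable ?S (\<lambda>s. e (fst s) # encode_list e (fst (snd s)) # env (snd (snd s)))
     (\<lambda>s. e' (f (snd (snd s)) (fst s)))"
    by (rule comp_call[where \<phi> = "\<lambda>s. (fst s, snd (snd s))", OF _ f, unfolded fst_conv snd_conv, OF 2]) simp
  then show "computable ?S (\<lambda>s. e (fst s) # encode_list e (fst (snd s)) # env (snd (snd s)))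
     (\<lambda>s. Node (e' (f (snd (snd s)) (fst s))) Null)" by (intro comp_Node comp_Null)
qed (use len in simp_all)

text \<open>Recursion with a single call in which all arguments may change, for functions that walk
  along two lists at once or update an argument.\<close>

lemma comp_rec1:
  fixes w :: "'s \<Rightarrow> nat"
  assumes "computable S env (\<lambda>s. truth (nd s))"
    and "computable {s\<in>S. \<not> nd s} env g"
    and "computable {s\<in>S. nd s} (\<lambda>s. g (c s) # env s) g"
    and "computables {s\<in>S. nd s} env (\<lambda>s. env (c s))"
    and "computable {s\<in>S. nd s} env h"
    and "\<And>s. s \<in> S \<Longrightarrow> nd s \<Longrightarrow> c s \<in> S \<and> esz (env (c s)) \<le> esz (env s)"
    and "\<And>s. s \<in> S \<Longrightarrow> length (env s) = n"
    and "\<And>s. s \<in> S \<Longrightarrow> nd s \<Longrightarrow> 1 + w (c s) \<le> w s"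
    and "\<And>s. s \<in> S \<Longrightarrow> 1 \<le> w s \<and> w s \<le> esz (env s)"
    and "\<And>s. s \<in> S \<Longrightarrow> nd s \<Longrightarrow> data_size (g s) \<le> data_size (g (c s)) + data_size (h s)"
  shows "computable S env g"
  by (rule comp_rec_add[where nd = nd and cs = "[c]" and w = w and n = n and H = "\<lambda>s. data_size (h s)"])
    (use assms comp_qb[OF assms(5)] in auto)

lemma data_size_append_zip: "data_size (encode_list (encode_list e) (append_zip xs ys)) \<le>
   data_size (encode_list (encode_list e) xs) + data_size (encode_list (encode_list e) ys)"
proof (induction xs ys rule: append_zip.induct)
  case (3 xs xss ys yss)
  then show ?case using data_size_append[of e xs ys] by simp
qed auto

lemma comp_append_zip0: 
  fixes e :: "'b \<Rightarrow> 'a data"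
  shows "computable UNIV (\<lambda>s. [encode_list (encode_list e) (fst s), encode_list (encode_list e) (snd s)]) 
    (\<lambda>s. encode_list (encode_list e) (append_zip (fst s) (snd s)))"
proof (rule comp_rec1[where nd = "\<lambda>s. \<not> (fst s = [] \<or> snd s = [])" and c = "\<lambda>s. (tl (fst s), tl (snd s))" and n = 2
      and w = "\<lambda>s. data_size (encode_list (encode_list e) (fst s))" and h = "\<lambda>s. encode_list (encode_list e) [hd (fst s) @ hd (snd s)]"], simp_all only: fst_conv snd_conv)
  let ?env = "\<lambda>s. [encode_list (encode_list e) (fst s), encode_list (encode_list e) (snd s)]"
  let ?S = "{s \<in> UNIV. \<not> (fst s = [] \<or> snd s = [])}"
  let ?g = "\<lambda>s. encode_list (encode_list e) (append_zip (tl (fst s)) (tl (snd s)))"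
  have "computable UNIV ?env (\<lambda>s. if fst s = [] then Null else if snd s = [] then Null else Node Null Null)"
    by (intro comp_if comp_isNil[where e = "encode_list e"] comp_vs comp_Null comp_Node)
  then show "computable UNIV ?env (\<lambda>s. truth (\<not> (fst s = [] \<or> snd s = [])))"
    by (rule comp_cong) (simp add: truth_def)
  have "computable {s \<in> UNIV. \<not> \<not> (fst s = [] \<or> snd s = [])} ?env (\<lambda>s. encode_list (encode_list e) (if fst s = [] then snd s else fst s))"
    by (intro comp_ifL comp_isNil[where e = "encode_list e"] comp_vs)
  then show "computable {s \<in> UNIV. \<not> \<not> (fst s = [] \<or> snd s = [])} ?env (\<lambda>s. encode_list (encode_list e) (append_zip (fst s) (snd s)))"
    by (rule comp_cong) (case_tac "fst s", auto)
  have "computable ?S (\<lambda>s. ?g s # ?env s) (\<lambda>s. encode_list (encode_list e) ((hd (fst s) @ hd (snd s)) # append_zip (tl (fst s)) (tl (snd s))))"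
    by (intro comp_Cons comp_append comp_hd[where e = "encode_list e"] comp_vs) auto
  then show "computable ?S (\<lambda>s. ?g s # ?env s) (\<lambda>s. encode_list (encode_list e) (append_zip (fst s) (snd s)))"
    by (rule comp_cong) (auto simp: neq_Nil_conv)
  show "computables ?S ?env (\<lambda>s. [encode_list (encode_list e) (tl (fst s)), encode_list (encode_list e) (tl (snd s))])"
    by (intro comps_Cons comps_Nil comp_tl comp_vs)
  show "computable ?S ?env (\<lambda>s. encode_list (encode_list e) [hd (fst s) @ hd (snd s)])"
    by (intro comp_Cons comp_Nil comp_append comp_hd[where e = "encode_list e"] comp_vs) auto
qed (auto simp: neq_Nil_conv data_size_pos[simplified])

lemma comp_append_zip [comp_intro]: "computable S env (\<lambda>s. encode_list (encode_list e) (A s)) \<Longrightarrow>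
    computable S env (\<lambda>s. encode_list (encode_list e) (B s)) \<Longrightarrow>
    computable S env (\<lambda>s. encode_list (encode_list e) (append_zip (A s) (B s)))"
  by (rule comp_call[where \<phi> = "\<lambda>s. (A s, B s)", OF _ comp_append_zip0, of S env, unfolded fst_conv snd_conv])
    (intro comps_Cons comps_Nil, simp_all)

lemma comp_zip0: 
  fixes e1 :: "'b \<Rightarrow> 'a data" and e2 :: "'c \<Rightarrow> 'a data"
  shows "computable UNIV (\<lambda>s. [encode_list e1 (fst s), encode_list e2 (snd s)]) 
    (\<lambda>s. encode_list (enc_pair e1 e2) (zip (fst s) (snd s)))"
proof (rule comp_rec1[where nd = "\<lambda>s. \<not> (fst s = [] \<or> snd s = [])" and c = "\<lambda>s. (tl (fst s), tl (snd s))" and n = 2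
      and w = "\<lambda>s. data_size (encode_list e1 (fst s))" and h = "\<lambda>s. encode_list (enc_pair e1 e2) [(hd (fst s), hd (snd s))]"], simp_all only: fst_conv snd_conv)
  let ?env = "\<lambda>s. [encode_list e1 (fst s), encode_list e2 (snd s)]"
  let ?S = "{s \<in> UNIV. \<not> (fst s = [] \<or> snd s = [])}"
  let ?g = "\<lambda>s. encode_list (enc_pair e1 e2) (zip (tl (fst s)) (tl (snd s)))"
  have "computable UNIV ?env (\<lambda>s. if fst s = [] then Null else if snd s = [] then Null else Node Null Null)"
    by (intro comp_if comp_isNil[where e = e1] comp_isNil[where e = e2] comp_Null comp_Node) (rule comp_vs)+
  then show "computable UNIV ?env (\<lambda>s. truth (\<not> (fst s = [] \<or> snd s = [])))"
    by (rule comp_cong) (simp add: truth_def)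
  have "computable {s \<in> UNIV. \<not> \<not> (fst s = [] \<or> snd s = [])} ?env (\<lambda>s. encode_list (enc_pair e1 e2) [])"
    by (rule comp_Nil)
  then show "computable {s \<in> UNIV. \<not> \<not> (fst s = [] \<or> snd s = [])} ?env (\<lambda>s. encode_list (enc_pair e1 e2) (zip (fst s) (snd s)))"
    by (rule comp_cong) auto
  have "computable ?S (\<lambda>s. ?g s # ?env s) (\<lambda>s. encode_list (enc_pair e1 e2) ((hd (fst s), hd (snd s)) # zip (tl (fst s)) (tl (snd s))))"
    by (intro comp_Cons comp_pair comp_hd[where e = e1] comp_hd[where e = e2] comp_v0 comp_v1 comp_v2) auto
  then show "computable ?S (\<lambda>s. ?g s # ?env s) (\<lambda>s. encode_list (enc_pair e1 e2) (zip (fst s) (snd s)))"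
    by (rule comp_cong) (auto simp: neq_Nil_conv)
  show "computables ?S ?env (\<lambda>s. [encode_list e1 (tl (fst s)), encode_list e2 (tl (snd s))])"
    by (intro comps_Cons comps_Nil comp_tl comp_v0 comp_v1)
  show "computable ?S ?env (\<lambda>s. encode_list (enc_pair e1 e2) [(hd (fst s), hd (snd s))])"
    by (intro comp_Cons comp_Nil comp_pair comp_hd[where e = e1] comp_hd[where e = e2] comp_v0 comp_v1) auto
qed (auto simp: neq_Nil_conv data_size_pos[simplified])

lemma comp_zip [comp_intro]: "computable S env (\<lambda>s. encode_list e1 (A s)) \<Longrightarrow>
    computable S env (\<lambda>s. encode_list e2 (B s)) \<Longrightarrow>
    computable S env (\<lambda>s. encode_list (enc_pair e1 e2) (zip (A s) (B s)))"
  by (rule comp_call[where \<phi> = "\<lambda>s. (A s, B s)", OF _ comp_zip0, of S env, unfolded fst_conv snd_conv])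
    (intro comps_Cons comps_Nil, simp_all)

end

fun enc_slc :: "'a slc \<Rightarrow> 'a data" where
  "enc_slc (Slc a b c d e f) = Node (encode_form a) (Node (encode_form b) (Node (encode_form c)
     (Node (encode_list encode_form d) (Node (encode_list encode_form e) (encode_list (enc_pair encode_form enc_ded) f)))))"

context sks
begin

lemma comp_map_single [comp_intro]:
  assumes "computable S env (\<lambda>s. e1 (x s))" "computable S env (\<lambda>s. encode_list e2 (ys s))"
  shows "computable S env (\<lambda>s. encode_list (encode_list (enc_pair e1 e2)) (map (\<lambda>y. [(x s, y)]) (ys s)))"
proof -
  have "computable {s. snd s \<in> UNIV} (\<lambda>s. e2 (fst s) # [e1 (snd s)]) (\<lambda>s. encode_list (enc_pair e1 e2) [(snd s, fst s)])"
    by (intro comp_Cons comp_Nil comp_pair comp_v0 comp_v1)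
  note m = comp_map0[where env = "\<lambda>p. [e1 p]" and f = "\<lambda>x y. [(x, y)]" and n = 1, OF this]
  show ?thesis
    by (rule comp_call[where \<phi> = "\<lambda>s. (ys s, x s)", OF _ m, of S env, unfolded fst_conv snd_conv])
      (intro comps_Cons comps_Nil assms, simp_all)
qed

lemma comp_conv0: "computable {s. snd s \<in> UNIV} (\<lambda>s. encode_list e1 (fst s) # [encode_list e2 (snd s)])
    (\<lambda>s. encode_list (encode_list (enc_pair e1 e2)) (conv (fst s) (snd s)))"
  apply (rule comp_list_rec[where env = "\<lambda>p. [encode_list e2 p]" and n = 1
     and g = "\<lambda>s. encode_list (encode_list (enc_pair e1 e2)) (conv (fst s) (snd s))"
     and h = "\<lambda>s. Node (Node Null Null) (encode_list (encode_list (enc_pair e1 e2)) (map (\<lambda>y. [(fst s, y)]) (snd (snd s))))"])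
      apply (simp_all only: fst_conv snd_conv conv.simps)
      apply ((rule comp_vs comp_append_zip comp_map_single comp_intro comp_Null comp_Node)+)[3]
   apply (rule order_trans[OF data_size_append_zip])
   apply simp_all
  done

lemma comp_conv [comp_intro]: "computable S env (\<lambda>s. encode_list e1 (A s)) \<Longrightarrow>
   computable S env (\<lambda>s. encode_list e2 (B s)) \<Longrightarrow>
   computable S env (\<lambda>s. encode_list (encode_list (enc_pair e1 e2)) (conv (A s) (B s)))"
  by (rule comp_call[where \<phi> = "\<lambda>s. (A s, B s)", OF _ comp_conv0, of S env, unfolded fst_conv snd_conv])
    (intro comps_Cons comps_Nil, simp_all)

section \<open>Programs for the pieces of the derivations between thresholds\<close>

lemma comp_raise_term0: "computable UNIV (\<lambda>s. [encode_form (fst s), enc_ded (fst (snd s)), encode_form (fst (snd (snd s))),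
     encode_form (fst (snd (snd (snd s)))), encode_form (fst (snd (snd (snd (snd s))))), encode_form (snd (snd (snd (snd (snd s)))))])
   (\<lambda>s. enc_ded (raise_term (fst s) (fst (snd s)) (fst (snd (snd s))) (fst (snd (snd (snd s))))
       (fst (snd (snd (snd (snd s))))) (snd (snd (snd (snd (snd s)))))))"
  unfolding raise_term_def by (rule comp_vs comp_intro)+

lemma comp_raise_term [comp_intro]: "computable S env (\<lambda>s. encode_form (G s)) \<Longrightarrow>
   computable S env (\<lambda>s. enc_ded (d s)) \<Longrightarrow>
   computable S env (\<lambda>s. encode_form (X s)) \<Longrightarrow>
   computable S env (\<lambda>s. encode_form (Y s)) \<Longrightarrow>
   computable S env (\<lambda>s. encode_form (A s)) \<Longrightarrow>
   computable S env (\<lambda>s. encode_form (H s)) \<Longrightarrow>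
   computable S env (\<lambda>s. enc_ded (raise_term (G s) (d s) (X s) (Y s) (A s) (H s)))"
  by (rule comp_call[where \<phi> = "\<lambda>s. (G s, d s, X s, Y s, A s, H s)", OF _ comp_raise_term0, of S env, unfolded fst_conv snd_conv])
    (intro comps_Cons comps_Nil, simp_all)

lemma comp_map_fst0: "computable {s. snd s \<in> UNIV} (\<lambda>s :: _ \<times> unit. encode_list (enc_pair e1 e2) (fst s) # []) (\<lambda>s. encode_list e1 (map fst (fst s)))"
  by (rule comp_map0[where f = "\<lambda>p. fst" and env = "\<lambda>_. []" and n = 0 and e = "enc_pair e1 e2"]) (auto intro: comp_fst[where ?e1.0 = e1 and ?e2.0 = e2] comp_v0)

lemma comp_map_fst: "computable S env (\<lambda>s. encode_list (enc_pair e1 e2) (A s)) \<Longrightarrow> computable S env (\<lambda>s. encode_list e1 (map fst (A s)))"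
  by (rule comp_call[where \<phi> = "\<lambda>s. (A s, ())", OF _ comp_map_fst0, of S env, unfolded fst_conv snd_conv])
    (intro comps_Cons comps_Nil, simp_all)

lemmas comp_map_fst_ded = comp_map_fst[where ?e1.0 = encode_form and ?e2.0 = enc_ded]
lemmas comp_fst_ded = comp_fst[where ?e1.0 = encode_form and ?e2.0 = enc_ded]
lemmas comp_snd_ded = comp_snd[where ?e1.0 = encode_form and ?e2.0 = enc_ded]

text \<open>The nonempty case of \<open>raise_disj\<close> with both subderivations replaced by
  \<open>Fm FF\<close>: what one disjunct adds.\<close>

definition raise_disj_step :: "'a form \<Rightarrow> 'a form \<Rightarrow> 'a form \<Rightarrow> 'a form \<Rightarrow> 'a form \<Rightarrow> 'a ded" where
  "raise_disj_step P G H A B = seq (DAnd (cocontr P) (Fm (Disj A B)))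
     (seq (distr P A B) (seq (DOr (Fm FF) (Fm FF)) (contr (Disj H G))))"

lemma raise_disj_step_size: "data_size (enc_ded (raise_disj P G H (x # xs))) \<le>
   data_size (enc_ded (raise_disj P G H xs)) + data_size (enc_ded (snd x)) + data_size (enc_ded (raise_disj_step P G H (fst x) (disj_list (map fst xs))))"
  by (simp add: raise_disj_step_def size_simps)

lemma comp_raise_disj_step0: "computable UNIV (\<lambda>s. [encode_form (fst s), encode_form (fst (snd s)), encode_form (fst (snd (snd s))),
     encode_form (fst (snd (snd (snd s)))), encode_form (snd (snd (snd (snd s))))])
   (\<lambda>s. enc_ded (raise_disj_step (fst s) (fst (snd s)) (fst (snd (snd s))) (fst (snd (snd (snd s)))) (snd (snd (snd (snd s))))))"
  unfolding raise_disj_step_def by (rule comp_vs comp_intro)+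

lemma comp_raise_disj_step [comp_intro]: "computable S env (\<lambda>s. encode_form (P s)) \<Longrightarrow>
   computable S env (\<lambda>s. encode_form (G s)) \<Longrightarrow>
   computable S env (\<lambda>s. encode_form (H s)) \<Longrightarrow>
   computable S env (\<lambda>s. encode_form (A s)) \<Longrightarrow>
   computable S env (\<lambda>s. encode_form (B s)) \<Longrightarrow>
   computable S env (\<lambda>s. enc_ded (raise_disj_step (P s) (G s) (H s) (A s) (B s)))"
  by (rule comp_call[where \<phi> = "\<lambda>s. (P s, G s, H s, A s, B s)", OF _ comp_raise_disj_step0, of S env, unfolded fst_conv snd_conv])
    (intro comps_Cons comps_Nil, simp_all)

lemma comp_raise_disj0: "computable {s. snd s \<in> UNIV} (\<lambda>s. encode_list (enc_pair encode_form enc_ded) (fst s) #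
     [encode_form (fst (snd s)), encode_form (fst (snd (snd s))), encode_form (snd (snd (snd s)))])
    (\<lambda>s. enc_ded (raise_disj (fst (snd s)) (fst (snd (snd s))) (snd (snd (snd s))) (fst s)))"
  apply (rule comp_list_rec[where env = "\<lambda>p. [encode_form (fst p), encode_form (fst (snd p)), encode_form (snd (snd p))]" and n = 3
     and g = "\<lambda>s. enc_ded (raise_disj (fst (snd s)) (fst (snd (snd s))) (snd (snd (snd s))) (fst s))"
     and h = "\<lambda>s. Node (enc_ded (snd (fst s))) (enc_ded (raise_disj_step (fst (snd (snd s))) (fst (snd (snd (snd s)))) (snd (snd (snd (snd s)))) (fst (fst s)) (disj_list (map fst (fst (snd s))))))"])
      apply (simp_all only: fst_conv snd_conv raise_disj.simps(1))
      apply ((rule comp_vs comp_intro comp_Null comp_Node)+)[1]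
     apply (simp_all only: fst_conv snd_conv raise_disj.simps)
     apply ((rule comp_vs comp_intro comp_map_fst_ded comp_snd_ded comp_fst_ded comp_Node)+)[2]
   apply (simp_all only: raise_disj.simps(2)[symmetric])
   apply (rule order_trans[OF raise_disj_step_size])
   apply simp_all
  done

lemma comp_raise_disj [comp_intro]: "computable S env (\<lambda>s. encode_form (P s)) \<Longrightarrow>
   computable S env (\<lambda>s. encode_form (G s)) \<Longrightarrow>
   computable S env (\<lambda>s. encode_form (H s)) \<Longrightarrow>
   computable S env (\<lambda>s. encode_list (enc_pair encode_form enc_ded) (A s)) \<Longrightarrow>
   computable S env (\<lambda>s. enc_ded (raise_disj (P s) (G s) (H s) (A s)))"
  by (rule comp_call[where \<phi> = "\<lambda>s. (A s, P s, G s, H s)", OF _ comp_raise_disj0, of S env, unfolded fst_conv snd_conv])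
    (intro comps_Cons comps_Nil, simp_all)

lemma comp_succs [comp_intro]: "computable S env (\<lambda>s. encode_list encode_form (A s)) \<Longrightarrow> computable S env (\<lambda>s. encode_list encode_form (succs (A s)))"
  unfolding succs_def by (intro comp_append comp_tl comp_Cons comp_Nil comp_FF)

lemma comp_triples [comp_intro]: "computable S env (\<lambda>s. encode_list encode_form (A s)) \<Longrightarrow> computable S env (\<lambda>s. encode_list enc_ded (B s)) \<Longrightarrow>
   computable S env (\<lambda>s. encode_list (enc_pair encode_form (enc_pair encode_form enc_ded)) (triples (A s) (B s)))"
  unfolding triples_def by (intro comp_zip comp_succs)

abbreviation enc_item where
  "enc_item \<equiv> enc_pair (enc_pair encode_form (enc_pair encode_form enc_ded)) (enc_pair encode_form (enc_pair encode_form enc_ded))"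

lemma comp_item:
  assumes "computable S env (\<lambda>s. enc_item (q s))"
  shows "computable S env (\<lambda>s. encode_form (fst (fst (q s))))" "computable S env (\<lambda>s. encode_form (fst (snd (fst (q s)))))"
    "computable S env (\<lambda>s. enc_ded (snd (snd (fst (q s)))))" 
    "computable S env (\<lambda>s. encode_form (fst (snd (q s))))" "computable S env (\<lambda>s. encode_form (fst (snd (snd (q s)))))"
    "computable S env (\<lambda>s. enc_ded (snd (snd (snd (q s)))))"
proof -
  note 1 = comp_fst[OF assms] and 2 = comp_snd[OF assms]
  show "computable S env (\<lambda>s. encode_form (fst (fst (q s))))" by (rule comp_fst[OF 1])
  show "computable S env (\<lambda>s. encode_form (fst (snd (q s))))" by (rule comp_fst[OF 2])
  show "computable S env (\<lambda>s. encode_form (fst (snd (fst (q s)))))" by (rule comp_fst[OF comp_snd[OF 1]])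
  show "computable S env (\<lambda>s. encode_form (fst (snd (snd (q s)))))" by (rule comp_fst[OF comp_snd[OF 2]])
  show "computable S env (\<lambda>s. enc_ded (snd (snd (fst (q s)))))" by (rule comp_snd[OF comp_snd[OF 1]])
  show "computable S env (\<lambda>s. enc_ded (snd (snd (snd (q s)))))" by (rule comp_snd[OF comp_snd[OF 2]])
qed

lemma comp_raise_pair0: "computable UNIV (\<lambda>s. [enc_item (fst s), encode_form (fst (snd s)), encode_form (fst (snd (snd s))), truth (fst (snd (snd (snd s)))),
     encode_form (snd (snd (snd (snd s))))])
   (\<lambda>s. enc_pair encode_form enc_ded (raise_pair (fst (snd s)) (fst (snd (snd s))) (fst (snd (snd (snd s)))) (snd (snd (snd (snd s)))) (fst s)))"
  unfolding raise_pair_def by (rule comp_vs comp_intro comp_item)+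

lemma comp_raise_pair [comp_intro]: "computable S env (\<lambda>s. enc_item (q s)) \<Longrightarrow>
   computable S env (\<lambda>s. encode_form (P s)) \<Longrightarrow>
   computable S env (\<lambda>s. encode_form (G s)) \<Longrightarrow>
   computable S env (\<lambda>s. truth (b s)) \<Longrightarrow>
   computable S env (\<lambda>s. encode_form (H s)) \<Longrightarrow>
   computable S env (\<lambda>s. enc_pair encode_form enc_ded (raise_pair (P s) (G s) (b s) (H s) (q s)))"
  by (rule comp_call[where \<phi> = "\<lambda>s. (q s, P s, G s, b s, H s)", OF _ comp_raise_pair0, of S env, unfolded fst_conv snd_conv])
    (intro comps_Cons comps_Nil, simp_all)

lemma comp_rev0: "computable {s. snd s \<in> UNIV} (\<lambda>s :: _ \<times> unit. encode_list e (fst s) # []) (\<lambda>s. encode_list e (rev (fst s)))"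
  apply (rule comp_list_rec[where env = "\<lambda>p. []" and g = "\<lambda>s. encode_list e (rev (fst s))" and n = 0
        and h = "\<lambda>s. encode_list e [fst s]"])
      apply (simp_all only: fst_conv snd_conv rev.simps)
      apply ((rule comp_vs comp_intro)+)[3]
   apply (rule data_size_append)
  apply simp
  done

lemma comp_rev [comp_intro]: "computable S env (\<lambda>s. encode_list e (A s)) \<Longrightarrow> computable S env (\<lambda>s. encode_list e (rev (A s)))"
  by (rule comp_call[where \<phi> = "\<lambda>s. (A s, ())", OF _ comp_rev0, of S env, unfolded fst_conv snd_conv])
    (intro comps_Cons comps_Nil, simp_all)

lemma comp_pick0: 
  fixes e2 :: "'c \<Rightarrow> 'a data"
  shows "computable UNIV (\<lambda>s. [encode_list enc_ded (fst s), encode_list e2 (snd s)]) (\<lambda>s. enc_ded (pick (fst s) (snd s)))"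
proof (rule comp_rec1[where nd = "\<lambda>s. \<not> (fst s = [] \<or> snd s = [])" and c = "\<lambda>s. (tl (fst s), tl (snd s))" and n = 2
      and w = "\<lambda>s. data_size (encode_list enc_ded (fst s))" and h = "\<lambda>s. Null"], simp_all only: fst_conv snd_conv)
  let ?env = "\<lambda>s. [encode_list enc_ded (fst s), encode_list e2 (snd s)]"
  let ?S = "{s \<in> UNIV. \<not> (fst s = [] \<or> snd s = [])}"
  let ?g = "\<lambda>s. enc_ded (pick (tl (fst s)) (tl (snd s)))"
  have "computable UNIV ?env (\<lambda>s. if fst s = [] then Null else if snd s = [] then Null else Node Null Null)"
    by (intro comp_if comp_isNil[where e = enc_ded] comp_isNil[where e = e2] comp_Null comp_Node) (rule comp_vs)+
  then show "computable UNIV ?env (\<lambda>s. truth (\<not> (fst s = [] \<or> snd s = [])))"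
    by (rule comp_cong) (simp add: truth_def)
  have "computable {s \<in> UNIV. \<not> \<not> (fst s = [] \<or> snd s = [])} ?env (\<lambda>s. enc_ded (if fst s = [] then Fm FF else hd (fst s)))"
    by (intro comp_ifD comp_Fm comp_FF comp_isNil[where e = enc_ded] comp_hd[where e = enc_ded] comp_v0) auto
  then show "computable {s \<in> UNIV. \<not> \<not> (fst s = [] \<or> snd s = [])} ?env (\<lambda>s. enc_ded (pick (fst s) (snd s)))"
    by (rule comp_cong) (case_tac "fst s"; case_tac "snd s"; auto)
  have "computable ?S (\<lambda>s. ?g s # ?env s) ?g" by (rule comp_v0)
  then show "computable ?S (\<lambda>s. ?g s # ?env s) (\<lambda>s. enc_ded (pick (fst s) (snd s)))"
    by (rule comp_cong) (auto simp: neq_Nil_conv)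
  show "computables ?S ?env (\<lambda>s. [encode_list enc_ded (tl (fst s)), encode_list e2 (tl (snd s))])"
    by (intro comps_Cons comps_Nil comp_tl comp_v0 comp_v1)
  show "computable ?S ?env (\<lambda>s. Null)" by (rule comp_Null)
qed (auto simp: neq_Nil_conv data_size_pos[simplified])

lemma comp_pick [comp_intro]: "computable S env (\<lambda>s. encode_list enc_ded (A s)) \<Longrightarrow>
   computable S env (\<lambda>s. encode_list encode_form (B s)) \<Longrightarrow>
   computable S env (\<lambda>s. enc_ded (pick (A s) (B s)))"
  by (rule comp_call[where \<phi> = "\<lambda>s. (A s, B s)", OF _ comp_pick0[where ?e2.0 = encode_form], of S env, unfolded fst_conv snd_conv])
    (intro comps_Cons comps_Nil, simp_all)

lemma comp_lookup0: "computable {s. snd s \<in> UNIV} (\<lambda>s. encode_list (enc_pair encode_form enc_ded) (fst s) # [encode_form (snd s)])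
    (\<lambda>s. enc_ded (lookup (snd s) (fst s)))"
  apply (rule comp_list_rec[where env = "\<lambda>p. [encode_form p]" and n = 1
     and g = "\<lambda>s. enc_ded (lookup (snd s) (fst s))"
     and h = "\<lambda>s. enc_ded (snd (fst s))"])
      apply (simp_all only: fst_conv snd_conv lookup.simps)
      apply ((rule comp_vs comp_intro)+)[1]
     apply ((rule comp_vs comp_intro comp_snd_ded comp_fst_ded)+)[2]
   apply simp_all
  done

lemma comp_lookup [comp_intro]: "computable S env (\<lambda>s. encode_form (P s)) \<Longrightarrow>
   computable S env (\<lambda>s. encode_list (enc_pair encode_form enc_ded) (A s)) \<Longrightarrow>
   computable S env (\<lambda>s. enc_ded (lookup (P s) (A s)))"
  by (rule comp_call[where \<phi> = "\<lambda>s. (A s, P s)", OF _ comp_lookup0, of S env, unfolded fst_conv snd_conv])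
    (intro comps_Cons comps_Nil, simp_all)

lemma comp_ins0: "computable UNIV (\<lambda>s. encode_form (fst s) # [encode_form (snd s)]) (\<lambda>s. encode_form (ins (snd s) (fst s)))"
  apply (rule comp_form_rec[where env = "\<lambda>p. [encode_form p]" and g = "\<lambda>s. encode_form (ins (snd s) (fst s))" and n = 1
        and hD = "\<lambda>s. encode_form (Conj (snd (snd s)) (Disj (fst s) (fst (snd s))))" and hC = "\<lambda>s. encode_form (Conj FF (fst s))"])
           apply (simp_all only: fst_conv snd_conv ins.simps)
           apply ((rule comp_vs comp_intro)+)[7]
    apply (simp_all add: size_simps)
  done

lemma comp_ins [comp_intro]: "computable S env (\<lambda>s. encode_form (P s)) \<Longrightarrow>
   computable S env (\<lambda>s. encode_form (A s)) \<Longrightarrow>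
   computable S env (\<lambda>s. encode_form (ins (P s) (A s)))"
  by (rule comp_call[where \<phi> = "\<lambda>s. (A s, P s)", OF _ comp_ins0, of S env, unfolded fst_conv snd_conv])
    (intro comps_Cons comps_Nil, simp_all)

lemma data_size_ins: "data_size (encode_form (ins P A)) \<le> data_size (encode_form A) + data_size (encode_form (Conj P FF))"
  by (induction A) (auto simp: data_size_tag)

lemma comp_atree0: "computable {s. snd s \<in> UNIV} (\<lambda>s :: _ \<times> unit. encode_list encode_form (fst s) # []) (\<lambda>s. encode_form (atree (fst s)))"
  apply (rule comp_list_rec[where env = "\<lambda>p. []" and g = "\<lambda>s. encode_form (atree (fst s))" and n = 0
        and h = "\<lambda>s. encode_form (Conj (fst s) FF)"])
      apply (simp_all only: fst_conv snd_conv atree_def foldr.simps id_apply o_apply)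
      apply ((rule comp_vs comp_intro)+)[3]
   apply (rule data_size_ins)
  apply simp
  done

lemma comp_atree [comp_intro]: "computable S env (\<lambda>s. encode_list encode_form (A s)) \<Longrightarrow> computable S env (\<lambda>s. encode_form (atree (A s)))"
  by (rule comp_call[where \<phi> = "\<lambda>s. (A s, ())", OF _ comp_atree0, of S env, unfolded fst_conv snd_conv])
    (intro comps_Cons comps_Nil, simp_all)

lemma comp_ors0: "computable {s. snd s \<in> UNIV} (\<lambda>s :: _ \<times> unit. encode_list encode_form (fst s) # []) (\<lambda>s. encode_list encode_form (ors (fst s)))"
  apply (rule comp_list_rec[where env = "\<lambda>p. []" and g = "\<lambda>s. encode_list encode_form (ors (fst s))" and n = 0
        and h = "\<lambda>s. encode_list encode_form [fst s]"])
      apply (simp_all only: fst_conv snd_conv ors.simps)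
      apply ((rule comp_vs comp_intro)+)[3]
   apply simp_all
  done

lemma comp_ors [comp_intro]: "computable S env (\<lambda>s. encode_list encode_form (A s)) \<Longrightarrow> computable S env (\<lambda>s. encode_list encode_form (ors (A s)))"
  by (rule comp_call[where \<phi> = "\<lambda>s. (A s, ())", OF _ comp_ors0, of S env, unfolded fst_conv snd_conv])
    (intro comps_Cons comps_Nil, simp_all)

lemmas comp_fst_step = comp_fst[where ?e1.0 = encode_rule and ?e2.0 = encode_form]
lemmas comp_snd_step = comp_snd[where ?e1.0 = encode_rule and ?e2.0 = encode_form]

lemma comp_concl0: "computable {s. snd s \<in> UNIV} (\<lambda>s :: _ \<times> unit. encode_list (enc_pair encode_rule encode_form) (fst s) # []) (\<lambda>s. encode_form (concl (fst s)))"
  apply (rule comp_list_rec[where env = "\<lambda>p. []" and g = "\<lambda>s. encode_form (concl (fst s))" and n = 0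
        and h = "\<lambda>s. encode_form (snd (fst s))"])
      apply (simp_all only: fst_conv snd_conv concl.simps)
      apply ((rule comp_vs comp_intro comp_isNil[where e = "enc_pair encode_rule encode_form"] comp_snd_step)+)[3]
   apply simp_all
  done

lemma comp_concl [comp_intro]: "computable S env (\<lambda>s. encode_list (enc_pair encode_rule encode_form) (A s)) \<Longrightarrow> computable S env (\<lambda>s. encode_form (concl (A s)))"
  by (rule comp_call[where \<phi> = "\<lambda>s. (A s, ())", OF _ comp_concl0, of S env, unfolded fst_conv snd_conv])
    (intro comps_Cons comps_Nil, simp_all)

lemma comp_all_atoms0: "computable {s. snd s \<in> UNIV} (\<lambda>s :: _ \<times> unit. encode_list (enc_pair encode_rule encode_form) (fst s) # []) (\<lambda>s. encode_list encode_form (all_atoms (fst s)))"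
  apply (rule comp_list_rec[where env = "\<lambda>p. []" and g = "\<lambda>s. encode_list encode_form (all_atoms (fst s))" and n = 0
        and h = "\<lambda>s. encode_list encode_form (afl (snd (fst s)))"])
      apply (simp_all only: fst_conv snd_conv all_atoms.simps)
      apply ((rule comp_vs comp_intro comp_snd_step)+)[3]
   apply (rule order_trans[OF data_size_append], simp)
  apply simp
  done

lemma comp_all_atoms [comp_intro]: "computable S env (\<lambda>s. encode_list (enc_pair encode_rule encode_form) (A s)) \<Longrightarrow>
   computable S env (\<lambda>s. encode_list encode_form (all_atoms (A s)))"
  by (rule comp_call[where \<phi> = "\<lambda>s. (A s, ())", OF _ comp_all_atoms0, of S env, unfolded fst_conv snd_conv])
    (intro comps_Cons comps_Nil, simp_all)


section \<open>Programs for the parts of a slice\<close>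

lemma comp_slc_sel [comp_intro]:
  assumes "computable S env (\<lambda>s. enc_slc (p s))"
  shows "computable S env (\<lambda>s. encode_form (th (p s)))" "computable S env (\<lambda>s. encode_form (th2 (p s)))"
    "computable S env (\<lambda>s. encode_form (al (p s)))" "computable S env (\<lambda>s. encode_list encode_form (ls (p s)))"
    "computable S env (\<lambda>s. encode_list encode_form (ms (p s)))"
    "computable S env (\<lambda>s. encode_list (enc_pair encode_form enc_ded) (cts (p s)))"
proof -
  have e: "enc_slc p = Node (encode_form (th p)) (Node (encode_form (th2 p)) (Node (encode_form (al p))
     (Node (encode_list encode_form (ls p)) (Node (encode_list encode_form (ms p)) (encode_list (enc_pair encode_form enc_ded) (cts p))))))" for p :: "'a slc"
    by (cases p) simp
  note a = assms[unfolded e]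
  note 1 = comp_Snd[OF a, simplified] note 2 = comp_Snd[OF 1, simplified] note 3 = comp_Snd[OF 2, simplified]
  note 4 = comp_Snd[OF 3, simplified] note 5 = comp_Snd[OF 4, simplified]
  show "computable S env (\<lambda>s. encode_form (th (p s)))" using comp_Fst[OF a] by simp
  show "computable S env (\<lambda>s. encode_form (th2 (p s)))" using comp_Fst[OF 1] by simp
  show "computable S env (\<lambda>s. encode_form (al (p s)))" using comp_Fst[OF 2] by simp
  show "computable S env (\<lambda>s. encode_list encode_form (ls (p s)))" using comp_Fst[OF 3] by simp
  show "computable S env (\<lambda>s. encode_list encode_form (ms (p s)))" using comp_Fst[OF 4] by simp
  show "computable S env (\<lambda>s. encode_list (enc_pair encode_form enc_ded) (cts (p s)))" using 5 by simp
qed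

lemma comp_Slc [comp_intro]:
  "computable S env (\<lambda>s. encode_form (a s)) \<Longrightarrow> computable S env (\<lambda>s. encode_form (b s)) \<Longrightarrow>
   computable S env (\<lambda>s. encode_form (c s)) \<Longrightarrow> computable S env (\<lambda>s. encode_list encode_form (d s)) \<Longrightarrow>
   computable S env (\<lambda>s. encode_list encode_form (e s)) \<Longrightarrow> computable S env (\<lambda>s. encode_list (enc_pair encode_form enc_ded) (f s)) \<Longrightarrow>
   computable S env (\<lambda>s. enc_slc (Slc (a s) (b s) (c s) (d s) (e s) (f s)))"
  unfolding enc_slc.simps by (intro comp_Node)

lemma comp_eqR [comp_intro]: "computable S env (\<lambda>s. encode_rule (A s)) \<Longrightarrow> computable S env (\<lambda>s. encode_rule (B s)) \<Longrightarrow>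
   computable S env (\<lambda>s. truth (A s = B s))"
  by (rule comp_cong[OF comp_Eq]) (assumption, assumption, simp add: encode_rule_inject)

lemma comp_RR [comp_intro]: "computable S env (\<lambda>s. enc_slc (p s)) \<Longrightarrow> computable S env (\<lambda>s. encode_form (RR (p s)))"
  unfolding RR_def by (intro comp_Disj comp_slc_sel)

lemma comp_discard0: "computable UNIV (\<lambda>s. [enc_slc (fst s), encode_form (fst (snd s)), encode_form (snd (snd s))])
   (\<lambda>s. enc_ded (discard (fst s) (fst (snd s)) (snd (snd s))))"
  unfolding discard_def by (rule comp_vs comp_intro)+

lemma comp_discard [comp_intro]: "computable S env (\<lambda>s. enc_slc (p s)) \<Longrightarrow>
   computable S env (\<lambda>s. encode_form (A s)) \<Longrightarrow>
   computable S env (\<lambda>s. encode_form (X s)) \<Longrightarrow>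
   computable S env (\<lambda>s. enc_ded (discard (p s) (A s) (X s)))"
  by (rule comp_call[where \<phi> = "\<lambda>s. (p s, A s, X s)", OF _ comp_discard0, of S env, unfolded fst_conv snd_conv])
    (intro comps_Cons comps_Nil, simp_all)

lemma comp_cutd [comp_intro]: "computable S env (\<lambda>s. enc_slc (p s)) \<Longrightarrow> computable S env (\<lambda>s. encode_form (A s)) \<Longrightarrow>
   computable S env (\<lambda>s. enc_ded (cutd (p s) (A s)))"
  unfolding cutd_def by (intro comp_lookup comp_slc_sel)

lemma comp_tau0: "computable UNIV (\<lambda>s. [enc_slc (fst s), encode_form (snd s)]) (\<lambda>s. encode_form (tau (fst s) (snd s)))"
  unfolding tau_def by (rule comp_vs comp_intro)+

lemma comp_tau [comp_intro]: "computable S env (\<lambda>s. enc_slc (p s)) \<Longrightarrow>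
   computable S env (\<lambda>s. encode_form (A s)) \<Longrightarrow>
   computable S env (\<lambda>s. encode_form (tau (p s) (A s)))"
  by (rule comp_call[where \<phi> = "\<lambda>s. (p s, A s)", OF _ comp_tau0, of S env, unfolded fst_conv snd_conv])
    (intro comps_Cons comps_Nil, simp_all)

lemma comp_tr0: "computable UNIV (\<lambda>s. encode_form (fst s) # [enc_slc (snd s)]) (\<lambda>s. encode_form (tr (snd s) (fst s)))"
  apply (rule comp_form_rec[where env = "\<lambda>p. [enc_slc p]" and g = "\<lambda>s. encode_form (tr (snd s) (fst s))" and n = 1
        and hD = "\<lambda>s. encode_form (Disj FF FF)" and hC = "\<lambda>s. encode_form (Conj FF FF)"])
           apply (simp_all only: fst_conv snd_conv tr.simps)
           apply ((rule comp_vs comp_intro)+)[7]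
    apply (simp_all add: size_simps)
  done

lemma comp_tr [comp_intro]: "computable S env (\<lambda>s. enc_slc (p s)) \<Longrightarrow>
   computable S env (\<lambda>s. encode_form (A s)) \<Longrightarrow>
   computable S env (\<lambda>s. encode_form (tr (p s) (A s)))"
  by (rule comp_call[where \<phi> = "\<lambda>s. (A s, p s)", OF _ comp_tr0, of S env, unfolded fst_conv snd_conv])
    (intro comps_Cons comps_Nil, simp_all)

lemma comp_idn0: "computable UNIV (\<lambda>s. [enc_slc (fst s), encode_form (snd s)]) (\<lambda>s. enc_ded (idn (fst s) (snd s)))"
  unfolding idn_def by (rule comp_vs comp_intro)+

lemma comp_idn [comp_intro]: "computable S env (\<lambda>s. enc_slc (p s)) \<Longrightarrow>
   computable S env (\<lambda>s. encode_form (A s)) \<Longrightarrow>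
   computable S env (\<lambda>s. enc_ded (idn (p s) (A s)))"
  by (rule comp_call[where \<phi> = "\<lambda>s. (p s, A s)", OF _ comp_idn0, of S env, unfolded fst_conv snd_conv])
    (intro comps_Cons comps_Nil, simp_all)

lemma comp_cutx0: "computable UNIV (\<lambda>s. [enc_slc (fst s), encode_form (snd s)]) (\<lambda>s. enc_ded (cutx (fst s) (snd s)))"
  unfolding cutx_def by (rule comp_vs comp_intro)+

lemma comp_cutx [comp_intro]: "computable S env (\<lambda>s. enc_slc (p s)) \<Longrightarrow>
   computable S env (\<lambda>s. encode_form (A s)) \<Longrightarrow>
   computable S env (\<lambda>s. enc_ded (cutx (p s) (A s)))"
  by (rule comp_call[where \<phi> = "\<lambda>s. (p s, A s)", OF _ comp_cutx0, of S env, unfolded fst_conv snd_conv])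
    (intro comps_Cons comps_Nil, simp_all)

lemma comp_negd0: "computable UNIV (\<lambda>s. [enc_slc (fst s), encode_form (snd s)]) (\<lambda>s. enc_ded (negd (fst s) (snd s)))"
  unfolding negd_def by (rule comp_vs comp_intro)+

lemma comp_negd [comp_intro]: "computable S env (\<lambda>s. enc_slc (p s)) \<Longrightarrow>
   computable S env (\<lambda>s. encode_form (A s)) \<Longrightarrow>
   computable S env (\<lambda>s. enc_ded (negd (p s) (A s)))"
  by (rule comp_call[where \<phi> = "\<lambda>s. (p s, A s)", OF _ comp_negd0, of S env, unfolded fst_conv snd_conv])
    (intro comps_Cons comps_Nil, simp_all)

lemma comp_leafd0: "computable UNIV (\<lambda>s. [enc_slc (fst s), encode_form (fst (snd s)), encode_form (snd (snd s))])
   (\<lambda>s. enc_ded (leafd (fst s) (fst (snd s)) (snd (snd s))))"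
  unfolding leafd_def by (rule comp_vs comp_intro)+

lemma comp_leafd [comp_intro]: "computable S env (\<lambda>s. enc_slc (p s)) \<Longrightarrow>
   computable S env (\<lambda>s. encode_form (C s)) \<Longrightarrow>
   computable S env (\<lambda>s. encode_form (D s)) \<Longrightarrow>
   computable S env (\<lambda>s. enc_ded (leafd (p s) (C s) (D s)))"
  by (rule comp_call[where \<phi> = "\<lambda>s. (p s, C s, D s)", OF _ comp_leafd0, of S env, unfolded fst_conv snd_conv])
    (intro comps_Cons comps_Nil, simp_all)

text \<open>The node case of \<open>fwd\<close> by selectors, as the recursion schemes work with
  tests and projections instead of patterns.\<close>

definition fwd_step :: "'a slc \<Rightarrow> 'a form \<Rightarrow> 'a form \<Rightarrow> 'a ded \<Rightarrow> 'a ded \<Rightarrow> 'a ded" where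
  "fwd_step p C D d e = (if isD C then seq (DAnd (cocontr (th p)) (Fm (Disj (tr p (lft C)) (tr p (rgt C)))))
      (seq (distr (th p) (tr p (lft C)) (tr p (rgt C))) (seq (DOr d e) (joinO (tr p (lft D)) (tr p (rgt D)) (RR p))))
    else seq (DAnd (cocontr (th p)) (Fm (Conj (tr p (lft C)) (tr p (rgt C)))))
      (seq (DAnd d e) (joinA (tr p (lft D)) (tr p (rgt D)) (RR p))))"

lemma fwd_rec: "fwd p C D = (if isD C \<and> isD D \<or> isC C \<and> isC D then fwd_step p C D (fwd p (lft C) (lft D)) (fwd p (rgt C) (rgt D)) else leafd p C D)"
  by (cases C; cases D) (auto simp: fwd_step_def)

lemma fwd_nd: "isD C \<and> isD D \<or> isC C \<and> isC D \<Longrightarrow> fwd p C D = fwd_step p C D (fwd p (lft C) (lft D)) (fwd p (rgt C) (rgt D))"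
  and fwd_leaf: "\<not> (isD C \<and> isD D \<or> isC C \<and> isC D) \<Longrightarrow> fwd p C D = leafd p C D"
  using fwd_rec[of p C D] by auto

lemma fwd_step_size: "data_size (enc_ded (fwd_step p C D d e)) \<le> data_size (enc_ded d) + data_size (enc_ded e) +
    data_size (enc_ded (fwd_step p C D (Fm FF) (Fm FF)))"
  by (auto simp: fwd_step_def size_simps)

text \<open>Both formulae are descended together, so the size of the first alone serves as the
  weight.\<close>

lemma comp_fwd0: "computable UNIV (\<lambda>s. [encode_form (fst s), encode_form (fst (snd s)), enc_slc (snd (snd s))]) 
   (\<lambda>s. enc_ded (fwd (snd (snd s)) (fst s) (fst (snd s))))"
proof (rule comp_rec_add[where nd = "\<lambda>s. isD (fst s) \<and> isD (fst (snd s)) \<or> isC (fst s) \<and> isC (fst (snd s))" and n = 3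
      and cs = "[\<lambda>s. (lft (fst s), lft (fst (snd s)), snd (snd s)), \<lambda>s. (rgt (fst s), rgt (fst (snd s)), snd (snd s))]"
      and w = "\<lambda>s. data_size (encode_form (fst s))" 
      and H = "\<lambda>s. data_size (enc_ded (fwd_step (snd (snd s)) (fst s) (fst (snd s)) (Fm FF) (Fm FF)))"], simp_all only: list.map append.simps fst_conv snd_conv)
  let ?env = "\<lambda>s. [encode_form (fst s), encode_form (fst (snd s)), enc_slc (snd (snd s))]"
  let ?nd = "\<lambda>s. isD (fst s) \<and> isD (fst (snd s)) \<or> isC (fst s) \<and> isC (fst (snd s))"
  let ?g = "\<lambda>s. enc_ded (fwd (snd (snd s)) (fst s) (fst (snd s)))"
  let ?S = "{s \<in> UNIV. ?nd s}" and ?Leaf = "{s \<in> UNIV. \<not> ?nd s}"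
  show "computable UNIV ?env (\<lambda>s. truth (?nd s))"
    by (rule comp_vs comp_intro)+
  have "computable ?Leaf ?env (\<lambda>s. enc_ded (leafd (snd (snd s)) (fst s) (fst (snd s))))" by (rule comp_vs comp_intro)+
  then show "computable ?Leaf ?env ?g" by (rule comp_cong) (simp add: fwd_leaf)
  have "computable ?S (\<lambda>s. [enc_ded (fwd (snd (snd s)) (lft (fst s)) (lft (fst (snd s)))), enc_ded (fwd (snd (snd s)) (rgt (fst s)) (rgt (fst (snd s)))),
      encode_form (fst s), encode_form (fst (snd s)), enc_slc (snd (snd s))])
     (\<lambda>s. enc_ded (fwd_step (snd (snd s)) (fst s) (fst (snd s)) (fwd (snd (snd s)) (lft (fst s)) (lft (fst (snd s)))) (fwd (snd (snd s)) (rgt (fst s)) (rgt (fst (snd s))))))"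
    unfolding fwd_step_def by (rule comp_vs comp_intro)+
  then show "computable ?S (\<lambda>s. [enc_ded (fwd (snd (snd s)) (lft (fst s)) (lft (fst (snd s)))), enc_ded (fwd (snd (snd s)) (rgt (fst s)) (rgt (fst (snd s)))),
      encode_form (fst s), encode_form (fst (snd s)), enc_slc (snd (snd s))]) ?g"
    by (rule comp_cong) (subst fwd_nd, auto)
  have "computable ?S ?env (\<lambda>s. enc_ded (fwd_step (snd (snd s)) (fst s) (fst (snd s)) (Fm FF) (Fm FF)))"
    unfolding fwd_step_def by (rule comp_vs comp_intro)+
  then show "qb ?S (\<lambda>s. esz (?env s)) (\<lambda>s. data_size (enc_ded (fwd_step (snd (snd s)) (fst s) (fst (snd s)) (Fm FF) (Fm FF))))"
    by (rule comp_qb)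
  show "data_size (?g s) \<le> sum_list [data_size (enc_ded (fwd (snd (snd s)) (lft (fst s)) (lft (fst (snd s))))),
        data_size (enc_ded (fwd (snd (snd s)) (rgt (fst s)) (rgt (fst (snd s)))))]
      + data_size (enc_ded (fwd_step (snd (snd s)) (fst s) (fst (snd s)) (Fm FF) (Fm FF)))" if "?nd s" for s
    unfolding fwd_nd[OF that] using fwd_step_size[of "snd (snd s)" "fst s" "fst (snd s)"] by (simp only: sum_list.Cons sum_list.Nil add_0_right)
  fix c assume "c \<in> set [\<lambda>s. (lft (fst s), lft (fst (snd s)), snd (snd s)), \<lambda>s :: 'a form \<times> 'a form \<times> 'a slc. (rgt (fst s), rgt (fst (snd s)), snd (snd s))]"
  then have c: "c = (\<lambda>s. (lft (fst s), lft (fst (snd s)), snd (snd s))) \<or> c = (\<lambda>s. (rgt (fst s), rgt (fst (snd s)), snd (snd s)))" by simp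
  have "computables ?S ?env (\<lambda>s. [encode_form (lft (fst s)), encode_form (lft (fst (snd s))), enc_slc (snd (snd s))])"
    by (rule comps_Cons comps_Nil comp_vs comp_intro)+
  moreover have "computables ?S ?env (\<lambda>s. [encode_form (rgt (fst s)), encode_form (rgt (fst (snd s))), enc_slc (snd (snd s))])"
    by (rule comps_Cons comps_Nil comp_vs comp_intro)+
  ultimately show "computables ?S ?env (\<lambda>s. [encode_form (fst (c s)), encode_form (fst (snd (c s))), enc_slc (snd (snd (c s)))])"
    using c by auto
  have l: "data_size (encode_form (lft A)) \<le> data_size (encode_form A)" "data_size (encode_form (rgt A)) \<le> data_size (encode_form A)" for A :: "'a form"
    by (cases A; simp)+
  show "c s \<in> UNIV \<and> esz [encode_form (fst (c s)), encode_form (fst (snd (c s))), enc_slc (snd (snd (c s)))] \<le> esz (?env s)" for s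
    using c l[of "fst s"] l[of "fst (snd s)"] by (auto intro: add_mono)
next
  fix s :: "'a form \<times> 'a form \<times> 'a slc"
  show "isD (fst s) \<and> isD (fst (snd s)) \<or> isC (fst s) \<and> isC (fst (snd s)) \<Longrightarrow>
    1 + sum_list [data_size (encode_form (lft (fst s))), data_size (encode_form (rgt (fst s)))] \<le> data_size (encode_form (fst s))"
    by (cases "fst s") auto
qed (auto simp: data_size_pos[simplified])

lemma comp_fwd [comp_intro]: "computable S env (\<lambda>s. enc_slc (p s)) \<Longrightarrow>
   computable S env (\<lambda>s. encode_form (C s)) \<Longrightarrow>
   computable S env (\<lambda>s. encode_form (D s)) \<Longrightarrow>
   computable S env (\<lambda>s. enc_ded (fwd (p s) (C s) (D s)))"
  by (rule comp_call[where \<phi> = "\<lambda>s. (C s, D s, p s)", OF _ comp_fwd0, of S env, unfolded fst_conv snd_conv])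
    (intro comps_Cons comps_Nil, simp_all)

lemma comp_unfold0: "computable UNIV (\<lambda>s. encode_form (fst s) # [enc_slc (snd s)]) (\<lambda>s. enc_ded (unfold (snd s) (fst s)))"
  apply (rule comp_form_rec[where env = "\<lambda>p. [enc_slc p]" and g = "\<lambda>s. enc_ded (unfold (snd s) (fst s))" and n = 1
        and hD = "\<lambda>s. enc_ded (seq (DOr (Fm FF) (Fm FF)) (joinO (fst s) (fst (snd s)) (RR (snd (snd s)))))"
        and hC = "\<lambda>s. enc_ded (seq (DAnd (Fm FF) (Fm FF)) (joinA (fst s) (fst (snd s)) (RR (snd (snd s)))))"])
           apply (simp_all only: fst_conv snd_conv unfold.simps)
           apply ((rule comp_vs comp_intro)+)[7]
    apply (simp_all add: size_simps)
  done

lemma comp_unfold [comp_intro]: "computable S env (\<lambda>s. enc_slc (p s)) \<Longrightarrow>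
   computable S env (\<lambda>s. encode_form (A s)) \<Longrightarrow>
   computable S env (\<lambda>s. enc_ded (unfold (p s) (A s)))"
  by (rule comp_call[where \<phi> = "\<lambda>s. (A s, p s)", OF _ comp_unfold0, of S env, unfolded fst_conv snd_conv])
    (intro comps_Cons comps_Nil, simp_all)

lemma comp_stepd0: "computable UNIV (\<lambda>s. [enc_slc (fst s), encode_form (fst (snd s)), encode_rule (fst (snd (snd s))), encode_form (snd (snd (snd s)))])
   (\<lambda>s. enc_ded (stepd (fst s) (fst (snd s)) (fst (snd (snd s))) (snd (snd (snd s)))))"
  unfolding stepd_def by (rule comp_vs comp_intro)+

lemma comp_stepd [comp_intro]: "computable S env (\<lambda>s. enc_slc (p s)) \<Longrightarrow>
   computable S env (\<lambda>s. encode_form (C s)) \<Longrightarrow>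
   computable S env (\<lambda>s. encode_rule (r s)) \<Longrightarrow>
   computable S env (\<lambda>s. encode_form (D s)) \<Longrightarrow>
   computable S env (\<lambda>s. enc_ded (stepd (p s) (C s) (r s) (D s)))"
  by (rule comp_call[where \<phi> = "\<lambda>s. (p s, C s, r s, D s)", OF _ comp_stepd0, of S env, unfolded fst_conv snd_conv])
    (intro comps_Cons comps_Nil, simp_all)

text \<open>Each call moves a formula from the list into the argument for the current line, so the
  environment does not grow although that argument changes.\<close>

lemma comp_loopd0: "computable UNIV (\<lambda>s. [encode_list (enc_pair encode_rule encode_form) (fst s), encode_form (fst (snd s)), enc_slc (snd (snd s))]) 
   (\<lambda>s. enc_ded (loopd (snd (snd s)) (fst (snd s)) (fst s)))"
proof (rule comp_rec1[where nd = "\<lambda>s. \<not> fst s = []" and c = "\<lambda>s. (tl (fst s), snd (hd (fst s)), snd (snd s))" and n = 3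
      and w = "\<lambda>s. data_size (encode_list (enc_pair encode_rule encode_form) (fst s))" 
      and h = "\<lambda>s. enc_ded (seq (stepd (snd (snd s)) (fst (snd s)) (fst (hd (fst s))) (snd (hd (fst s)))) (Fm FF))"], simp_all only: fst_conv snd_conv)
  let ?e = "enc_pair encode_rule encode_form"
  let ?env = "\<lambda>s. [encode_list ?e (fst s), encode_form (fst (snd s)), enc_slc (snd (snd s))]"
  let ?S = "{s \<in> UNIV. \<not> fst s = []}"
  let ?g = "\<lambda>s. enc_ded (loopd (snd (snd s)) (snd (hd (fst s))) (tl (fst s)))"
  have "computable UNIV ?env (\<lambda>s. if fst s = [] then Null else Node Null Null)"
    by (intro comp_if comp_isNil[where e = ?e] comp_Null comp_Node comp_v0)
  then show "computable UNIV ?env (\<lambda>s. truth (\<not> fst s = []))"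
    by (rule comp_cong) (simp add: truth_def)
  have "computable {s \<in> UNIV. \<not> \<not> fst s = []} ?env (\<lambda>s. enc_ded (Fm (Conj (th (snd (snd s))) (Disj (tr (snd (snd s)) (fst (snd s))) (RR (snd (snd s)))))))"
    by (rule comp_vs comp_intro)+
  then show "computable {s \<in> UNIV. \<not> \<not> fst s = []} ?env (\<lambda>s. enc_ded (loopd (snd (snd s)) (fst (snd s)) (fst s)))"
    by (rule comp_cong) auto
  have hd1: "computable ?S (\<lambda>s. ?g s # ?env s) (\<lambda>s. ?e (hd (fst s)))"
    by (rule comp_hd[OF comp_v1]) simp
  have hd0: "computable ?S ?env (\<lambda>s. ?e (hd (fst s)))"
    by (rule comp_hd[OF comp_v0]) simp
  have "computable ?S (\<lambda>s. ?g s # ?env s) (\<lambda>s. enc_ded (seq (stepd (snd (snd s)) (fst (snd s)) (fst (hd (fst s))) (snd (hd (fst s)))) (loopd (snd (snd s)) (snd (hd (fst s))) (tl (fst s)))))"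
    by (intro comp_seq comp_stepd comp_fst_step[OF hd1] comp_snd_step[OF hd1] comp_v0 comp_v2 comp_v3)
  then show "computable ?S (\<lambda>s. ?g s # ?env s) (\<lambda>s. enc_ded (loopd (snd (snd s)) (fst (snd s)) (fst s)))"
    by (rule comp_cong) (auto simp: neq_Nil_conv)
  show "computables ?S ?env (\<lambda>s. [encode_list ?e (tl (fst s)), encode_form (snd (hd (fst s))), enc_slc (snd (snd s))])"
    by (intro comps_Cons comps_Nil comp_tl comp_snd_step[OF hd0] comp_v0 comp_v2)
  show "computable ?S ?env (\<lambda>s. enc_ded (seq (stepd (snd (snd s)) (fst (snd s)) (fst (hd (fst s))) (snd (hd (fst s)))) (Fm FF)))"
    by (intro comp_seq comp_stepd comp_fst_step[OF hd0] comp_snd_step[OF hd0] comp_Fm comp_FF comp_v0 comp_v1 comp_v2)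
qed (auto simp: neq_Nil_conv data_size_pos[simplified] size_simps)

lemma comp_loopd [comp_intro]: "computable S env (\<lambda>s. enc_slc (p s)) \<Longrightarrow>
   computable S env (\<lambda>s. encode_form (C s)) \<Longrightarrow>
   computable S env (\<lambda>s. encode_list (enc_pair encode_rule encode_form) (A s)) \<Longrightarrow>
   computable S env (\<lambda>s. enc_ded (loopd (p s) (C s) (A s)))"
  by (rule comp_call[where \<phi> = "\<lambda>s. (A s, C s, p s)", OF _ comp_loopd0, of S env, unfolded fst_conv snd_conv])
    (intro comps_Cons comps_Nil, simp_all)

lemma comp_sliced0: "computable UNIV (\<lambda>s. [enc_slc (fst s), encode_list (enc_pair encode_rule encode_form) (snd s)])
   (\<lambda>s. enc_ded (sliced (fst s) (snd s)))"
  unfolding sliced_def by (rule comp_vs comp_intro)+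

lemma comp_sliced [comp_intro]: "computable S env (\<lambda>s. enc_slc (p s)) \<Longrightarrow>
   computable S env (\<lambda>s. encode_list (enc_pair encode_rule encode_form) (A s)) \<Longrightarrow>
   computable S env (\<lambda>s. enc_ded (sliced (p s) (A s)))"
  by (rule comp_call[where \<phi> = "\<lambda>s. (p s, A s)", OF _ comp_sliced0, of S env, unfolded fst_conv snd_conv])
    (intro comps_Cons comps_Nil, simp_all)

lemma comp_hd_FF: "computable S env (\<lambda>s. encode_list encode_form (xs s)) \<Longrightarrow>
   computable S env (\<lambda>s. encode_form (if xs s = [] then FF else hd (xs s)))"
  by (intro comp_ifF comp_isNil[where e = encode_form] comp_FF comp_hd[where e = encode_form]) (auto intro: comp_subset)

abbreviation enc_row where "enc_row \<equiv> enc_pair encode_form (encode_list enc_ded)"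

lemma comp_pick_rows0: "computable {s. snd s \<in> UNIV} (\<lambda>s. encode_list enc_row (fst s) # [encode_list encode_form (snd s)])
   (\<lambda>s. encode_list (enc_pair encode_form enc_ded) (map (\<lambda>q. (fst q, pick (snd q) (snd s))) (fst s)))"
  apply (rule comp_map0[where f = "\<lambda>p q. (fst q, pick (snd q) p)" and env = "\<lambda>p. [encode_list encode_form p]" and n = 1])
   apply (rule comp_vs comp_pair comp_pick comp_fst[where ?e1.0 = encode_form and ?e2.0 = "encode_list enc_ded"]
       comp_snd[where ?e1.0 = encode_form and ?e2.0 = "encode_list enc_ded"])+
  apply simp
  done

lemma comp_pick_rows [comp_intro]: "computable S env (\<lambda>s. encode_list enc_row (R s)) \<Longrightarrow>
   computable S env (\<lambda>s. encode_list encode_form (X s)) \<Longrightarrow>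
   computable S env (\<lambda>s. encode_list (enc_pair encode_form enc_ded) (map (\<lambda>q. (fst q, pick (snd q) (X s))) (R s)))"
  by (rule comp_call[where \<phi> = "\<lambda>s. (R s, X s)", OF _ comp_pick_rows0, of S env, unfolded fst_conv snd_conv])
    (intro comps_Cons comps_Nil, simp_all)

lemma comp_outerd0: "computable {s. snd s \<in> UNIV} (\<lambda>s. encode_list encode_form (fst s) # [encode_form (fst (snd s)), encode_list encode_form (fst (snd (snd s))),
     encode_list encode_form (fst (snd (snd (snd s)))), encode_list enc_row (fst (snd (snd (snd (snd s))))),
     encode_list (enc_pair encode_rule encode_form) (snd (snd (snd (snd (snd s)))))])
   (\<lambda>s. enc_ded (outerd (fst (snd s)) (fst (snd (snd s))) (fst (snd (snd (snd s)))) (fst (snd (snd (snd (snd s))))) (snd (snd (snd (snd (snd s))))) (fst s)))"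
  apply (rule comp_list_rec[where env = "\<lambda>p. [encode_form (fst p), encode_list encode_form (fst (snd p)), encode_list encode_form (fst (snd (snd p))), encode_list enc_row (fst (snd (snd (snd p)))),
     encode_list (enc_pair encode_rule encode_form) (snd (snd (snd (snd p))))]"
     and g = "\<lambda>s. enc_ded (outerd (fst (snd s)) (fst (snd (snd s))) (fst (snd (snd (snd s)))) (fst (snd (snd (snd (snd s))))) (snd (snd (snd (snd (snd s))))) (fst s))"
     and h = "\<lambda>s. enc_ded (seq (DOr (Fm (fst (snd (snd s)))) (sliced (Slc (fst s) (if fst (snd s) = [] then FF else hd (fst (snd s))) (fst (snd (snd s))) (fst (snd (snd (snd s)))) (fst (snd (snd (snd (snd s)))))
             (map (\<lambda>q. (fst q, pick (snd q) (fst (snd s)))) (fst (snd (snd (snd (snd (snd s)))))))) (snd (snd (snd (snd (snd (snd s))))))))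
          (seq (DOr (contr (fst (snd (snd s)))) (Fm (if fst (snd s) = [] then FF else hd (fst (snd s))))) (Fm FF)))" and n = 5])
      apply (simp_all only: fst_conv snd_conv outerd.simps)
      apply ((rule comp_vs comp_hd_FF comp_intro)+)[3]
   apply (simp_all add: size_simps)
  done

lemma comp_outerd [comp_intro]: "computable S env (\<lambda>s. encode_form (G s)) \<Longrightarrow>
   computable S env (\<lambda>s. encode_list encode_form (L s)) \<Longrightarrow>
   computable S env (\<lambda>s. encode_list encode_form (M s)) \<Longrightarrow>
   computable S env (\<lambda>s. encode_list enc_row (R s)) \<Longrightarrow>
   computable S env (\<lambda>s. encode_list (enc_pair encode_rule encode_form) (ss s)) \<Longrightarrow>
   computable S env (\<lambda>s. encode_list encode_form (X s)) \<Longrightarrow>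
   computable S env (\<lambda>s. enc_ded (outerd (G s) (L s) (M s) (R s) (ss s) (X s)))"
  by (rule comp_call[where \<phi> = "\<lambda>s. (X s, G s, L s, M s, R s, ss s)", OF _ comp_outerd0, of S env, unfolded fst_conv snd_conv])
    (intro comps_Cons comps_Nil, simp_all)


end

section \<open>Sizes of the thresholds and of their derivations\<close>

text \<open>If \<open>2 ^ d\<close> is quasipolynomial, then \<open>d\<close> is polylogarithmic,
  and a quasipolynomial raised to such a power is again quasipolynomial. Through this lemma bounds
  like \<open>n\<close> to the power \<open>O(log n)\<close> enter.\<close>

lemma qb_pow:
  assumes "qb S N f" "qb S N g" "\<And>s. s \<in> S \<Longrightarrow> 2 ^ d s \<le> g s"
  shows "qb S N (\<lambda>s. f s ^ d s)"
proof -
  obtain k k' where k: "\<And>s. s \<in> S \<Longrightarrow> f s \<le> bd k (N s)" "\<And>s. s \<in> S \<Longrightarrow> g s \<le> bd k' (N s)"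
    using assms(1,2) unfolding qb_def by blast
  show ?thesis
    unfolding qb_def
  proof (intro exI ballI)
    fix s assume s: "s \<in> S"
    let ?x = "lg (N s)"
    have "(2::nat) ^ d s \<le> 2 ^ ((?x + k') ^ k')"
      using order_trans[OF assms(3) k(2)] s by (auto simp: bd_def)
    then have d: "d s \<le> (?x + k') ^ k'" by simp
    have "f s ^ d s \<le> bd k (N s) ^ d s" using k(1)[OF s] by (rule power_mono) simp
    also have "\<dots> = 2 ^ ((?x + k) ^ k * d s)" by (simp add: bd_def power_mult)
    also have "(?x + k) ^ k * d s \<le> (?x + (k + k')) ^ k * (?x + (k + k')) ^ k'"
      using d by (intro mult_le_mono order_trans[OF d] power_mono) auto
    then have "(2::nat) ^ ((?x + k) ^ k * d s) \<le> bd (k + k') (N s)"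
      by (simp add: bd_def power_add)
    finally show "f s ^ d s \<le> bd (k + k') (N s)" .
  qed
qed

lemma sum_append_zip:
  fixes \<phi> :: "'b \<Rightarrow> nat"
  shows "(\<Sum>ps\<leftarrow>append_zip xs ys. \<Sum>q\<leftarrow>ps. \<phi> q) = (\<Sum>ps\<leftarrow>xs. \<Sum>q\<leftarrow>ps. \<phi> q) + (\<Sum>ps\<leftarrow>ys. \<Sum>q\<leftarrow>ps. \<phi> q)"
  by (induction xs ys rule: append_zip.induct) auto

text \<open>A convolution contains every pair of positions exactly once, so the sum over it is a
  double sum, and sizes split into lengths times totals.\<close>

lemma sum_conv:
  fixes \<phi> :: "'b \<times> 'c \<Rightarrow> nat"
  shows "(\<Sum>ps\<leftarrow>conv xs ys. \<Sum>q\<leftarrow>ps. \<phi> q) = (\<Sum>x\<leftarrow>xs. \<Sum>y\<leftarrow>ys. \<phi> (x, y))"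
  by (induction xs) (simp_all add: sum_append_zip o_def)

lemma sum_conv_split:
  fixes f :: "'b \<Rightarrow> nat" and g :: "'c \<Rightarrow> nat"
  shows "(\<Sum>ps\<leftarrow>conv xs ys. \<Sum>q\<leftarrow>ps. c + f (fst q) + g (snd q)) =
    c * (length xs * length ys) + length ys * (\<Sum>x\<leftarrow>xs. f x) + length xs * (\<Sum>y\<leftarrow>ys. g y)"
proof -
  have "(\<Sum>y\<leftarrow>ys. c + f x + g y) = length ys * (c + f x) + (\<Sum>y\<leftarrow>ys. g y)" for x
    by (induction ys) (auto simp: algebra_simps)
  then show ?thesis unfolding sum_conv by (induction xs) (auto simp: algebra_simps)
qed

lemma sum_list_const_add:
  fixes f :: "'b \<Rightarrow> nat"
  shows "(\<Sum>x\<leftarrow>xs. c + f x) = length xs * c + (\<Sum>x\<leftarrow>xs. f x)"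
  by (induction xs) auto

lemma data_size_encode_list: "data_size (encode_list e xs) = 1 + length xs + (\<Sum>x\<leftarrow>xs. data_size (e x))"
  by (induction xs) auto

lemma data_size_disj_list: "data_size (encode_form (disj_list As)) = 1 + (\<Sum>A\<leftarrow>As. 5 + data_size (encode_form A))"
  by (induction As) (auto simp: data_size_tag)

lemma data_size_erase: "data_size (encode_form (erase P A)) \<le> data_size (encode_form A)"
  by (induction A) (auto simp: data_size_pos[simplified])

lemma length_thr: "length (thr t) \<le> data_size (encode_form t) + 1"
proof (induction t)
  case (Conj l r)
  then show ?case unfolding length_thr_Conj by simp
qed auto

abbreviation thr_size :: "'a form \<Rightarrow> nat" where
  "thr_size t \<equiv> data_size (encode_list encode_form (thr t))"

text \<open>An element of one list occurs in as many pairs as the other list is long, at most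
  \<open>N\<close>, so totals grow by a factor linear in \<open>N\<close>. A pair costs 12 besides
  its components: 7 for the conjunction and 5 for the disjunction.\<close>

lemma thr_size_Conj:
  assumes "length (thr l) \<le> N" "length (thr r) \<le> N"
  shows "thr_size (Conj l r) \<le> 16 * N * (thr_size l + thr_size r)"
proof -
  let ?X = "thr l" and ?Y = "thr r"
  let ?sX = "\<Sum>x\<leftarrow>?X. data_size (encode_form x)" and ?sY = "\<Sum>x\<leftarrow>?Y. data_size (encode_form x)"
  have N: "1 \<le> N" using assms(1) thr_nonempty[of l] by (cases "thr l") auto
  have e: "data_size (encode_form (disj_list (map (\<lambda>(x, y). Conj x y) ps))) =
      1 + (\<Sum>q\<leftarrow>ps. 12 + data_size (encode_form (fst q)) + data_size (encode_form (snd q)))" for ps :: "('a form \<times> 'a form) list"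
    unfolding data_size_disj_list map_map o_def by (simp add: case_prod_beta data_size_tag add.assoc)
  have "thr_size (Conj l r) = 1 + length (conv ?X ?Y) + (\<Sum>ps\<leftarrow>conv ?X ?Y. 1 + (\<Sum>q\<leftarrow>ps. 12 + data_size (encode_form (fst q)) + data_size (encode_form (snd q))))"
    unfolding thr.simps data_size_encode_list map_map o_def e by simp
  also have "\<dots> = 1 + 2 * length (conv ?X ?Y) + (\<Sum>ps\<leftarrow>conv ?X ?Y. \<Sum>q\<leftarrow>ps. 12 + data_size (encode_form (fst q)) + data_size (encode_form (snd q)))"
    unfolding sum_list_const_add[of 1] by simp
  also have "\<dots> = 1 + 2 * length (conv ?X ?Y) + (12 * (length ?X * length ?Y) + length ?Y * ?sX + length ?X * ?sY)"
    using sum_conv_split[of 12 "\<lambda>x. data_size (encode_form x)" "\<lambda>x. data_size (encode_form x)" ?X ?Y] by simp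
  also have "\<dots> \<le> 2 * N * (thr_size l + thr_size r) + (12 * (N * thr_size l) + N * thr_size l + N * thr_size r)"
  proof -
    have "1 + 2 * length (conv ?X ?Y) \<le> 2 * (thr_size l + thr_size r)"
      using length_conv[OF thr_nonempty[of r], of ?X] by (auto simp: data_size_encode_list)
    also have "\<dots> \<le> 2 * N * (thr_size l + thr_size r)" using N by (intro mult_le_mono1) simp
    finally have "1 + 2 * length (conv ?X ?Y) \<le> 2 * N * (thr_size l + thr_size r)" .
    moreover have "length ?X * length ?Y \<le> thr_size l * N" using assms by (intro mult_le_mono) (auto simp: data_size_encode_list)
    moreover have "length ?Y * ?sX \<le> N * thr_size l" "length ?X * ?sY \<le> N * thr_size r"
      using assms by (intro mult_le_mono; simp add: data_size_encode_list)+
    ultimately show ?thesis by (simp add: mult.commute)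
  qed
  also have "\<dots> \<le> 16 * N * (thr_size l + thr_size r)" by (simp add: algebra_simps)
  finally show ?thesis .
qed

text \<open>Solves the recurrence of \<open>thr_size_Conj\<close>: \<open>16 * N\<close> times a sum
  over two children gives \<open>32 * N\<close> per level. The 7 is the size of the encoded list for
  an atom.\<close>

definition thr_bound :: "nat \<Rightarrow> nat \<Rightarrow> nat" where
  "thr_bound N m = 7 * N * (32 * N) ^ m"

lemma thr_bound_mono: "1 \<le> N \<Longrightarrow> m \<le> m' \<Longrightarrow> thr_bound N m \<le> thr_bound N m'"
  unfolding thr_bound_def by (intro mult_le_mono power_increasing) auto

lemma thr_bound_pos: "1 \<le> N \<Longrightarrow> 1 \<le> thr_bound N m"
  by (simp add: thr_bound_def Suc_le_eq)

lemma thr_size_le: "data_size (encode_form t) + 1 \<le> N \<Longrightarrow> thr_size t \<le> thr_bound N (dep t)"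
proof (induction t)
  case (Conj l r)
  let ?m = "max (dep l) (dep r)"
  have N: "data_size (encode_form l) + 1 \<le> N" "data_size (encode_form r) + 1 \<le> N" "1 \<le> N" using Conj.prems by auto
  have "thr_size l \<le> thr_bound N ?m" "thr_size r \<le> thr_bound N ?m"
    using Conj.IH N thr_bound_mono[OF N(3)] by (meson le_trans max.cobounded1 max.cobounded2)+
  moreover have "thr_size (Conj l r) \<le> 16 * N * (thr_size l + thr_size r)"
    using length_thr[of l] length_thr[of r] N by (intro thr_size_Conj) auto
  ultimately have "thr_size (Conj l r) \<le> 16 * N * (thr_bound N ?m + thr_bound N ?m)"
    by (meson add_mono le_trans mult_le_mono2)
  also have "\<dots> = thr_bound N (dep (Conj l r))" by (simp add: thr_bound_def)
  finally show ?case .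
qed (auto simp: thr_bound_def)

lemma thr_elem_size: "A \<in> set (thr t) \<Longrightarrow> data_size (encode_form A) \<le> thr_size t"
  using member_le_sum_list[of "data_size (encode_form A)" "map (\<lambda>x. data_size (encode_form x)) (thr t)"]
  by (auto simp: data_size_encode_list)

text \<open>The form required by \<open>qb_pow\<close>. The empty tree, to which
  \<open>dep_braun\<close> does not apply, is treated apart.\<close>

lemma dep_le: "braun t \<Longrightarrow> 2 ^ dep t \<le> (data_size (encode_form t) + 1) * (data_size (encode_form t) + 1)"
proof (cases "leaves t = 0")
  case True
  assume "braun t"
  then have "t = FF" using True by (cases t) auto
  then show ?thesis by simp
next
  case False
  assume b: "braun t"
  have "leaves t \<le> data_size (encode_form t)" by (induction t) auto
  then have "leaves t * leaves t \<le> (data_size (encode_form t) + 1) * (data_size (encode_form t) + 1)"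
    by (intro mult_le_mono) auto
  then show ?thesis using dep_braun[OF b] False by simp
qed

lemma map_triples:
  assumes "X \<noteq> []" "length D = length X"
  shows "map fst (triples X D) = X" "map (\<lambda>x. snd (snd x)) (triples X D) = D" "length (triples X D) = length X"
proof -
  have l: "length (succs X) = length X" using length_succs[OF assms(1)] .
  show "map fst (triples X D) = X" "length (triples X D) = length X" using l assms by (simp_all add: triples_def)
  have "map (\<lambda>x. snd (snd x)) (triples X D) = map snd (map snd (triples X D))" by simp
  also have "\<dots> = D" using l assms by (simp add: triples_def)
  finally show "map (\<lambda>x. snd (snd x)) (triples X D) = D" .
qed

lemma set_tlD: "x \<in> set (tl xs) \<Longrightarrow> x \<in> set xs"
  by (cases xs) auto

lemma triples_mem:
  assumes "x \<in> set (triples X D)"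
  shows "fst x \<in> set X" "fst (snd x) = FF \<or> fst (snd x) \<in> set X"
proof -
  have "fst x \<in> set X \<and> snd x \<in> set (zip (succs X) D)"
    using assms unfolding triples_def by (metis in_set_zipE prod.collapse)
  then have "fst x \<in> set X \<and> fst (snd x) \<in> set (succs X)" by (metis in_set_zipE prod.collapse)
  then show "fst x \<in> set X" "fst (snd x) = FF \<or> fst (snd x) \<in> set X"
    by (auto simp: succs_def dest: set_tlD)
qed

lemma raise_disj_size:
  assumes nil: "\<And>H. data_size (encode_form H) \<le> U \<Longrightarrow> data_size (enc_ded (raise_disj P G H [])) \<le> B"
    and step: "\<And>H A C. data_size (encode_form H) \<le> U \<Longrightarrow> data_size (encode_form A) \<le> U \<Longrightarrow> data_size (encode_form C) \<le> U \<Longrightarrow>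
      data_size (enc_ded (seq (DAnd (cocontr P) (Fm (Disj A C))) (seq (distr P A C) (seq (DOr (Fm FF) (Fm FF)) (contr (Disj H G)))))) \<le> B"
    and H: "data_size (encode_form H) \<le> U"
  shows "data_size (encode_form (disj_list (map fst xs))) \<le> U \<Longrightarrow>
    data_size (enc_ded (raise_disj P G H xs)) \<le> B + (\<Sum>x\<leftarrow>xs. data_size (enc_ded (snd x)) + B)"
proof (induction xs)
  case Nil
  then show ?case using nil[OF H] by simp
next
  case (Cons x xs)
  let ?C = "disj_list (map fst xs)"
  have U: "data_size (encode_form (fst x)) \<le> U" "data_size (encode_form ?C) \<le> U" using Cons.prems by auto
  have "data_size (enc_ded (raise_disj P G H (x # xs))) \<le> data_size (enc_ded (raise_disj P G H xs)) + data_size (enc_ded (snd x)) +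
     data_size (enc_ded (seq (DAnd (cocontr P) (Fm (Disj (fst x) ?C))) (seq (distr P (fst x) ?C) (seq (DOr (Fm FF) (Fm FF)) (contr (Disj H G))))))"
    by (simp add: data_size_tag seq_def)
  then show ?case using Cons.IH[OF U(2)] step[OF H U] by simp
qed

text \<open>The local pieces enter only through a common bound \<open>B\<close>, valid for formulae
  of size at most \<open>U\<close>; \<open>7 + 2 * U\<close> allows for a conjunction of two of
  these. \<open>V\<close> bounds what one node adds: at most \<open>2 * N\<close> entries and
  \<open>N * N\<close> pairs, with \<open>2 * B\<close> for each pair. A derivation from a child is
  copied at most \<open>N\<close> times, so \<open>V\<close> and the two children together fit into
  a factor \<open>3 * N\<close> per level.\<close>

lemma raise_size:
  fixes P G :: "'a form"
  assumes nil: "\<And>H. data_size (encode_form H) \<le> U \<Longrightarrow> data_size (enc_ded (raise_disj P G H [])) \<le> B"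
    and step: "\<And>H A C. data_size (encode_form H) \<le> U \<Longrightarrow> data_size (encode_form A) \<le> U \<Longrightarrow> data_size (encode_form C) \<le> U \<Longrightarrow>
      data_size (enc_ded (seq (DAnd (cocontr P) (Fm (Disj A C))) (seq (distr P A C) (seq (DOr (Fm FF) (Fm FF)) (contr (Disj H G)))))) \<le> B"
    and trm: "\<And>X Y A H. data_size (encode_form X) \<le> U \<Longrightarrow> data_size (encode_form Y) \<le> U \<Longrightarrow> data_size (encode_form A) \<le> 7 + 2 * U \<Longrightarrow>
      data_size (encode_form H) \<le> U \<Longrightarrow> data_size (enc_ded (raise_term G (Fm FF) X Y A H)) \<le> B"
    and leaf: "data_size (encode_list enc_ded [DOr (Fm P) (weak G), embed P G]) \<le> B"
    and V: "V = 1 + 2 * N * (2 + B) + N * N * (2 * B)"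
  shows "data_size (encode_form t) + 1 \<le> N \<Longrightarrow> thr_bound N (dep t) \<le> U \<Longrightarrow>
    data_size (encode_list enc_ded (raise P G t)) \<le> V * (3 * N) ^ dep t"
proof (induction t)
  case (Conj l r)
  let ?R = "\<lambda>t. data_size (encode_list enc_ded (raise P G t))"
  let ?m = "max (dep l) (dep r)"
  let ?d = "\<lambda>x. data_size (encode_form x)"
  have N: "?d l + 1 \<le> N" "?d r + 1 \<le> N" "1 \<le> N" using Conj.prems by auto
  have tU: "thr_bound N (dep l) \<le> U" "thr_bound N (dep r) \<le> U"
    using thr_bound_mono[OF N(3), of "dep l" "dep (Conj l r)"] thr_bound_mono[OF N(3), of "dep r" "dep (Conj l r)"]
      le_trans[OF _ Conj.prems(2)] by (simp_all add: le_SucI)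
  have sU: "?d A \<le> U" if "A \<in> set (thr l) \<or> A \<in> set (thr r) \<or> A \<in> set (thr (Conj l r)) \<or> A = FF" for A
  proof -
    have "1 \<le> U" using thr_bound_pos[OF N(3)] tU(1) le_trans by blast
    then have "?d (FF :: 'a form) \<le> U" by simp
    moreover have "?d A \<le> U" if "A \<in> set (thr t)" "?d t + 1 \<le> N" "thr_bound N (dep t) \<le> U" for t
      using thr_elem_size[OF that(1)] thr_size_le[OF that(2)] that(3) by linarith
    ultimately show ?thesis using that N tU Conj.prems
      by (auto simp del: thr.simps encode_form.simps dep.simps)
  qed
  define TX where "TX = triples (thr l) (raise P G l)"
  define TY where "TY = triples (thr r) (raise P G r)"
  note mX = map_triples[OF thr_nonempty length_raise, of l P G, folded TX_def]
  note mY = map_triples[OF thr_nonempty length_raise, of r P G, folded TY_def]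
  have lX: "length TX \<le> N" "length TY \<le> N" using length_thr[of l] length_thr[of r] N mX mY by auto
  define lf where "lf = (P \<in> set (afl l))"
  define \<phi> where "\<phi> = (\<lambda>q :: ('a form \<times> 'a form \<times> 'a ded) \<times> ('a form \<times> 'a form \<times> 'a ded). 2 * B + data_size (enc_ded (snd (snd (fst q)))) + data_size (enc_ded (snd (snd (snd q)))))"
  have one: "data_size (enc_ded (raise_disj P G H (map (raise_pair P G lf H) qs))) \<le> B + (\<Sum>q\<leftarrow>qs. \<phi> q)"
    if qs: "qs \<in> set (conv TX TY)" and H: "H = FF \<or> H \<in> set (thr (Conj l r))" for qs H
  proof -
    have "conv (thr l) (thr r) = map (map (map_prod fst fst)) (conv TX TY)"
      by (subst mX(1)[symmetric], subst mY(1)[symmetric]) (rule conv_map)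
    then have "disj_list (map (\<lambda>(x, y). Conj x y) (map (map_prod fst fst) qs)) \<in> set (thr (Conj l r))" using qs by auto
    then have u: "?d (disj_list (map (\<lambda>(x, y). Conj x y) (map (map_prod fst fst) qs))) \<le> U" using sU by blast
    \<comment> \<open>The disjunction treated here is a threshold with \<open>P\<close> erased, and
      erasing does not increase the size.\<close>
    have e: "disj_list (map fst (map (raise_pair P G lf H) qs)) = erase P (disj_list (map (\<lambda>(x, y). Conj x y) (map (map_prod fst fst) qs)))"
      by (simp add: erase_disj_list o_def raise_pair_def case_prod_beta map_prod_def)
    have "?d (disj_list (map fst (map (raise_pair P G lf H) qs))) \<le> U"
      unfolding e by (rule order_trans[OF data_size_erase u])
    then have "data_size (enc_ded (raise_disj P G H (map (raise_pair P G lf H) qs))) \<le>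
      B + (\<Sum>x\<leftarrow>map (raise_pair P G lf H) qs. data_size (enc_ded (snd x)) + B)"
      using sU H by (intro raise_disj_size[OF nil step]) auto
    also have "(\<Sum>x\<leftarrow>map (raise_pair P G lf H) qs. data_size (enc_ded (snd x)) + B) \<le> (\<Sum>q\<leftarrow>qs. \<phi> q)"
      unfolding map_map o_def
    proof (rule sum_list_mono)
      fix q assume q: "q \<in> set qs"
      then have m: "fst q \<in> set TX" "snd q \<in> set TY" using set_conv_subset[OF qs] by auto
      have t: "data_size (enc_ded (raise_term G d X Y (Conj A C) H)) \<le> data_size (enc_ded d) + B"
        if "?d X \<le> U" "?d Y \<le> U" "?d A \<le> U" "?d C \<le> U" for d X Y A C
      proof -
        have "data_size (enc_ded (raise_term G d X Y (Conj A C) H)) \<le> data_size (enc_ded d) + data_size (enc_ded (raise_term G (Fm FF) X Y (Conj A C) H))"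
          by (simp add: raise_term_def seq_def data_size_tag)
        moreover have "data_size (enc_ded (raise_term G (Fm FF) X Y (Conj A C) H)) \<le> B"
          using that H sU by (intro trm) (auto simp: data_size_tag)
        ultimately show ?thesis by simp
      qed
      have "?d (fst (fst q)) \<le> U" "?d (fst (snd (fst q))) \<le> U" "?d (fst (snd q)) \<le> U" "?d (fst (snd (snd q))) \<le> U"
        using triples_mem[OF m(1)[unfolded TX_def]] triples_mem[OF m(2)[unfolded TY_def]] sU by blast+
      then have "data_size (enc_ded (snd (raise_pair P G lf H q))) \<le>
         data_size (enc_ded (snd (snd (fst q)))) + data_size (enc_ded (snd (snd (snd q)))) + B"
        using t by (auto simp: raise_pair_def intro: order_trans[OF t])
      then show "data_size (enc_ded (snd (raise_pair P G lf H q))) + B \<le> \<phi> q" by (simp add: \<phi>_def)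
    qed
    finally show ?thesis by simp
  qed
  let ?Z = "zip (conv TX TY) (succs (thr (Conj l r)))"
  have T: "TX \<noteq> []" "TY \<noteq> []" using mX(3) mY(3) thr_nonempty[of l] thr_nonempty[of r] by auto
  have lT: "length (conv TX TY) = length TX + length TY - 1" using length_conv[OF T(2), of TX] T(1) by simp
  have lZ: "length (conv TX TY) = length (succs (thr (Conj l r)))"
    using length_succs[OF thr_nonempty[of "Conj l r"]] by (simp only: lT mX(3) mY(3) length_thr_Conj)
  have lC: "length (conv TX TY) \<le> 2 * N" using lX by (simp add: lT)
  have "?R (Conj l r) = 1 + length ?Z + (\<Sum>z\<leftarrow>?Z. data_size (enc_ded (raise_disj P G (snd z) (map (raise_pair P G lf (snd z)) (fst z)))))"
    by (simp add: data_size_encode_list o_def TX_def TY_def lf_def del: thr.simps)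
  also have "(\<Sum>z\<leftarrow>?Z. data_size (enc_ded (raise_disj P G (snd z) (map (raise_pair P G lf (snd z)) (fst z))))) \<le> (\<Sum>z\<leftarrow>?Z. B + (\<Sum>q\<leftarrow>fst z. \<phi> q))"
  proof (intro sum_list_mono one)
    fix z assume z: "z \<in> set ?Z"
    show "fst z \<in> set (conv TX TY)" using z by (metis in_set_zipE prod.collapse)
    have "snd z \<in> set (succs (thr (Conj l r)))" using z by (metis in_set_zipE prod.collapse)
    then show "snd z = FF \<or> snd z \<in> set (thr (Conj l r))" unfolding succs_def by (auto dest: set_tlD simp del: thr.simps)
  qed
  also have "(\<Sum>z\<leftarrow>?Z. B + (\<Sum>q\<leftarrow>fst z. \<phi> q)) = (\<Sum>qs\<leftarrow>map fst ?Z. B + (\<Sum>q\<leftarrow>qs. \<phi> q))" by (simp add: o_def)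
  also have "map fst ?Z = conv TX TY" using lZ by simp
  also have "(\<Sum>qs\<leftarrow>conv TX TY. B + (\<Sum>q\<leftarrow>qs. \<phi> q)) = length (conv TX TY) * B + (\<Sum>qs\<leftarrow>conv TX TY. \<Sum>q\<leftarrow>qs. \<phi> q)"
    by (rule sum_list_const_add)
  also have "(\<Sum>qs\<leftarrow>conv TX TY. \<Sum>q\<leftarrow>qs. \<phi> q) = 2 * B * (length TX * length TY) +
      length TY * (\<Sum>x\<leftarrow>TX. data_size (enc_ded (snd (snd x)))) + length TX * (\<Sum>y\<leftarrow>TY. data_size (enc_ded (snd (snd y))))"
    unfolding \<phi>_def
    by (rule sum_conv_split[of "2 * B" "\<lambda>x. data_size (enc_ded (snd (snd x)))" "\<lambda>x. data_size (enc_ded (snd (snd x)))"])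
  also have "\<dots> \<le> 2 * B * (N * N) + N * ?R l + N * ?R r"
  proof (intro add_mono mult_le_mono lX order_refl)
    have "(\<Sum>x\<leftarrow>TX. data_size (enc_ded (snd (snd x)))) = sum_list (map (\<lambda>d. data_size (enc_ded d)) (map (\<lambda>x. snd (snd x)) TX))" by (simp add: o_def)
    then show "(\<Sum>x\<leftarrow>TX. data_size (enc_ded (snd (snd x)))) \<le> ?R l" unfolding mX(2) data_size_encode_list by simp
    have "(\<Sum>x\<leftarrow>TY. data_size (enc_ded (snd (snd x)))) = sum_list (map (\<lambda>d. data_size (enc_ded d)) (map (\<lambda>x. snd (snd x)) TY))" by (simp add: o_def)
    then show "(\<Sum>x\<leftarrow>TY. data_size (enc_ded (snd (snd x)))) \<le> ?R r" unfolding mY(2) data_size_encode_list by simp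
  qed
  finally have 1: "?R (Conj l r) \<le> 1 + length ?Z + (length (conv TX TY) * B + (2 * B * (N * N) + N * ?R l + N * ?R r))" by simp
  have "length ?Z \<le> 2 * N" using lZ lC by simp
  moreover have "length (conv TX TY) * B \<le> 2 * N * B" using lC by (rule mult_le_mono1)
  moreover have "V = 1 + (2 * N + 2 * N + 2 * N * B) + 2 * B * (N * N)" unfolding V by (simp add: algebra_simps)
  ultimately have 2: "?R (Conj l r) \<le> V + N * ?R l + N * ?R r" using 1 by linarith
  have N3: "1 \<le> 3 * N" using N by simp
  have p: "(3 * N) ^ dep l \<le> (3 * N) ^ ?m" "(3 * N) ^ dep r \<le> (3 * N) ^ ?m" "1 \<le> (3 * N) ^ ?m"
    by (rule power_increasing[OF max.cobounded1 N3], rule power_increasing[OF max.cobounded2 N3], rule one_le_power[OF N3])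
  have "?R l \<le> V * (3 * N) ^ dep l" "?R r \<le> V * (3 * N) ^ dep r" using Conj.IH N tU by auto
  with p(1,2) have "?R l \<le> V * (3 * N) ^ ?m" "?R r \<le> V * (3 * N) ^ ?m" by (meson le_trans mult_le_mono2)+
  then have "N * ?R l \<le> N * (V * (3 * N) ^ ?m)" "N * ?R r \<le> N * (V * (3 * N) ^ ?m)" by (meson mult_le_mono2)+
  moreover have "V * 1 * 1 \<le> V * N * (3 * N) ^ ?m" using N(3) p(3) by (intro mult_le_mono) auto
  moreover have "V * N * (3 * N) ^ ?m = N * (V * (3 * N) ^ ?m)" by (simp only: ac_simps)
  ultimately have "?R (Conj l r) \<le> 3 * (N * (V * (3 * N) ^ ?m))" using 2 by linarith
  also have "\<dots> = V * (3 * N) ^ dep (Conj l r)" by simp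
  finally show ?case .
next
  case (Atom a)
  have "1 * B \<le> (2 * N) * (2 + B)" using Atom by (intro mult_le_mono) auto
  then have "B \<le> V" unfolding V by simp
  then have "data_size (encode_list enc_ded [DOr (Fm P) (weak G), embed P G]) \<le> V" using leaf by linarith
  then show ?case by simp
qed (use V in auto)

section \<open>Programs for the thresholds and the derivations between them\<close>

context sks
begin

lemma comp_terms0: "computable {s. snd s \<in> UNIV} (\<lambda>s :: _ \<times> unit. encode_list (enc_pair encode_form encode_form) (fst s) # [])
   (\<lambda>s. encode_list encode_form (map (\<lambda>q. Conj (fst q) (snd q)) (fst s)))"
  apply (rule comp_map0[where f = "\<lambda>p q. Conj (fst q) (snd q)" and env = "\<lambda>p. []" and n = 0])
   apply (rule comp_vs comp_Conj comp_fst[where ?e1.0 = encode_form and ?e2.0 = encode_form]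
       comp_snd[where ?e1.0 = encode_form and ?e2.0 = encode_form])+
  apply simp
  done

lemma comp_terms: "computable S env (\<lambda>s. encode_list (enc_pair encode_form encode_form) (A s)) \<Longrightarrow>
   computable S env (\<lambda>s. encode_form (disj_list (map (\<lambda>q. Conj (fst q) (snd q)) (A s))))"
  by (rule comp_disj_list[OF comp_call[where \<phi> = "\<lambda>s. (A s, ())", OF _ comp_terms0, of S env, unfolded fst_conv snd_conv]])
    (intro comps_Cons comps_Nil, simp_all)

lemma comp_thr_map0: "computable {s. snd s \<in> UNIV} (\<lambda>s :: _ \<times> unit. encode_list (encode_list (enc_pair encode_form encode_form)) (fst s) # [])
   (\<lambda>s. encode_list encode_form (map (\<lambda>ps. disj_list (map (\<lambda>q. Conj (fst q) (snd q)) ps)) (fst s)))"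
  apply (rule comp_map0[where f = "\<lambda>p ps. disj_list (map (\<lambda>q. Conj (fst q) (snd q)) ps)" and env = "\<lambda>p. []" and n = 0])
   apply (rule comp_vs comp_terms)+
  apply simp
  done

lemma comp_thr_map: "computable S env (\<lambda>s. encode_list (encode_list (enc_pair encode_form encode_form)) (A s)) \<Longrightarrow>
   computable S env (\<lambda>s. encode_list encode_form (map (\<lambda>ps. disj_list (map (\<lambda>q. Conj (fst q) (snd q)) ps)) (A s)))"
  by (rule comp_call[where \<phi> = "\<lambda>s. (A s, ())", OF _ comp_thr_map0, of S env, unfolded fst_conv snd_conv])
    (intro comps_Cons comps_Nil, simp_all)

lemma qb_thr_bound:
  assumes "qb S N (\<lambda>s. data_size (encode_form (t s)))" "\<And>s. s \<in> S \<Longrightarrow> braun (t s)"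
  shows "qb S N (\<lambda>s. thr_bound (data_size (encode_form (t s)) + 1) (dep (t s)))"
  unfolding thr_bound_def
proof (intro qb_intros assms)
  show "qb S N (\<lambda>s. (32 * (data_size (encode_form (t s)) + 1)) ^ dep (t s))"
    by (rule qb_pow[where g = "\<lambda>s. (data_size (encode_form (t s)) + 1) * (data_size (encode_form (t s)) + 1)"])
      (intro qb_intros assms dep_le)+
qed

lemma isC_braun: "isC t \<Longrightarrow> braun t \<Longrightarrow> braun (lft t) \<and> braun (rgt t)"
  by (cases t) auto

text \<open>Sizes multiply from level to level instead of adding up, so the bound is taken from
  \<open>thr_size_le\<close>. It is quasipolynomial when the depth is logarithmic, hence the
  restriction to Braun trees.\<close>

lemma comp_thr0: "computable {t. braun t} (\<lambda>t. [encode_form t]) (\<lambda>t. encode_list encode_form (thr t))"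
proof (rule comp_rec[where nd = isC and cs = "[lft, rgt]" and n = 1 and w = "\<lambda>t. data_size (encode_form t)"], simp_all only: list.map append.simps)
  let ?S = "{t \<in> {t. braun t}. isC t}"
  show "computable {t. braun t} (\<lambda>t. [encode_form t]) (\<lambda>t. truth (isC t))" by (rule comp_vs comp_intro)+
  have "computable {t \<in> {t. braun t}. \<not> isC t} (\<lambda>t. [encode_form t]) (\<lambda>t. encode_list encode_form (if isA t then [TT, t] else [TT]))"
    by (rule comp_vs comp_intro)+
  then show "computable {t \<in> {t. braun t}. \<not> isC t} (\<lambda>t. [encode_form t]) (\<lambda>t. encode_list encode_form (thr t))"
    by (rule comp_cong) (case_tac s, auto)
  have "computable ?S (\<lambda>t. [encode_list encode_form (thr (lft t)), encode_list encode_form (thr (rgt t)), encode_form t])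
     (\<lambda>t. encode_list encode_form (map (\<lambda>ps. disj_list (map (\<lambda>q. Conj (fst q) (snd q)) ps)) (conv (thr (lft t)) (thr (rgt t)))))"
    by (rule comp_vs comp_thr_map comp_conv)+
  then show "computable ?S (\<lambda>t. [encode_list encode_form (thr (lft t)), encode_list encode_form (thr (rgt t)), encode_form t])
     (\<lambda>t. encode_list encode_form (thr t))"
    by (rule comp_cong) (case_tac s, auto simp: case_prod_beta')
  show "computables ?S (\<lambda>t. [encode_form t]) (\<lambda>s. [encode_form (c s)])" if "c \<in> set [lft, rgt]" for c
    using that by (auto intro!: comps_Cons comps_Nil comp_lft comp_rgt comp_v0)
  show "c s \<in> {t. braun t} \<and> esz [encode_form (c s)] \<le> esz [encode_form s]" if "c \<in> set [lft, rgt]" "s \<in> {t. braun t}" "isC s" for c s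
    using that by (cases s) auto
  have "qb {t. braun t} (\<lambda>s. esz [encode_form s]) (\<lambda>s. data_size (encode_form s))"
    using qb_N[of "{t. braun t}" "\<lambda>s. esz [encode_form s]"] by simp
  from qb_thr_bound[OF this]
  show "qb {t. braun t} (\<lambda>s. esz [encode_form s]) (\<lambda>s. data_size (encode_list encode_form (thr s)))"
    by (rule qb_mono) (auto intro: thr_size_le)
  show "1 + sum_list [data_size (encode_form (lft s)), data_size (encode_form (rgt s))] \<le> data_size (encode_form s)" if "isC s" for s
    using that by (cases s) auto
qed (auto simp: data_size_pos[simplified])

lemma comp_thr: "computable S env (\<lambda>s. encode_form (A s)) \<Longrightarrow> (\<And>s. s \<in> S \<Longrightarrow> braun (A s)) \<Longrightarrow> computable S env (\<lambda>s. encode_list encode_form (thr (A s)))"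
  by (rule comp_call[where \<phi> = A, OF _ comp_thr0, of S env]) (intro comps_Cons comps_Nil, simp_all)

lemma comp_raise_pairs0: "computable {s. snd s \<in> UNIV} (\<lambda>s. encode_list enc_item (fst s) # [encode_form (fst (snd s)), encode_form (fst (snd (snd s))), truth (fst (snd (snd (snd s)))), encode_form (snd (snd (snd (snd s))))])
   (\<lambda>s. encode_list (enc_pair encode_form enc_ded) (map (raise_pair (fst (snd s)) (fst (snd (snd s))) (fst (snd (snd (snd s)))) (snd (snd (snd (snd s))))) (fst s)))"
  apply (rule comp_map0[where f = "\<lambda>p. raise_pair (fst p) (fst (snd p)) (fst (snd (snd p))) (snd (snd (snd p)))"
     and env = "\<lambda>p. [encode_form (fst p), encode_form (fst (snd p)), truth (fst (snd (snd p))), encode_form (snd (snd (snd p)))]" and n = 4])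
   apply (rule comp_vs comp_raise_pair)+
  apply simp
  done

lemma comp_raise_pairs [comp_intro]: "computable S env (\<lambda>s. encode_list enc_item (q s)) \<Longrightarrow>
   computable S env (\<lambda>s. encode_form (P s)) \<Longrightarrow>
   computable S env (\<lambda>s. encode_form (G s)) \<Longrightarrow>
   computable S env (\<lambda>s. truth (b s)) \<Longrightarrow>
   computable S env (\<lambda>s. encode_form (H s)) \<Longrightarrow>
   computable S env (\<lambda>s. encode_list (enc_pair encode_form enc_ded) (map (raise_pair (P s) (G s) (b s) (H s)) (q s)))"
  by (rule comp_call[where \<phi> = "\<lambda>s. (q s, P s, G s, b s, H s)", OF _ comp_raise_pairs0, of S env, unfolded fst_conv snd_conv])
    (intro comps_Cons comps_Nil, simp_all)

abbreviation enc_row2 where "enc_row2 \<equiv> enc_pair (encode_list enc_item) encode_form"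

lemma comp_raise_map0: "computable {s. snd s \<in> UNIV} (\<lambda>s. encode_list enc_row2 (fst s) # [encode_form (fst (snd s)), encode_form (fst (snd (snd s))), truth (snd (snd (snd s)))])
   (\<lambda>s. encode_list enc_ded (map (\<lambda>z. raise_disj (fst (snd s)) (fst (snd (snd s))) (snd z) (map (raise_pair (fst (snd s)) (fst (snd (snd s))) (snd (snd (snd s))) (snd z)) (fst z))) (fst s)))"
  apply (rule comp_map0[where f = "\<lambda>p z. raise_disj (fst p) (fst (snd p)) (snd z) (map (raise_pair (fst p) (fst (snd p)) (snd (snd p)) (snd z)) (fst z))"
     and env = "\<lambda>p. [encode_form (fst p), encode_form (fst (snd p)), truth (snd (snd p))]" and n = 3])
   apply (rule comp_vs comp_raise_disj comp_raise_pairs comp_fst[where ?e1.0 = "encode_list enc_item" and ?e2.0 = encode_form]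
       comp_snd[where ?e1.0 = "encode_list enc_item" and ?e2.0 = encode_form])+
  apply simp
  done

lemma comp_raise_map [comp_intro]: "computable S env (\<lambda>s. encode_list enc_row2 (q s)) \<Longrightarrow>
   computable S env (\<lambda>s. encode_form (P s)) \<Longrightarrow>
   computable S env (\<lambda>s. encode_form (G s)) \<Longrightarrow>
   computable S env (\<lambda>s. truth (b s)) \<Longrightarrow>
   computable S env (\<lambda>s. encode_list enc_ded (map (\<lambda>z. raise_disj (P s) (G s) (snd z) (map (raise_pair (P s) (G s) (b s) (snd z)) (fst z))) (q s)))"
  by (rule comp_call[where \<phi> = "\<lambda>s. (q s, P s, G s, b s)", OF _ comp_raise_map0, of S env, unfolded fst_conv snd_conv])
    (intro comps_Cons comps_Nil, simp_all)


text \<open>The number \<open>B\<close> of \<open>raise_size\<close> is not calculated: the four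
  kinds of local piece are computable, so \<open>comp_qb\<close> bounds them by some
  \<open>bd\<close> of the sizes of their arguments.\<close>

lemma qb_raise:
  fixes P G t :: "'s \<Rightarrow> 'a form"
  assumes t: "qb S N (\<lambda>s. data_size (encode_form (t s)))" and br: "\<And>s. s \<in> S \<Longrightarrow> braun (t s)"
    and P: "qb S N (\<lambda>s. data_size (encode_form (P s)))" and G: "qb S N (\<lambda>s. data_size (encode_form (G s)))"
  shows "qb S N (\<lambda>s. data_size (encode_list enc_ded (raise (P s) (G s) (t s))))"
proof -
  let ?n = "\<lambda>s. data_size (encode_form (t s)) + 1"
  let ?U = "\<lambda>s. thr_bound (?n s) (dep (t s))"
  let ?E5 = "\<lambda>s :: 'a form \<times> 'a form \<times> 'a form \<times> 'a form \<times> 'a form. [encode_form (fst s), encode_form (fst (snd s)), encode_form (fst (snd (snd s))), encode_form (fst (snd (snd (snd s)))), encode_form (snd (snd (snd (snd s))))]"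
  have qU: "qb S N ?U" by (rule qb_thr_bound[OF t br])
  have "computable UNIV ?E5 (\<lambda>s. enc_ded (raise_disj (fst s) (fst (snd s)) (fst (snd (snd s))) []))"
    unfolding raise_disj.simps by (rule comp_vs comp_intro)+
  from comp_qb[OF this] obtain k1 where k1: "\<And>s. data_size (enc_ded (raise_disj (fst s) (fst (snd s)) (fst (snd (snd s))) [])) \<le> bd k1 (esz (?E5 s))"
    unfolding qb_def by blast
  have "computable UNIV ?E5 (\<lambda>s. enc_ded (raise_disj_step (fst s) (fst (snd s)) (fst (snd (snd s))) (fst (snd (snd (snd s)))) (snd (snd (snd (snd s))))))"
    by (rule comp_vs comp_raise_disj_step)+
  from comp_qb[OF this] obtain k2 where k2: "\<And>s. data_size (enc_ded (raise_disj_step (fst s) (fst (snd s)) (fst (snd (snd s))) (fst (snd (snd (snd s)))) (snd (snd (snd (snd s)))))) \<le> bd k2 (esz (?E5 s))"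
    unfolding qb_def by blast
  have "computable UNIV ?E5 (\<lambda>s. enc_ded (raise_term (fst s) (Fm FF) (fst (snd s)) (fst (snd (snd s))) (fst (snd (snd (snd s)))) (snd (snd (snd (snd s))))))"
    by (rule comp_vs comp_raise_term comp_Fm comp_FF)+
  from comp_qb[OF this] obtain k3 where k3: "\<And>s. data_size (enc_ded (raise_term (fst s) (Fm FF) (fst (snd s)) (fst (snd (snd s))) (fst (snd (snd (snd s)))) (snd (snd (snd (snd s)))))) \<le> bd k3 (esz (?E5 s))"
    unfolding qb_def by blast
  have "computable UNIV ?E5 (\<lambda>s. encode_list enc_ded [DOr (Fm (fst s)) (weak (fst (snd s))), embed (fst s) (fst (snd s))])"
    by (rule comp_vs comp_intro)+
  from comp_qb[OF this] obtain k4 where k4: "\<And>s. data_size (encode_list enc_ded [DOr (Fm (fst s)) (weak (fst (snd s))), embed (fst s) (fst (snd s))]) \<le> bd k4 (esz (?E5 s))"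
    unfolding qb_def by blast
  define K where "K = k1 + k2 + k3 + k4"
  \<comment> \<open>Bounds the total size of the arguments of every piece. The coefficient 5 stems
    from \<open>raise_term\<close>: \<open>X\<close>, \<open>Y\<close> and \<open>H\<close> count
    \<open>U\<close> each, and \<open>A\<close> counts \<open>7 + 2 * U\<close>.\<close>
  define z where "z = (\<lambda>s. data_size (encode_form (P s)) + data_size (encode_form (G s)) + 5 * ?U s + 10)"
  define B where "B = (\<lambda>s. bd K (z s))"
  define V where "V = (\<lambda>s. 1 + 2 * ?n s * (2 + B s) + ?n s * ?n s * (2 * B s))"
  have qB: "qb S N B" unfolding B_def z_def by (intro qb_intros P G qU)
  have qV: "qb S N V" unfolding V_def by (intro qb_intros t qB)
  have "qb S N (\<lambda>s. (3 * ?n s) ^ dep (t s))"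
    by (rule qb_pow[where g = "\<lambda>s. ?n s * ?n s"]) (intro qb_intros t br dep_le)+
  then have "qb S N (\<lambda>s. V s * (3 * ?n s) ^ dep (t s))" by (intro qb_mult qV)
  then show ?thesis
  proof (rule qb_mono)
    fix s assume "s \<in> S"
    let ?d = "\<lambda>A. data_size (encode_form A)"
    show "data_size (encode_list enc_ded (raise (P s) (G s) (t s))) \<le> V s * (3 * ?n s) ^ dep (t s)"
    proof (rule raise_size[where U = "?U s" and B = "B s"])
      show "V s = 1 + 2 * ?n s * (2 + B s) + ?n s * ?n s * (2 * B s)" by (simp add: V_def)
      show "data_size (enc_ded (raise_disj (P s) (G s) H [])) \<le> B s" if "?d H \<le> ?U s" for H
        unfolding B_def by (rule order_trans[OF k1[of "(P s, G s, H, FF, FF)", unfolded fst_conv snd_conv] bd_mono]) (use that in \<open>auto simp: K_def z_def\<close>)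
      show "data_size (enc_ded (seq (DAnd (cocontr (P s)) (Fm (Disj A C))) (seq (distr (P s) A C) (seq (DOr (Fm FF) (Fm FF)) (contr (Disj H (G s))))))) \<le> B s"
        if "?d H \<le> ?U s" "?d A \<le> ?U s" "?d C \<le> ?U s" for H A C
        unfolding B_def raise_disj_step_def[symmetric] by (rule order_trans[OF k2[of "(P s, G s, H, A, C)", unfolded fst_conv snd_conv] bd_mono]) (use that in \<open>auto simp: K_def z_def\<close>)
      show "data_size (enc_ded (raise_term (G s) (Fm FF) X Y A H)) \<le> B s"
        if "?d X \<le> ?U s" "?d Y \<le> ?U s" "?d A \<le> 7 + 2 * ?U s" "?d H \<le> ?U s" for X Y A H
        unfolding B_def by (rule order_trans[OF k3[of "(G s, X, Y, A, H)", unfolded fst_conv snd_conv] bd_mono]) (use that in \<open>auto simp: K_def z_def\<close>)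
      show "data_size (encode_list enc_ded [DOr (Fm (P s)) (weak (G s)), embed (P s) (G s)]) \<le> B s"
        unfolding B_def by (rule order_trans[OF k4[of "(P s, G s, FF, FF, FF)", unfolded fst_conv snd_conv] bd_mono]) (auto simp: K_def z_def)
    qed auto
  qed
qed

text \<open>The thresholds needed at a node are recomputed there from the tree, so only the lists of
  derivations are passed upwards.\<close>

lemma comp_raise0: "computable {s. braun (fst s)} (\<lambda>s. [encode_form (fst s), encode_form (fst (snd s)), encode_form (snd (snd s))])
   (\<lambda>s. encode_list enc_ded (raise (fst (snd s)) (snd (snd s)) (fst s)))"
proof (rule comp_rec[where nd = "\<lambda>s. isC (fst s)" and cs = "[\<lambda>s. (lft (fst s), snd s), \<lambda>s. (rgt (fst s), snd s)]" and n = 3 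
      and w = "\<lambda>s. data_size (encode_form (fst s))"], simp_all only: list.map append.simps fst_conv snd_conv)
  let ?B = "{s :: 'a form \<times> 'a form \<times> 'a form. braun (fst s)}"
  let ?Node = "{s \<in> ?B. isC (fst s)}" and ?Leaf = "{s \<in> ?B. \<not> isC (fst s)}"
  let ?env = "\<lambda>s. [encode_form (fst s), encode_form (fst (snd s)), encode_form (snd (snd s))]"
  let ?g = "\<lambda>s. encode_list enc_ded (raise (fst (snd s)) (snd (snd s)) (fst s))"
  let ?R = "\<lambda>s t. encode_list enc_ded (raise (fst (snd s)) (snd (snd s)) t)"
  show "computable ?B ?env (\<lambda>s. truth (isC (fst s)))" by (rule comp_vs comp_intro)+
  have "computable ?Leaf ?env (\<lambda>s. encode_list enc_ded (if isA (fst s) then [DOr (Fm (fst (snd s))) (weak (snd (snd s))), embed (fst (snd s)) (snd (snd s))] else [Fm FF]))"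
    by (rule comp_vs comp_intro)+
  then show "computable ?Leaf ?env ?g"
    by (rule comp_cong) (case_tac "fst s", auto)
  let ?Env = "\<lambda>s. [?R s (lft (fst s)), ?R s (rgt (fst s)), encode_form (fst s), encode_form (fst (snd s)), encode_form (snd (snd s))]"
  let ?z = "\<lambda>s. zip (conv (triples (thr (lft (fst s))) (raise (fst (snd s)) (snd (snd s)) (lft (fst s)))) (triples (thr (rgt (fst s))) (raise (fst (snd s)) (snd (snd s)) (rgt (fst s))))) (succs (thr (fst s)))"
  have thrs: "computable ?Node ?Env (\<lambda>s. encode_list encode_form (thr (lft (fst s))))"
    by (rule comp_thr[OF comp_lft[OF comp_v2]]) (use isC_braun in auto)
  have thrs2: "computable ?Node ?Env (\<lambda>s. encode_list encode_form (thr (rgt (fst s))))"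
    by (rule comp_thr[OF comp_rgt[OF comp_v2]]) (use isC_braun in auto)
  have thrs3: "computable ?Node ?Env (\<lambda>s. encode_list encode_form (thr (fst s)))"
    by (rule comp_thr[OF comp_v2]) auto
  have "computable ?Node ?Env (\<lambda>s. encode_list enc_ded (map (\<lambda>z. raise_disj (fst (snd s)) (snd (snd s)) (snd z)
      (map (raise_pair (fst (snd s)) (snd (snd s)) (fst (snd s) \<in> set (afl (lft (fst s)))) (snd z)) (fst z))) (?z s)))"
    by (rule comp_vs comp_raise_map comp_zip comp_conv comp_triples comp_succs thrs thrs2 thrs3 comp_mem comp_afl comp_lft)+
  then show "computable ?Node ?Env ?g"
    by (rule comp_cong) (case_tac "fst s", auto simp del: thr.simps)
  show "computables ?Node ?env (\<lambda>s. [encode_form (fst (c s)), encode_form (fst (snd (c s))), encode_form (snd (snd (c s)))])"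
    if "c \<in> set [\<lambda>s. (lft (fst s), snd s), \<lambda>s. (rgt (fst s), snd s)]" for c
  proof -
    have "computables ?Node ?env (\<lambda>s. [encode_form (lft (fst s)), encode_form (fst (snd s)), encode_form (snd (snd s))])"
      "computables ?Node ?env (\<lambda>s. [encode_form (rgt (fst s)), encode_form (fst (snd s)), encode_form (snd (snd s))])"
      by (rule comps_Cons comps_Nil comp_vs comp_lft comp_rgt)+
    then show ?thesis using that by auto
  qed
  show "c s \<in> ?B \<and> esz [encode_form (fst (c s)), encode_form (fst (snd (c s))), encode_form (snd (snd (c s)))] \<le> esz (?env s)"
    if "c \<in> set [\<lambda>s. (lft (fst s), snd s), \<lambda>s. (rgt (fst s), snd s)]" "s \<in> ?B" "isC (fst s)" for c s
    using that by (cases "fst s") auto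
  have q: "qb ?B (\<lambda>s. esz (?env s)) (\<lambda>s. data_size (encode_form (fst s)))" "qb ?B (\<lambda>s. esz (?env s)) (\<lambda>s. data_size (encode_form (fst (snd s))))"
    "qb ?B (\<lambda>s. esz (?env s)) (\<lambda>s. data_size (encode_form (snd (snd s))))"
    by (rule qb_mono[OF qb_N], simp)+
  show "qb ?B (\<lambda>s. esz (?env s)) (\<lambda>s. data_size (?g s))"
    by (rule qb_raise[OF q(1) _ q(2,3)]) simp
  show "1 + sum_list [data_size (encode_form (lft (fst s))), data_size (encode_form (rgt (fst s)))] \<le> data_size (encode_form (fst s))" if "isC (fst s)" for s :: "'a form \<times> 'a form \<times> 'a form"
    using that by (cases "fst s") auto
qed (auto simp: data_size_pos[simplified])

lemma comp_raise: "computable S env (\<lambda>s. encode_form (P s)) \<Longrightarrow> computable S env (\<lambda>s. encode_form (G s)) \<Longrightarrow> computable S env (\<lambda>s. encode_form (A s)) \<Longrightarrow>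
   (\<And>s. s \<in> S \<Longrightarrow> braun (A s)) \<Longrightarrow> computable S env (\<lambda>s. encode_list enc_ded (raise (P s) (G s) (A s)))"
  by (rule comp_call[where \<phi> = "\<lambda>s. (A s, P s, G s)", OF _ comp_raise0, of S env, unfolded fst_conv snd_conv])
    (intro comps_Cons comps_Nil, simp_all)

lemma comp_cut_table0: "computable {s. snd s \<in> {p. braun (snd p)}} (\<lambda>s. encode_list encode_form (fst s) # [encode_form (fst (snd s)), encode_form (snd (snd s))])
   (\<lambda>s. encode_list enc_row (map (\<lambda>P. (P, rev (raise P (fst (snd s)) (snd (snd s))))) (fst s)))"
  apply (rule comp_map0[where f = "\<lambda>p P. (P, rev (raise P (fst p) (snd p)))" and env = "\<lambda>p. [encode_form (fst p), encode_form (snd p)]" and n = 2])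
   apply ((rule comp_vs comp_pair comp_rev comp_raise)+)[1]
   apply simp_all
  done

lemma comp_cut_table: "computable S env (\<lambda>s. encode_form (G s)) \<Longrightarrow> computable S env (\<lambda>s. encode_form (t s)) \<Longrightarrow> computable S env (\<lambda>s. encode_list encode_form (A s)) \<Longrightarrow>
   (\<And>s. s \<in> S \<Longrightarrow> braun (t s)) \<Longrightarrow> computable S env (\<lambda>s. encode_list enc_row (cut_table (G s) (t s) (A s)))"
  unfolding cut_table_def
  by (rule comp_call[where \<phi> = "\<lambda>s. (A s, G s, t s)", OF _ comp_cut_table0, of S env, unfolded fst_conv snd_conv])
    (intro comps_Cons comps_Nil, simp_all)

lemma braun_atree_ors: "braun (atree (ors (afl A)))"
  using atree_props[of "ors (afl A)"] ors_subset[of "afl A"] afl_Atom[of _ A] by blast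

lemma comp_normal0: "computable UNIV (\<lambda>s. [encode_list (enc_pair encode_rule encode_form) s]) (\<lambda>s. enc_ded (normal s))"
  unfolding normal_def normal_from_def
  by (rule comp_vs comp_cut_table comp_thr braun_atree_ors comp_intro)+

end

section \<open>Flattening open deductions into derivations\<close>

fun isFm :: "'a ded \<Rightarrow> bool" where "isFm (Fm A) \<longleftrightarrow> True" | "isFm _ \<longleftrightarrow> False"

fun ded1 :: "'a ded \<Rightarrow> 'a ded" where
  "ded1 (DOr d e) = d" | "ded1 (DAnd d e) = d" | "ded1 (DSeq r d e) = d" | "ded1 (Fm A) = Fm A"

fun ded2 :: "'a ded \<Rightarrow> 'a ded" where
  "ded2 (DOr d e) = e" | "ded2 (DAnd d e) = e" | "ded2 (DSeq r d e) = e" | "ded2 (Fm A) = Fm A"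

fun ded_rule :: "'a ded \<Rightarrow> rule" where
  "ded_rule (DSeq r d e) = r" | "ded_rule _ = Equality"

fun ded_form :: "'a ded \<Rightarrow> 'a form" where
  "ded_form (Fm A) = A" | "ded_form _ = FF"

lemma tag_simps: "tag 1 = Node Null Null" "tag 2 = Node Null (Node Null Null)" "tag 3 = Node Null (Node Null (Node Null Null))"
  by (simp_all add: numeral_2_eq_2 numeral_3_eq_3)

context sks
begin

lemma comp_ded_rec:
  fixes g :: "'a ded \<Rightarrow> 'a data"
  assumes Fm: "computable UNIV (\<lambda>A. [encode_form A]) (\<lambda>A. g (Fm A))"
    and DOr: "computable UNIV (\<lambda>s. [g (fst s), g (snd s), enc_ded (fst s), enc_ded (snd s)]) (\<lambda>s. g (DOr (fst s) (snd s)))"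
    and DAnd: "computable UNIV (\<lambda>s. [g (fst s), g (snd s), enc_ded (fst s), enc_ded (snd s)]) (\<lambda>s. g (DAnd (fst s) (snd s)))"
    and DSeq: "computable UNIV (\<lambda>s. [g (fst (snd s)), g (snd (snd s)), encode_rule (fst s), enc_ded (fst (snd s)), enc_ded (snd (snd s))])
        (\<lambda>s. g (DSeq (fst s) (fst (snd s)) (snd (snd s))))"
    and size: "qb UNIV (\<lambda>d. data_size (enc_ded d)) (\<lambda>d. data_size (g d))"
  shows "computable UNIV (\<lambda>d. [enc_ded d]) g"
proof (rule comp_rec[where nd = "\<lambda>d. \<not> isFm d" and cs = "[ded1, ded2]" and n = 1 and w = "\<lambda>d. data_size (enc_ded d)"], simp_all only: list.map append.simps)
  let ?Node = "{d \<in> UNIV. \<not> isFm d}" and ?Leaf = "{d \<in> UNIV. \<not> \<not> isFm d}"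
  let ?env = "\<lambda>d :: 'a ded. [enc_ded d]" and ?Env = "\<lambda>d. [g (ded1 d), g (ded2 d), enc_ded d]"
  let ?tg = "\<lambda>d :: 'a ded. data_fst (enc_ded d)"
  have Fm_iff: "?tg d = Null \<longleftrightarrow> isFm d" for d by (cases d) (auto simp: tag_simps)
  have Fm_eq: "isFm d \<Longrightarrow> data_snd (enc_ded d) = encode_form (ded_form d)" "isFm d \<Longrightarrow> Fm (ded_form d) = d" for d :: "'a ded"
    by (cases d; simp)+
  have seq_eq: "\<not> isFm d \<Longrightarrow> ?tg d = tag 3 \<Longrightarrow> data_snd (data_snd (enc_ded d)) = Node (enc_ded (ded1 d)) (enc_ded (ded2 d)) \<and>
      data_fst (data_snd (enc_ded d)) = encode_rule (ded_rule d) \<and> DSeq (ded_rule d) (ded1 d) (ded2 d) = d" for d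
    by (cases d) (auto simp: tag_simps)
  have nseq_eq: "\<not> isFm d \<Longrightarrow> ?tg d \<noteq> tag 3 \<Longrightarrow> data_snd (enc_ded d) = Node (enc_ded (ded1 d)) (enc_ded (ded2 d)) \<and>
      (?tg d = tag 1 \<longrightarrow> DOr (ded1 d) (ded2 d) = d) \<and> (?tg d \<noteq> tag 1 \<longrightarrow> DAnd (ded1 d) (ded2 d) = d)" for d
    by (cases d) (auto simp: tag_simps)
  have "computable UNIV ?env (\<lambda>d. if ?tg d = Null then Null else Node Null Null)"
    by (intro comp_if comp_Eq comp_Fst comp_Null comp_Node comp_v0)
  then show "computable UNIV ?env (\<lambda>d. truth (\<not> isFm d))"
    by (rule comp_cong) (simp add: truth_def Fm_iff)
  have "computable ?Leaf ?env (\<lambda>d. encode_form (ded_form d))"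
    by (rule comp_cong[OF comp_Snd[OF comp_v0]]) (simp add: Fm_eq)
  from comp_call[OF comps_Cons[OF this comps_Nil] Fm] have "computable ?Leaf ?env (\<lambda>d. g (Fm (ded_form d)))" by simp
  then show "computable ?Leaf ?env g" by (rule comp_cong) (simp add: Fm_eq)
  \<comment> \<open>\<open>DSeq\<close> stores its rule in front of the children, so their pair sits
    one level deeper than in the other two cases.\<close>
  define arg where "arg = (\<lambda>d. if ?tg d = tag 3 then data_snd (data_snd (enc_ded d)) else data_snd (enc_ded d))"
  have a: "computable ?Node ?Env arg" "computable ?Node ?env arg"
    unfolding arg_def by (intro comp_if comp_Eq comp_Fst comp_Snd comp_tag comp_v0 comp_v2)+
  have arg: "Node (enc_ded (ded1 d)) (enc_ded (ded2 d)) = arg d" if "d \<in> ?Node" for d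
    using that seq_eq nseq_eq by (auto simp: arg_def)
  have argE: "computable ?Node ?Env (\<lambda>d. Node (enc_ded (ded1 d)) (enc_ded (ded2 d)))"
    by (rule comp_cong[OF a(1) arg])
  have arg0: "computable ?Node ?env (\<lambda>d. Node (enc_ded (ded1 d)) (enc_ded (ded2 d)))"
    by (rule comp_cong[OF a(2) arg])
  have d12: "computable T ?Env (\<lambda>d. enc_ded (ded1 d))" "computable T ?Env (\<lambda>d. enc_ded (ded2 d))" if "T \<subseteq> ?Node" for T
    using comp_subset[OF comp_Fst[OF argE] that] comp_subset[OF comp_Snd[OF argE] that] by simp_all
  have DO: "computable T ?Env (\<lambda>d. g (DOr (ded1 d) (ded2 d)))" if "T \<subseteq> ?Node" for T
    by (rule comp_call[where \<phi> = "\<lambda>d. (ded1 d, ded2 d)", OF _ DOr, of T ?Env, unfolded fst_conv snd_conv])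
      (intro comps_Cons comps_Nil comp_v0 comp_v1 d12 that, simp)
  have DA: "computable T ?Env (\<lambda>d. g (DAnd (ded1 d) (ded2 d)))" if "T \<subseteq> ?Node" for T
    by (rule comp_call[where \<phi> = "\<lambda>d. (ded1 d, ded2 d)", OF _ DAnd, of T ?Env, unfolded fst_conv snd_conv])
      (intro comps_Cons comps_Nil comp_v0 comp_v1 d12 that, simp)
  let ?Seq = "{d \<in> ?Node. ?tg d = tag 3}"
  have "computable ?Seq ?Env (\<lambda>d. encode_rule (ded_rule d))"
    by (rule comp_cong[OF comp_Fst[OF comp_Snd[OF comp_v2]]]) (use seq_eq in auto)
  then have "computables ?Seq ?Env (\<lambda>d. [g (ded1 d), g (ded2 d), encode_rule (ded_rule d), enc_ded (ded1 d), enc_ded (ded2 d)])"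
    by (intro comps_Cons comps_Nil comp_v0 comp_v1 d12) auto
  from comp_call[where \<phi> = "\<lambda>d. (ded_rule d, ded1 d, ded2 d)", OF _ DSeq, of ?Seq ?Env, unfolded fst_conv snd_conv, OF this]
  have DS: "computable ?Seq ?Env (\<lambda>d. g (DSeq (ded_rule d) (ded1 d) (ded2 d)))" by simp
  have "computable ?Node ?Env (\<lambda>d. if ?tg d = tag 3 then g (DSeq (ded_rule d) (ded1 d) (ded2 d)) else
      if ?tg d = tag 1 then g (DOr (ded1 d) (ded2 d)) else g (DAnd (ded1 d) (ded2 d)))"
    by (intro comp_if comp_Eq comp_Fst comp_tag comp_v2 DS DO DA) auto
  then show "computable ?Node ?Env g"
    by (rule comp_cong) (use seq_eq nseq_eq in auto)
  show "computables ?Node ?env (\<lambda>s. [enc_ded (c s)])" if "c \<in> set [ded1, ded2]" for c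
    using that comp_Fst[OF arg0] comp_Snd[OF arg0] by (auto intro!: comps_Cons comps_Nil)
  show "c s \<in> UNIV \<and> esz [enc_ded (c s)] \<le> esz [enc_ded s]" if "c \<in> set [ded1, ded2]" for c s
    using that by (cases s) auto
  show "1 + sum_list [data_size (enc_ded (ded1 s)), data_size (enc_ded (ded2 s))] \<le> data_size (enc_ded s)" if "\<not> isFm s" for s :: "'a ded"
    using that by (cases s) auto
  show "qb UNIV (\<lambda>s. esz [enc_ded s]) (\<lambda>s. data_size (g s))" using size by simp
qed (auto simp: data_size_pos[simplified])

lemma pr_cn_size: "data_size (encode_form (pr d)) \<le> data_size (enc_ded d)" "data_size (encode_form (cn d)) \<le> data_size (enc_ded d)"
  by (induction d) (auto simp: data_size_tag)

lemma comp_pr0: "computable UNIV (\<lambda>d. [enc_ded d]) (\<lambda>d. encode_form (pr d))"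
  by (rule comp_ded_rec; (simp only: pr.simps)?; (rule comp_vs comp_intro qb_mono[OF qb_N pr_cn_size(1)])+)

lemma comp_cn0: "computable UNIV (\<lambda>d. [enc_ded d]) (\<lambda>d. encode_form (cn d))"
  by (rule comp_ded_rec; (simp only: cn.simps)?; (rule comp_vs comp_intro qb_mono[OF qb_N pr_cn_size(2)])+)

lemma comp_pr [comp_intro]: "computable S env (\<lambda>s. enc_ded (d s)) \<Longrightarrow> computable S env (\<lambda>s. encode_form (pr (d s)))"
  by (rule comp_call[where \<phi> = d, OF _ comp_pr0, of S env]) (intro comps_Cons comps_Nil, simp_all)

lemma comp_cn [comp_intro]: "computable S env (\<lambda>s. enc_ded (d s)) \<Longrightarrow> computable S env (\<lambda>s. encode_form (cn (d s)))"
  by (rule comp_call[where \<phi> = d, OF _ comp_cn0, of S env]) (intro comps_Cons comps_Nil, simp_all)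

abbreviation enc_steps where "enc_steps \<equiv> encode_list (enc_pair encode_rule encode_form)"

lemma comp_map_ctxt:
  assumes f: "computable UNIV (\<lambda>s. [enc_pair encode_rule encode_form (fst s), encode_form (snd s)])
      (\<lambda>s. encode_form (f (snd s) (snd (fst s))))"
    and xs: "computable S env (\<lambda>s. enc_steps (xs s))" and A: "computable S env (\<lambda>s. encode_form (A s))"
  shows "computable S env (\<lambda>s. enc_steps (map (\<lambda>(r, C). (r, f (A s) C)) (xs s)))"
proof -
  have "computable {s. snd s \<in> UNIV} (\<lambda>s. enc_steps (fst s) # [encode_form (snd s)])
   (\<lambda>s. enc_steps (map (\<lambda>q. (fst q, f (snd s) (snd q))) (fst s)))"
  proof (rule comp_map0[where f = "\<lambda>A q. (fst q, f A (snd q))" and env = "\<lambda>p. [encode_form p]" and n = 1])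
    show "computable {s. snd s \<in> UNIV} (\<lambda>s. [enc_pair encode_rule encode_form (fst s), encode_form (snd s)])
      (\<lambda>s. enc_pair encode_rule encode_form (fst (fst s), f (snd s) (snd (fst s))))"
      by (intro comp_pair comp_fst_step comp_v0 comp_subset[OF f]) simp
  qed simp
  from comp_call[where \<phi> = "\<lambda>s. (xs s, A s)", OF _ this, of S env, unfolded fst_conv snd_conv]
  have "computable S env (\<lambda>s. enc_steps (map (\<lambda>q. (fst q, f (A s) (snd q))) (xs s)))"
    using xs A by (simp add: comps_Cons comps_Nil)
  then show ?thesis by (simp add: case_prod_beta')
qed

lemma comp_map_ctxts:
  assumes "computable S env (\<lambda>s. enc_steps (xs s))" "computable S env (\<lambda>s. encode_form (A s))"
  shows "computable S env (\<lambda>s. enc_steps (map (\<lambda>(r, C). (r, Disj C (A s))) (xs s)))"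
    "computable S env (\<lambda>s. enc_steps (map (\<lambda>(r, C). (r, Disj (A s) C)) (xs s)))"
    "computable S env (\<lambda>s. enc_steps (map (\<lambda>(r, C). (r, Conj C (A s))) (xs s)))"
    "computable S env (\<lambda>s. enc_steps (map (\<lambda>(r, C). (r, Conj (A s) C)) (xs s)))"
  by (rule comp_map_ctxt[OF _ assms], (rule comp_v1 comp_Disj comp_Conj comp_snd_step comp_v0)+)+

lemma length_steps: "length (steps d) \<le> data_size (enc_ded d)"
  by (induction d) auto

text \<open>A line of the chain is a horizontal cut through the deduction: each component
  contributes one of its own lines, its premiss or its conclusion.\<close>

lemma steps_line_size: "x \<in> set (steps d) \<Longrightarrow> data_size (encode_form (snd x)) \<le> data_size (enc_ded d)"
proof (induction d arbitrary: x)
  case (DOr d e)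
  from DOr.prems consider y where "y \<in> set (steps d)" "snd x = Disj (snd y) (pr e)" | y where "y \<in> set (steps e)" "snd x = Disj (cn d) (snd y)"
    by auto
  then show ?case
  proof cases
    case 1
    then show ?thesis using DOr.IH(1)[of y] pr_cn_size(1)[of e] by (simp add: data_size_tag)
  next
    case 2
    then show ?thesis using DOr.IH(2)[of y] pr_cn_size(2)[of d] by (simp add: data_size_tag)
  qed
next
  case (DAnd d e)
  from DAnd.prems consider y where "y \<in> set (steps d)" "snd x = Conj (snd y) (pr e)" | y where "y \<in> set (steps e)" "snd x = Conj (cn d) (snd y)"
    by auto
  then show ?case
  proof cases
    case 1
    then show ?thesis using DAnd.IH(1)[of y] pr_cn_size(1)[of e] by (simp add: data_size_tag)
  next
    case 2
    then show ?thesis using DAnd.IH(2)[of y] pr_cn_size(2)[of d] by (simp add: data_size_tag)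
  qed
next
  case (DSeq r d e)
  from DSeq.prems consider "x \<in> set (steps d)" | "x = (r, pr e)" | "x \<in> set (steps e)" by auto
  then show ?case
    using DSeq.IH[of x] pr_cn_size(1)[of e] by cases auto
qed simp

text \<open>The number of lines and the size of a line are both bounded by the deduction, so
  flattening is quadratic; the 20 covers the rule name and the list cell.\<close>

lemma steps_size:
  fixes d :: "'a ded"
  shows "data_size (enc_steps (steps d)) \<le> 1 + data_size (enc_ded d) * (data_size (enc_ded d) + 20)"
proof -
  let ?n = "data_size (enc_ded d)"
  have "data_size (enc_steps (steps d)) = 1 + (\<Sum>x\<leftarrow>steps d. 1 + data_size (enc_pair encode_rule encode_form x))"
    by (simp only: data_size_encode_list sum_list_const_add mult_1_right add.assoc)
  also have "(\<Sum>x\<leftarrow>steps d. 1 + data_size (enc_pair encode_rule encode_form x)) \<le> (\<Sum>x\<leftarrow>steps d. ?n + 20)"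
  proof (rule sum_list_mono)
    fix x assume "x \<in> set (steps d)"
    then show "1 + data_size (enc_pair encode_rule encode_form x) \<le> ?n + 20"
      using steps_line_size[of x d] data_size_rule[where r = "fst x" and ?'a = 'a] by (simp add: enc_pair_fst_snd)
  qed
  also have "\<dots> = length (steps d) * (?n + 20)" by (simp only: sum_list_triv of_nat_id)
  also have "\<dots> \<le> ?n * (?n + 20)" using length_steps by (rule mult_le_mono1)
  finally show ?thesis by simp
qed

lemma comp_steps0: "computable UNIV (\<lambda>d. [enc_ded d]) (\<lambda>d. enc_steps (steps d))"
proof (rule comp_ded_rec; (simp only: steps.simps)?)
  show "qb UNIV (\<lambda>d :: 'a ded. data_size (enc_ded d)) (\<lambda>d. data_size (enc_steps (steps d)))"
  proof (rule qb_mono)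
    show "qb UNIV (\<lambda>d :: 'a ded. data_size (enc_ded d)) (\<lambda>d. 1 + data_size (enc_ded d) * (data_size (enc_ded d) + 20))"
      by (intro qb_add qb_mult qb_const qb_N)
  qed (rule steps_size)
qed (rule comp_vs comp_append comp_Cons comp_pair comp_map_ctxts comp_Nil comp_pr comp_cn)+

lemma comp_steps: "computable S env (\<lambda>s. enc_ded (d s)) \<Longrightarrow> computable S env (\<lambda>s. enc_steps (steps (d s)))"
  by (rule comp_call[where \<phi> = d, OF _ comp_steps0, of S env]) (intro comps_Cons comps_Nil, simp_all)

lemma enc_step_eq: "(\<lambda>(\<rho>, \<beta>). Node (encode_rule \<rho>) (encode_form \<beta>)) = enc_pair encode_rule encode_form"
  by (auto simp: fun_eq_iff)

lemma encode_deriv_eq: "encode_deriv \<Pi> = Node (encode_form (fst \<Pi>)) (enc_steps (snd \<Pi>))"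
  by (simp only: encode_deriv_def enc_step_eq)

lemma comp_normal: "computable UNIV (\<lambda>\<Pi>. [encode_deriv \<Pi>]) (\<lambda>\<Pi>. encode_deriv (TT, steps (normal (snd \<Pi>))))"
proof -
  have "computable UNIV (\<lambda>\<Pi>. [encode_deriv \<Pi>]) (\<lambda>\<Pi>. enc_steps (snd \<Pi>))"
  proof -
    have 1: "computable UNIV (\<lambda>\<Pi>. [encode_deriv \<Pi>]) encode_deriv" by (rule comp_v0)
    have 2: "data_snd (encode_deriv \<Pi>) = enc_steps (snd \<Pi>)" for \<Pi> :: "'a deriv"
      unfolding encode_deriv_eq by (rule data_snd.simps)
    show ?thesis using comp_Snd[OF 1] unfolding 2 .
  qed
  from comp_call[where \<phi> = snd, OF comps_Cons[OF this comps_Nil] comp_normal0]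
  have "computable UNIV (\<lambda>\<Pi>. [encode_deriv \<Pi>]) (\<lambda>\<Pi>. enc_ded (normal (snd \<Pi>)))" by (simp only: UNIV_I)
  then have "computable UNIV (\<lambda>\<Pi>. [encode_deriv \<Pi>]) (\<lambda>\<Pi>. Node (encode_form TT) (enc_steps (steps (normal (snd \<Pi>)))))"
    by (intro comp_Node comp_TT comp_steps)
  then show ?thesis by (rule comp_cong) (simp only: encode_deriv_eq fst_conv snd_conv)
qed

section \<open>Extraction of the program and the final time bound\<close>

lemma computable_program:
  assumes "computable UNIV (\<lambda>x. [e x]) g"
  shows "\<exists>P k. \<forall>x. \<exists>t. computes_in_time bar P (e x) (g x) t \<and> t \<le> bd k (data_size (e x))"
proof -
  obtain T where T: "qb UNIV (\<lambda>x. esz [e x]) T"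
    and ex: "\<And>off. \<exists>Q f. \<forall>pre post. length pre = off \<longrightarrow>
       (\<forall>x\<in>UNIV. \<exists>t\<le>T x. eval bar (pre @ Q @ post) [e x] f (g x) t)"
    using compE[OF assms] by blast
  \<comment> \<open>Compiled for offset 1, as index 0 is taken by \<open>f\<close> itself, the main
    function.\<close>
  obtain Q f where Q: "\<forall>pre post. length pre = 1 \<longrightarrow> (\<forall>x\<in>UNIV. \<exists>t\<le>T x. eval bar (pre @ Q @ post) [e x] f (g x) t)"
    using ex by blast
  have "qb UNIV (\<lambda>x. data_size (e x)) (\<lambda>x. data_size (e x) + T x + T x)" using T by (intro qb_intros) simp_all
  then obtain k where k: "\<And>x. data_size (e x) + T x + T x \<le> bd k (data_size (e x))" unfolding qb_def by blast
  have "\<exists>t. computes_in_time bar (f # Q) (e x) (g x) t \<and> t \<le> bd k (data_size (e x))" for x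
  proof -
    obtain t where t: "t \<le> T x" "eval bar (f # Q) [e x] f (g x) t" using Q[rule_format, of "[f]" x "[]"] by auto
    have "evals bar (f # Q) [e x] [Var 0] [e x] (data_size (e x))"
      using evals_Vars[of "[0]" "[e x]" bar "f # Q"] by simp
    then have "eval bar (f # Q) [e x] (Call 0 [Var 0]) (g x) (data_size (e x) + t + data_size (g x))"
      by (rule eval_evals.Call[rotated]) (use t in auto)
    moreover have "data_size (e x) + t + data_size (g x) \<le> bd k (data_size (e x))"
      using k[of x] t(1) eval_data_size(1)[OF t(2)] by linarith
    ultimately show ?thesis unfolding computes_in_time_def by blast
  qed
  then show ?thesis by blast
qed

end

text \<open>The summand 7 on the left is what a conjunction adds, which makes the induction close;
  the factor 10 then just covers the largest leaf, \<open>TT\<close>.\<close>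

lemma encode_form_size: "data_size (encode_form A) + 7 \<le> 10 * form_size A"
  by (induction A) (auto simp: data_size_tag)

lemma encode_deriv_size: "data_size (encode_deriv \<Pi>) \<le> 40 * deriv_size \<Pi>"
proof -
  have 1: "data_size (encode_list (\<lambda>(\<rho>, \<beta>). Node (encode_rule \<rho>) (encode_form \<beta>)) ss) \<le> 1 + 30 * (\<Sum>(\<rho>, \<beta>)\<leftarrow>ss. form_size \<beta>)" for ss :: "(rule \<times> 'a form) list"
  proof (induction ss)
    case (Cons x ss)
    obtain r A where x: "x = (r, A)" by (cases x)
    have "1 \<le> form_size A" by (induction A) auto
    then show ?case using Cons data_size_rule[where r = r and ?'a = 'a] encode_form_size[of A] by (simp add: x)
  qed simp
  show ?thesis
    using 1[of "snd \<Pi>"] encode_form_size[of "fst \<Pi>"] by (simp add: encode_deriv_def deriv_size_def)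
qed

text \<open>The required form has neither shift nor rounding, only a power of the real logarithm.
  For large \<open>n\<close> this logarithm exceeds \<open>k' + 2\<close>, so
  \<open>lg n + k'\<close> is at most twice the logarithm and hence at most its square.\<close>

lemma quasipolynomial_bd: "quasipolynomial (\<lambda>n. bd k (40 * n))"
proof -
  have "qb UNIV (\<lambda>n. n) (\<lambda>n. bd k (40 * n))" by (intro qb_intros)
  then obtain k' where k': "\<And>n. bd k (40 * n) \<le> bd k' n" by (auto simp: qb_def)
  have large: "\<forall>\<^sub>F n :: nat in sequentially. real k' + 2 < log 2 (real n)"
    using eventually_gt_at_top[of "2 ^ (k' + 2)"]
  proof eventually_elim
    case (elim n)
    have "2 powr (real k' + 2) = real (2 ^ (k' + 2))" using powr_realpow[of 2 "k' + 2"] by (simp add: add.commute)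
    also have "\<dots> < real n" using elim by (simp only: of_nat_less_iff)
    finally have "2 powr (real k' + 2) < real n" .
    moreover have "0 < real n" using elim by simp
    ultimately show ?case by (simp add: less_log_iff)
  qed
  have "\<forall>\<^sub>F n :: nat in sequentially. real (bd k (40 * n)) \<le> 2 powr (log 2 (real n) ^ (2 * k'))"
    using large eventually_gt_at_top[of 0]
  proof eventually_elim
    case (elim n)
    let ?x = "log 2 (real n)"
    have "lg n \<le> nat \<lceil>?x\<rceil>"
    proof -
      have "real n = 2 powr ?x" using elim by simp
      also have "\<dots> \<le> 2 powr real (nat \<lceil>?x\<rceil>)" by (intro powr_mono) linarith+
      also have "\<dots> = real (2 ^ nat \<lceil>?x\<rceil>)" by (simp add: powr_realpow)
      finally show ?thesis by (simp only: lg_le_iff of_nat_le_iff)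
    qed
    then have "real (lg n) \<le> ?x + 1" using elim by linarith
    then have "real (lg n + k') \<le> ?x * 2" using elim by simp
    also have "\<dots> \<le> ?x * ?x" using elim by (intro mult_left_mono) auto
    finally have "real (lg n + k') ^ k' \<le> (?x * ?x) ^ k'" by (intro power_mono) auto
    then have e: "real ((lg n + k') ^ k') \<le> ?x ^ (2 * k')" by (simp add: power_mult power2_eq_square)
    have "real (bd k (40 * n)) \<le> real (bd k' n)" using k' by simp
    also have "\<dots> = 2 powr real ((lg n + k') ^ k')" by (simp only: bd_def powr_realpow) simp
    also have "\<dots> \<le> 2 powr (?x ^ (2 * k'))" using e by (intro powr_mono) auto
    finally show ?case .
  qed
  then show ?thesis unfolding quasipolynomial_def by blast
qed

theorem theorem7p1:
  fixes bar :: "'a \<Rightarrow> 'a"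
  assumes "\<And>a. bar (bar a) = a"
    and "\<And>a. bar a \<noteq> a"
  shows "\<exists>(P :: program) (T :: nat \<Rightarrow> nat). quasipolynomial T \<and>
    (\<forall>(\<Pi> :: 'a deriv) \<alpha>. is_proof bar SKS \<Pi> \<alpha> \<longrightarrow>
      (\<exists>\<Pi>' t. is_proof bar aSKS \<Pi>' \<alpha> \<and>
        computes_in_time bar P (encode_deriv \<Pi>) (encode_deriv \<Pi>') t \<and>
        t \<le> T (deriv_size \<Pi>)))"
proof -
  interpret sks bar using assms by unfold_locales
  obtain P k where P: "\<And>\<Pi> :: 'a deriv. \<exists>t. computes_in_time bar P (encode_deriv \<Pi>) (encode_deriv (TT, steps (normal (snd \<Pi>)))) t \<and>
      t \<le> bd k (data_size (encode_deriv \<Pi>))"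
    using computable_program[OF comp_normal] by blast
  have "\<exists>\<Pi>' t. is_proof bar aSKS \<Pi>' \<alpha> \<and> computes_in_time bar P (encode_deriv \<Pi>) (encode_deriv \<Pi>') t \<and> t \<le> bd k (40 * deriv_size \<Pi>)"
    if "is_proof bar SKS \<Pi> \<alpha>" for \<Pi> :: "'a deriv" and \<alpha>
  proof -
    obtain t where t: "computes_in_time bar P (encode_deriv \<Pi>) (encode_deriv (TT, steps (normal (snd \<Pi>)))) t"
      "t \<le> bd k (data_size (encode_deriv \<Pi>))" using P by blast
    have "t \<le> bd k (40 * deriv_size \<Pi>)" using t(2) bd_mono[OF order_refl encode_deriv_size] le_trans by blast
    then show ?thesis using normal_proof[OF that] t(1) by blast
  qed
  then show ?thesis using quasipolynomial_bd[of k] by blast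
qed

end
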